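(* There is an algorithm that, on input a formula $\phi$ over the variable set $V$, halts in time linear in the length of $\phi$ and either returns that $\phi$ is not a local possibility integrity constraint, or produces sets $V_0,V_1,V_2$ witnessing that $\phi$ is a local possibility integrity constraint (i.e. satisfying the conditions in the definition below).
   Context: A clause is a disjunction of literals of pairwise distinct variables. A Horn clause has at most one positive literal. Renaming a set $W$ of variables means replacing every occurrence of $x$ by $\neg x$ and of $\neg x$ by $x$, for $x\in W$. A formula over $V$ is partially Horn with admissible set $V_0$ (a non-empty subset of $V$) if (i) every clause containing only variables from $V_0$ is Horn and (ii) variables of $V_0$ appear only negatively (if at all) in clauses that also contain variables not in $V_0$. For disjoint sets of variables $V,V'$, a $(V,V')$-generalized clause is an expression $(l_1\vee\cdots\vee l_s\vee(l_{s+1}\oplus\cdots\oplus l_t))$ with $s<t$, where $l_1,\ldots,l_s$ are literals of variables in $V$ and $l_{s+1},\ldots,l_t$ literals of variables in $V'$; it is falsified exactly by the assignments that falsify every $l_i$, $i\le s$, and satisfy an even number of $l_{s+1},\ldots,l_t$. A formula $\phi$ over $V$ is a local possibility integrity constraint (lpic) if there are three pairwise disjoint sets $V_0,V_1,V_2\subseteq V$ with $V_0\cup V_1\cup V_2=V$, such that no clause contains variables both from $V_1$ and $V_2$, and: (1) by renaming some variables of $V_0$ one obtains a partially Horn formula $\phi^*$ whose set of admissible variables is $V_0$; (2) every clause contains at most two variables from $V_1$; (3) the clauses containing variables from $V_2$ are $(V_0,V_2)$-generalized clauses. *)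

theory Defs
  imports Main
begin

section \<open>Formulas\<close>

datatype lit = Pos nat | Neg nat

fun lit_var :: "lit \<Rightarrow> nat" where
  "lit_var (Pos x) = x"
| "lit_var (Neg x) = x"

fun negate :: "lit \<Rightarrow> lit" where
  "negate (Pos x) = Neg x"
| "negate (Neg x) = Pos x"

text \<open>
  \<open>Clause [l1, ..., ls] [k1, ..., kr]\<close> is the expression
  \<open>l1 \<or> ... \<or> ls \<or> (k1 \<oplus> ... \<oplus> kr)\<close>; an ordinary clause is one with an empty \<open>\<oplus>\<close>-part.
\<close>

datatype clause = Clause (disj_part: "lit list") (xor_part: "lit list")

type_synonym formula = "clause list"

definition vars :: "lit list \<Rightarrow> nat set" where
  "vars ls = lit_var ` set ls"

definition clause_vars :: "clause \<Rightarrow> nat set" where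
  "clause_vars c = vars (disj_part c) \<union> vars (xor_part c)"

text \<open>
  A one-literal \<open>\<oplus>\<close>-part is the literal itself, so \<open>l1 \<or> ... \<or> ls \<or> (k)\<close> is the ordinary clause
  \<open>l1 \<or> ... \<or> ls \<or> k\<close>. It is always written as the latter, so that (up to the order of the
  literals) an expression has only one representation.
\<close>

definition clause_over :: "nat set \<Rightarrow> clause \<Rightarrow> bool" where
  "clause_over V c \<longleftrightarrow>
     clause_vars c \<subseteq> V \<and>
     distinct (map lit_var (disj_part c @ xor_part c)) \<and>
     length (xor_part c) \<noteq> 1"

definition formula_over :: "nat set \<Rightarrow> formula \<Rightarrow> bool" where
  "formula_over V \<phi> \<longleftrightarrow> (\<forall>c\<in>set \<phi>. clause_over V c)"

definition rename_lit :: "nat set \<Rightarrow> lit \<Rightarrow> lit" where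
  "rename_lit W l = (if lit_var l \<in> W then negate l else l)"

definition rename_clause :: "nat set \<Rightarrow> clause \<Rightarrow> clause" where
  "rename_clause W c =
     Clause (map (rename_lit W) (disj_part c)) (map (rename_lit W) (xor_part c))"

definition rename_formula :: "nat set \<Rightarrow> formula \<Rightarrow> formula" where
  "rename_formula W \<phi> = map (rename_clause W) \<phi>"

section \<open>Local possibility integrity constraints\<close>

definition horn_clause :: "clause \<Rightarrow> bool" where
  "horn_clause c \<longleftrightarrow> xor_part c = [] \<and> card {x. Pos x \<in> set (disj_part c)} \<le> 1"

text \<open>
  An occurrence inside a \<open>\<oplus>\<close>-part has no polarity (\<open>\<not>x \<oplus> y\<close> is \<open>x \<oplus> \<not>y\<close>), hence it never
  counts as negative.
\<close>

definition only_negative_in :: "nat \<Rightarrow> clause \<Rightarrow> bool" where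
  "only_negative_in x c \<longleftrightarrow> Pos x \<notin> set (disj_part c) \<and> x \<notin> vars (xor_part c)"

definition partially_horn :: "nat set \<Rightarrow> formula \<Rightarrow> nat set \<Rightarrow> bool" where
  "partially_horn V \<phi> V0 \<longleftrightarrow>
     V0 \<noteq> {} \<and> V0 \<subseteq> V \<and>
     (\<forall>c\<in>set \<phi>. clause_vars c \<subseteq> V0 \<longrightarrow> horn_clause c) \<and>
     (\<forall>c\<in>set \<phi>. \<not> clause_vars c \<subseteq> V0 \<longrightarrow> (\<forall>x\<in>V0. only_negative_in x c))"

text \<open>
  By the identification of \<open>(k)\<close> with \<open>k\<close>, an ordinary clause is generalized if some literal of it
  can serve as the \<open>\<oplus>\<close>-part.
\<close>

definition generalized_clause :: "nat set \<Rightarrow> nat set \<Rightarrow> clause \<Rightarrow> bool" where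
  "generalized_clause V V' c \<longleftrightarrow>
     (xor_part c \<noteq> [] \<and> vars (disj_part c) \<subseteq> V \<and> vars (xor_part c) \<subseteq> V') \<or>
     (xor_part c = [] \<and>
        (\<exists>k\<in>set (disj_part c).
           lit_var k \<in> V' \<and> (\<forall>l\<in>set (disj_part c) - {k}. lit_var l \<in> V)))"

definition lpic_partition ::
    "nat set \<Rightarrow> formula \<Rightarrow> nat set \<Rightarrow> nat set \<Rightarrow> nat set \<Rightarrow> bool" where
  "lpic_partition V \<phi> V0 V1 V2 \<longleftrightarrow>
     V0 \<inter> V1 = {} \<and> V0 \<inter> V2 = {} \<and> V1 \<inter> V2 = {} \<and> V0 \<union> V1 \<union> V2 = V \<and>
     (\<forall>c\<in>set \<phi>. clause_vars c \<inter> V1 = {} \<or> clause_vars c \<inter> V2 = {}) \<and>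
     (\<forall>c\<in>set \<phi>. card (clause_vars c \<inter> V1) \<le> 2) \<and>
     (\<forall>c\<in>set \<phi>. clause_vars c \<inter> V2 \<noteq> {} \<longrightarrow> generalized_clause V0 V2 c)"

definition lpic_witness ::
    "nat set \<Rightarrow> formula \<Rightarrow> nat set \<Rightarrow> nat set \<Rightarrow> nat set \<Rightarrow> bool" where
  "lpic_witness V \<phi> V0 V1 V2 \<longleftrightarrow>
     lpic_partition V \<phi> V0 V1 V2 \<and>
     (\<exists>W\<subseteq>V0. partially_horn V (rename_formula W \<phi>) V0)"

text \<open>
  Since admissible sets are non-empty, \<open>lpic_witness\<close> forces \<open>V0 \<noteq> {}\<close>. In the following reading the
  condition on \<open>V0\<close> is void for \<open>V0 = {}\<close>, so that for example every conjunction of two-literal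
  clauses (\<open>V1 = V\<close>) and every system of \<open>\<oplus>\<close>-clauses (\<open>V2 = V\<close>) qualifies.
\<close>

definition lpic_witness_empty_ok ::
    "nat set \<Rightarrow> formula \<Rightarrow> nat set \<Rightarrow> nat set \<Rightarrow> nat set \<Rightarrow> bool" where
  "lpic_witness_empty_ok V \<phi> V0 V1 V2 \<longleftrightarrow>
     lpic_partition V \<phi> V0 V1 V2 \<and>
     (V0 = {} \<or> (\<exists>W\<subseteq>V0. partially_horn V (rename_formula W \<phi>) V0))"

section \<open>Algorithms and their running time\<close>

text \<open>
  The machine model is a unit-cost random access machine with structured control flow, whose memory
  consists of registers and of arrays (both named by natural numbers, all cells initially \<open>0\<close>
  except for the input). A program mentions only finitely many registers and arrays. The only
  arithmetic is increment and decrement: the numbers in memory exceed the input words and the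
  constants of the program by at most the elapsed time, so that charging one unit per operation
  hides no large computations.
\<close>

datatype test = Less nat nat | Equal nat nat

datatype prog =
    Assign nat nat            (* register := constant *)
  | Copy nat nat              (* register := register *)
  | Inc nat
  | Dec nat
  | Read nat nat nat          (* \<open>Read r a i\<close>: register r := array a [register i] *)
  | Write nat nat nat         (* \<open>Write a i r\<close>: array a [register i] := register r *)
  | Seq prog prog
  | If test prog prog
  | While test prog

record state =
  reg :: "nat \<Rightarrow> nat"
  arr :: "nat \<Rightarrow> nat \<Rightarrow> nat"

fun holds :: "test \<Rightarrow> state \<Rightarrow> bool" where
  "holds (Less r q) s \<longleftrightarrow> reg s r < reg s q"
| "holds (Equal r q) s \<longleftrightarrow> reg s r = reg s q"

definition set_reg :: "nat \<Rightarrow> nat \<Rightarrow> state \<Rightarrow> state" where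
  "set_reg r v s = s\<lparr>reg := (reg s)(r := v)\<rparr>"

definition set_arr :: "nat \<Rightarrow> nat \<Rightarrow> nat \<Rightarrow> state \<Rightarrow> state" where
  "set_arr a i v s = s\<lparr>arr := (arr s)(a := (arr s a)(i := v))\<rparr>"

text \<open>\<open>exec p s t s'\<close>: started in \<open>s\<close>, the program \<open>p\<close> halts in \<open>s'\<close> after exactly \<open>t\<close> steps.\<close>

inductive exec :: "prog \<Rightarrow> state \<Rightarrow> nat \<Rightarrow> state \<Rightarrow> bool" where
  Assign: "exec (Assign r v) s 1 (set_reg r v s)"
| Copy: "exec (Copy r q) s 1 (set_reg r (reg s q) s)"
| Inc: "exec (Inc r) s 1 (set_reg r (reg s r + 1) s)"
| Dec: "exec (Dec r) s 1 (set_reg r (reg s r - 1) s)"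
| Read: "exec (Read r a i) s 1 (set_reg r (arr s a (reg s i)) s)"
| Write: "exec (Write a i r) s 1 (set_arr a (reg s i) (reg s r) s)"
| Seq: "exec p s t s' \<Longrightarrow> exec q s' u s'' \<Longrightarrow> exec (Seq p q) s (t + u) s''"
| IfTrue: "holds b s \<Longrightarrow> exec p s t s' \<Longrightarrow> exec (If b p q) s (t + 1) s'"
| IfFalse: "\<not> holds b s \<Longrightarrow> exec q s t s' \<Longrightarrow> exec (If b p q) s (t + 1) s'"
| WhileTrue: "holds b s \<Longrightarrow> exec p s t s' \<Longrightarrow> exec (While b p) s' u s'' \<Longrightarrow>
    exec (While b p) s (t + u + 1) s''"
| WhileFalse: "\<not> holds b s \<Longrightarrow> exec (While b p) s 1 s"

lemma exec_deterministic:
  "exec p s t s' \<Longrightarrow> exec p s u s'' \<Longrightarrow> u = t \<and> s'' = s'"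
proof (induction arbitrary: u s'' rule: exec.induct)
  case (Seq p s t s' q v s1)
  from Seq.prems show ?case by cases (use Seq.IH in blast)
next
  case (IfTrue b s p t s' q)
  from IfTrue.prems show ?case by cases (use IfTrue in blast)+
next
  case (IfFalse b s q t s' p)
  from IfFalse.prems show ?case by cases (use IfFalse in blast)+
next
  case (WhileTrue b s p t s' v s1)
  from WhileTrue.prems show ?case by cases (use WhileTrue in blast)+
next
  case (WhileFalse b s p)
  from WhileFalse.prems show ?case by cases (use WhileFalse in blast)+
qed (auto elim: exec.cases)

section \<open>Input and output\<close>

text \<open>
  The input is a formula over \<open>V = {..<n}\<close>. Variables of \<open>V\<close> need not occur in the formula but have
  to be placed in one of the output sets, and clauses may be empty; therefore \<open>n\<close> and the number of
  clauses are part of the length. If every variable occurs and no clause is empty, the length is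
  at most three times the number of literal occurrences.
\<close>

definition formula_length :: "nat \<Rightarrow> formula \<Rightarrow> nat" where
  "formula_length n \<phi> = n + (\<Sum>c\<leftarrow>\<phi>. 1 + length (disj_part c) + length (xor_part c))"

fun encode_lit :: "lit \<Rightarrow> nat" where
  "encode_lit (Pos x) = 2 * x"
| "encode_lit (Neg x) = 2 * x + 1"

definition encode_clause :: "clause \<Rightarrow> nat list" where
  "encode_clause c =
     length (disj_part c) # map encode_lit (disj_part c) @
     length (xor_part c) # map encode_lit (xor_part c)"

definition encode_formula :: "nat \<Rightarrow> formula \<Rightarrow> nat list" where
  "encode_formula n \<phi> = n # length \<phi> # concat (map encode_clause \<phi>)"

text \<open>The input is in array 0.\<close>

definition input_state :: "nat \<Rightarrow> formula \<Rightarrow> state" where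
  "input_state n \<phi> =
     (let w = encode_formula n \<phi> in
      \<lparr>reg = (\<lambda>_. 0),
       arr = (\<lambda>a i. if a = 0 \<and> i < length w then w ! i else 0)\<rparr>)"

text \<open>
  Register 0 holds the answer (\<open>0\<close> for ``not an lpic''), and array 1 maps each variable to the index
  of the set containing it.
\<close>

definition output_set :: "nat \<Rightarrow> state \<Rightarrow> nat \<Rightarrow> nat set" where
  "output_set n s j = {x. x < n \<and> arr s 1 x = j}"

definition finds_witness_in_linear_time ::
    "prog \<Rightarrow> (nat set \<Rightarrow> formula \<Rightarrow> nat set \<Rightarrow> nat set \<Rightarrow> nat set \<Rightarrow> bool) \<Rightarrow> bool" where
  "finds_witness_in_linear_time p witness \<longleftrightarrow>
     (\<exists>k. \<forall>n \<phi>. formula_over {..<n} \<phi> \<longrightarrow>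
        (\<exists>t s. exec p (input_state n \<phi>) t s \<and>
           t \<le> k * (formula_length n \<phi> + 1) \<and>
           (if reg s 0 = 0
            then \<not> (\<exists>V0 V1 V2. witness {..<n} \<phi> V0 V1 V2)
            else witness {..<n} \<phi> (output_set n s 0) (output_set n s 1) (output_set n s 2))))"

end

(*
  Renaming W inside V0 amounts to choosing the set S of literals that become negative.  V0 is
  admissible iff S is consistent, closed under the implications ~l -> k for distinct literals l, k of
  the disjunctive part of a clause, and avoids certain forbidden literals (those whose variable is
  under a xor, and the complements of the literals accompanying a xor).  Being closed under
  contraposition, these implications behave as in 2-SAT: if L is the closure of the complements of
  the forbidden literals and of the complements of the literals that imply their own complement, the
  variables occurring in L with both signs are exactly those that no admissible S contains, and the
  other ones form the greatest V0.  A greater V0 only relaxes the remaining conditions; given V0, the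
  set V2 has to contain the variables of all xors of length at least 3 and to be closed under the
  xors of length 2, and the least such V2 works if any does.

  For linear time, a clause contributes a chain of auxiliary nodes instead of quadratically many
  implications, and the searches from an undecided literal and from its complement run in lockstep
  until the first of them is exhausted.  If its result is consistent, it is added to L; otherwise the
  other search is completed and added.  Either way at least half of the work done is paid for by
  nodes that are added to L for good.
*)

theory Submission
  imports Defs
begin

section \<open>Literals that can be made negative\<close>

text \<open>The closure of all self-refuting literals is never computed as such. L grows under the
  weaker invariant \<open>marking\<close>: L is closed, contains the complements of the forbidden
  literals, and no admissible set contains a literal that L has with both signs. A consistent
  extension is harmless even if its choice of sign was arbitrary. Once every variable has a literal
  in L, the literals of L whose complement is missing form an admissible set; so the upper bound on
  V0 given by the invariant is attained. Contraposition enters in one form only: the dual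
  \<open>{l. negate l \<notin> S}\<close> of a closed S is closed. Links between xor variables are
  nodes of the same graph. The initial search thus yields the least V2 together with the least
  forced L, and later searches add no link nodes. The machine shapes the program. It cannot add, so
  node numbers come from tables filled by counting. It cannot clear an array in one step, so visited
  flags are increasing stamps. Nodes have two out-edges, so that a search step takes constant time
  and two searches can be interleaved fairly. Fresh nodes are counted against elapsed time, which
  bounds the graph without a separate count.\<close>

lemma negate_negate [simp]: "negate (negate l) = l"
  by (cases l) auto

lemma lit_var_negate [simp]: "lit_var (negate l) = lit_var l"
  by (cases l) auto

lemma negate_neq [simp]: "negate l \<noteq> l" "l \<noteq> negate l"
  by (cases l; auto)+

lemma lit_var_eq_iff: "lit_var l = lit_var k \<longleftrightarrow> k = l \<or> k = negate l"
  by (cases l; cases k) auto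

text \<open>S is the set of literals that become negative. If \<open>negate l\<close> becomes
  negative, then \<open>l\<close> becomes positive; a clause with a positive V0-literal has to lie
  inside V0 and to be Horn, so all its other literals become negative.\<close>

definition imp_closed :: "formula \<Rightarrow> lit set \<Rightarrow> bool" where
  "imp_closed \<phi> S \<longleftrightarrow>
     (\<forall>c\<in>set \<phi>. \<forall>l\<in>set (disj_part c). \<forall>k\<in>set (disj_part c). l \<noteq> k \<longrightarrow> negate l \<in> S \<longrightarrow> k \<in> S)"

lemma imp_closedD:
  "imp_closed \<phi> S \<Longrightarrow> c \<in> set \<phi> \<Longrightarrow> l \<in> set (disj_part c) \<Longrightarrow> k \<in> set (disj_part c) \<Longrightarrow> l \<noteq> k \<Longrightarrow>
    negate l \<in> S \<Longrightarrow> k \<in> S"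
  by (simp add: imp_closed_def)

text \<open>A clause with a xor is never Horn, so it must stick out of V0. Then its V0-literals have
  to be negative, which forbids the complements of its disjunctive literals, and its xor variables
  have to stay outside V0, which forbids both of their signs.\<close>

definition forbidden :: "formula \<Rightarrow> lit set" where
  "forbidden \<phi> = {l. \<exists>c\<in>set \<phi>. xor_part c \<noteq> [] \<and>
     (negate l \<in> set (disj_part c) \<or> l \<in> set (xor_part c) \<or> negate l \<in> set (xor_part c))}"

lemma forbidden_xor:
  assumes "c \<in> set \<phi>" "l \<in> set (xor_part c)"
  shows "l \<in> forbidden \<phi>" "negate l \<in> forbidden \<phi>"
proof -
  have "xor_part c \<noteq> []" using assms(2) by auto
  with assms show "l \<in> forbidden \<phi>" "negate l \<in> forbidden \<phi>"
    unfolding forbidden_def by auto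
qed

definition admissible :: "formula \<Rightarrow> lit set \<Rightarrow> bool" where
  "admissible \<phi> S \<longleftrightarrow> (\<forall>l\<in>S. negate l \<notin> S) \<and> imp_closed \<phi> S \<and> S \<inter> forbidden \<phi> = {}"

lemma imp_closed_Un: "imp_closed \<phi> S \<Longrightarrow> imp_closed \<phi> S' \<Longrightarrow> imp_closed \<phi> (S \<union> S')"
  unfolding imp_closed_def by blast

lemma imp_closed_UNIV: "imp_closed \<phi> UNIV"
  unfolding imp_closed_def by blast

text \<open>The implications \<open>\<not>l \<rightarrow> k\<close> and \<open>\<not>k \<rightarrow> l\<close> are contrapositives of each other.\<close>

lemma imp_closed_dual: "imp_closed \<phi> S \<Longrightarrow> imp_closed \<phi> {l. negate l \<notin> S}"
  unfolding imp_closed_def by (metis mem_Collect_eq negate_negate)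

section \<open>Renamings versus admissible sets of literals\<close>

definition is_neg :: "lit \<Rightarrow> bool" where
  "is_neg l \<longleftrightarrow> (\<exists>x. l = Neg x)"

lemma is_neg_simps [simp]: "is_neg (Neg x)" "\<not> is_neg (Pos x)"
  by (auto simp: is_neg_def)

lemma is_neg_negate [simp]: "is_neg (negate l) \<longleftrightarrow> \<not> is_neg l"
  by (cases l) auto

lemma not_is_neg: "\<not> is_neg l \<longleftrightarrow> l = Pos (lit_var l)"
  by (cases l) auto

lemma lit_var_rename [simp]: "lit_var (rename_lit W l) = lit_var l"
  by (simp add: rename_lit_def)

lemma vars_rename [simp]: "vars (map (rename_lit W) ls) = vars ls"
  by (simp add: vars_def image_image)

lemma clause_vars_rename [simp]: "clause_vars (rename_clause W c) = clause_vars c"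
  by (simp add: clause_vars_def rename_clause_def)

lemma Pos_mem_rename:
  "Pos x \<in> set (map (rename_lit W) ls) \<longleftrightarrow> (\<exists>l\<in>set ls. lit_var l = x \<and> \<not> is_neg (rename_lit W l))"
proof -
  have "Pos x = rename_lit W l \<longleftrightarrow> lit_var l = x \<and> \<not> is_neg (rename_lit W l)" for l
    unfolding not_is_neg by (metis lit_var.simps(1) lit_var_rename)
  then show ?thesis by auto
qed

lemma var_inj:
  assumes "distinct (map lit_var ls)" "l \<in> set ls" "k \<in> set ls" "lit_var l = lit_var k"
  shows "l = k"
  using assms by (metis distinct_map inj_onD)

text \<open>\<open>horn_clause\<close> counts variables whereas \<open>imp_closed\<close> compares
  literals; pairwise distinct variables make the two agree.\<close>

lemma card_pos_rename:
  assumes "distinct (map lit_var ls)"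
  shows "card {x. Pos x \<in> set (map (rename_lit W) ls)} \<le> 1 \<longleftrightarrow>
    (\<forall>l\<in>set ls. \<forall>k\<in>set ls. \<not> is_neg (rename_lit W l) \<longrightarrow> \<not> is_neg (rename_lit W k) \<longrightarrow> l = k)"
proof -
  let ?A = "{x. Pos x \<in> set (map (rename_lit W) ls)}"
  have eq: "?A = lit_var ` {l\<in>set ls. \<not> is_neg (rename_lit W l)}"
    unfolding Pos_mem_rename by auto
  have fin: "finite ?A" unfolding eq by simp
  have "card ?A \<le> 1 \<longleftrightarrow> (\<forall>x\<in>?A. \<forall>y\<in>?A. x = y)"
    using card_le_Suc0_iff_eq[OF fin] by simp
  then show ?thesis unfolding eq using var_inj[OF assms] by auto
qed

lemma partially_horn_imp_admissible:
  assumes \<phi>: "formula_over {..<n} \<phi>" and W: "W \<subseteq> V0"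
    and horn: "partially_horn {..<n} (rename_formula W \<phi>) V0"
  defines "S \<equiv> {l. lit_var l \<in> V0 \<and> is_neg (rename_lit W l)}"
  shows "admissible \<phi> S \<and> lit_var ` S = V0"
proof -
  have neg_rename: "rename_lit W (negate l) = negate (rename_lit W l)" for l
    by (simp add: rename_lit_def)
  have inside: "horn_clause (rename_clause W c)" if "c \<in> set \<phi>" "clause_vars c \<subseteq> V0" for c
    using horn that by (auto simp: partially_horn_def rename_formula_def)
  have outside: "only_negative_in x (rename_clause W c)"
    if "c \<in> set \<phi>" "\<not> clause_vars c \<subseteq> V0" "x \<in> V0" for c x
    using horn that by (auto simp: partially_horn_def rename_formula_def)
  \<comment> \<open>Inside V0 such a clause would not be Horn, and outside it the variable would not
    occur only negatively.\<close>
  have xor: "lit_var l \<notin> V0" if "c \<in> set \<phi>" "l \<in> set (xor_part c)" for c l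
  proof
    assume "lit_var l \<in> V0"
    moreover have "lit_var l \<in> vars (xor_part c)" "xor_part c \<noteq> []"
      using that(2) by (auto simp: vars_def)
    ultimately show False
      using inside[OF that(1)] outside[OF that(1), of "lit_var l"]
      by (auto simp: horn_clause_def only_negative_in_def rename_clause_def)
  qed
  \<comment> \<open>\<open>l\<close> is positive after the renaming, which condition (ii) rules out
    unless the whole clause lies in V0.\<close>
  have pos: "clause_vars c \<subseteq> V0 \<and> xor_part c = []"
    if "c \<in> set \<phi>" "l \<in> set (disj_part c)" "negate l \<in> S" for c l
  proof -
    have "lit_var l \<in> V0" "\<not> is_neg (rename_lit W l)"
      using that(3) by (auto simp: S_def neg_rename)
    then have "\<not> only_negative_in (lit_var l) (rename_clause W c)"
      using that(2) Pos_mem_rename[of "lit_var l" W "disj_part c"]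
      by (auto simp: only_negative_in_def rename_clause_def)
    then have "clause_vars c \<subseteq> V0" using outside that(1) \<open>lit_var l \<in> V0\<close> by blast
    with inside[OF that(1)] show ?thesis
      by (auto simp: horn_clause_def rename_clause_def)
  qed
  have "imp_closed \<phi> S"
    unfolding imp_closed_def
  proof (intro ballI impI)
    fix c l k
    assume *: "c \<in> set \<phi>" "l \<in> set (disj_part c)" "k \<in> set (disj_part c)" "l \<noteq> k" "negate l \<in> S"
    note p = pos[OF *(1,2,5)]
    have d: "distinct (map lit_var (disj_part c))"
      using \<phi> *(1) by (auto simp: formula_over_def clause_over_def)
    have "card {x. Pos x \<in> set (map (rename_lit W) (disj_part c))} \<le> 1"
      using inside[OF *(1)] p by (simp add: horn_clause_def rename_clause_def)
    then have "is_neg (rename_lit W k)"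
      using card_pos_rename[OF d] *(2-5) by (auto simp: S_def neg_rename)
    moreover have "lit_var k \<in> V0"
      using p *(3) by (auto simp: clause_vars_def vars_def)
    ultimately show "k \<in> S" by (simp add: S_def)
  qed
  moreover have "S \<inter> forbidden \<phi> = {}"
  proof -
    have False if l: "l \<in> S" "c \<in> set \<phi>" "xor_part c \<noteq> []" and
      "negate l \<in> set (disj_part c) \<or> l \<in> set (xor_part c) \<or> negate l \<in> set (xor_part c)" for l c
      using that(4) pos[OF l(2), of "negate l"] xor[OF l(2), of l] xor[OF l(2), of "negate l"] l(1,3)
      by (auto simp: S_def)
    then show ?thesis unfolding forbidden_def by blast
  qed
  moreover have "\<forall>l\<in>S. negate l \<notin> S"
    by (auto simp: S_def neg_rename)
  moreover have "lit_var ` S = V0"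
  proof
    show "V0 \<subseteq> lit_var ` S"
    proof
      fix x assume "x \<in> V0"
      show "x \<in> lit_var ` S"
      proof (cases "x \<in> W")
        case True
        then have "Pos x \<in> S" using \<open>x \<in> V0\<close> by (simp add: S_def rename_lit_def)
        then show ?thesis by force
      next
        case False
        then have "Neg x \<in> S" using \<open>x \<in> V0\<close> by (simp add: S_def rename_lit_def)
        then show ?thesis by force
      qed
    qed
  qed (auto simp: S_def)
  ultimately show ?thesis by (simp add: admissible_def)
qed

lemma admissible_imp_partially_horn:
  assumes \<phi>: "formula_over {..<n} \<phi>" and adm: "admissible \<phi> S"
    and V0: "lit_var ` S = V0" "V0 \<noteq> {}" "V0 \<subseteq> {..<n}"
  shows "\<exists>W\<subseteq>V0. partially_horn {..<n} (rename_formula W \<phi>) V0"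
proof (intro exI conjI)
  \<comment> \<open>A variable has to be flipped exactly if its positive literal is the one chosen
    to become negative.\<close>
  let ?W = "{x. Pos x \<in> S}"
  show "?W \<subseteq> V0" using V0(1) by force
  have cons: "negate l \<notin> S" if "l \<in> S" for l
    using adm that by (auto simp: admissible_def)
  have ic: "imp_closed \<phi> S" using adm by (simp add: admissible_def)
  have S_iff: "is_neg (rename_lit ?W l) \<longleftrightarrow> l \<in> S" if lV: "lit_var l \<in> V0" for l
  proof (cases l)
    case (Pos x)
    then show ?thesis by (simp add: rename_lit_def)
  next
    case (Neg x)
    from lV obtain k where k: "k \<in> S" "lit_var k = lit_var l" using V0(1) by auto
    then have "k = Pos x \<or> k = Neg x" using Neg by (cases k) auto
    with k(1) Neg show ?thesis using cons[of "Pos x"] cons[of "Neg x"] by (auto simp: rename_lit_def)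
  qed
  have neg_mem: "negate l \<in> S" if "lit_var l \<in> V0" "l \<notin> S" for l
  proof -
    from that(1) obtain k where "k \<in> S" "lit_var l = lit_var k" using V0(1) by auto
    then show ?thesis using that(2) by (auto simp: lit_var_eq_iff)
  qed
  have xor: "lit_var l \<notin> V0" if c: "c \<in> set \<phi>" "l \<in> set (xor_part c)" for c l
  proof
    assume "lit_var l \<in> V0"
    then have "l \<in> S \<or> negate l \<in> S" using neg_mem by blast
    moreover note forbidden_xor[OF c]
    ultimately show False using adm by (auto simp: admissible_def)
  qed
  \<comment> \<open>The complement of \<open>l\<close> lies in S, so closure puts all other literals
    of the clause into S: the clause lies inside V0 and \<open>l\<close> is its only positive
    literal.\<close>
  have pos: "clause_vars c \<subseteq> V0 \<and> xor_part c = [] \<and> (\<forall>k\<in>set (disj_part c). k \<noteq> l \<longrightarrow> k \<in> S)"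
    if c: "c \<in> set \<phi>" "l \<in> set (disj_part c)" "lit_var l \<in> V0" "l \<notin> S" for c l
  proof -
    have n: "negate l \<in> S" using neg_mem c by blast
    then have "negate l \<notin> forbidden \<phi>" using adm by (auto simp: admissible_def)
    then have x: "xor_part c = []" using c by (auto simp: forbidden_def)
    have k: "\<forall>k\<in>set (disj_part c). k \<noteq> l \<longrightarrow> k \<in> S"
      using imp_closedD[OF ic c(1,2) _ _ n] by blast
    have "lit_var k \<in> V0" if "k \<in> set (disj_part c)" for k
      using k that c(3) V0(1) by (cases "k = l") auto
    then have "clause_vars c \<subseteq> V0"
      using x by (auto simp: clause_vars_def vars_def)
    with x k show ?thesis by blast
  qed
  show "partially_horn {..<n} (rename_formula ?W \<phi>) V0"
    unfolding partially_horn_def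
  proof (intro conjI ballI impI)
    fix c' assume "c' \<in> set (rename_formula ?W \<phi>)" and sub: "clause_vars c' \<subseteq> V0"
    then obtain c where c: "c \<in> set \<phi>" "c' = rename_clause ?W c"
      by (auto simp: rename_formula_def)
    have d: "distinct (map lit_var (disj_part c))"
      using \<phi> c(1) by (auto simp: formula_over_def clause_over_def)
    have sub: "clause_vars c \<subseteq> V0" using sub c(2) by simp
    have "xor_part c = []"
      using xor[OF c(1)] sub by (cases "xor_part c") (auto simp: clause_vars_def vars_def)
    moreover have "lit_var l \<in> V0" if "l \<in> set (disj_part c)" for l
      using sub that by (auto simp: clause_vars_def vars_def)
    then have "\<forall>l\<in>set (disj_part c). \<forall>k\<in>set (disj_part c).
        \<not> is_neg (rename_lit ?W l) \<longrightarrow> \<not> is_neg (rename_lit ?W k) \<longrightarrow> l = k"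
      using pos[OF c(1)] S_iff by metis
    then have "card {x. Pos x \<in> set (map (rename_lit ?W) (disj_part c))} \<le> 1"
      using card_pos_rename[OF d] by blast
    ultimately show "horn_clause c'"
      by (simp add: c(2) horn_clause_def rename_clause_def)
  next
    fix c' x assume "c' \<in> set (rename_formula ?W \<phi>)" and sub: "\<not> clause_vars c' \<subseteq> V0" and x: "x \<in> V0"
    then obtain c where c: "c \<in> set \<phi>" "c' = rename_clause ?W c"
      by (auto simp: rename_formula_def)
    have sub: "\<not> clause_vars c \<subseteq> V0" using sub c(2) by simp
    have "x \<notin> vars (xor_part c)" using xor[OF c(1)] x by (auto simp: vars_def)
    moreover have "Pos x \<notin> set (map (rename_lit ?W) (disj_part c))"
      unfolding Pos_mem_rename using pos[OF c(1)] S_iff sub x by blast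
    ultimately show "only_negative_in x c'"
      by (simp add: c(2) only_negative_in_def rename_clause_def)
  qed (use V0 in auto)
qed

text \<open>The empty set of literals is admissible, so the case \<open>V0 = {}\<close>, which
  \<open>partially_horn\<close> rejects, needs no separate treatment on the right-hand side.\<close>

lemma empty_ok_iff:
  assumes "formula_over {..<n} \<phi>"
  shows "lpic_witness_empty_ok {..<n} \<phi> V0 V1 V2 \<longleftrightarrow>
    lpic_partition {..<n} \<phi> V0 V1 V2 \<and> (\<exists>S. admissible \<phi> S \<and> lit_var ` S = V0)"
proof -
  have "admissible \<phi> {} \<and> lit_var ` {} = {}" by (auto simp: admissible_def imp_closed_def)
  moreover have "V0 \<subseteq> {..<n}" if "lpic_partition {..<n} \<phi> V0 V1 V2"
    using that by (auto simp: lpic_partition_def)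
  moreover have "\<exists>S. admissible \<phi> S \<and> lit_var ` S = V0"
    if "\<exists>W\<subseteq>V0. partially_horn {..<n} (rename_formula W \<phi>) V0"
    using that partially_horn_imp_admissible[OF assms] by blast
  moreover note admissible_imp_partially_horn[OF assms, of _ V0]
  ultimately show ?thesis
    unfolding lpic_witness_empty_ok_def by blast
qed

text \<open>Because of this, one algorithm serves both readings; only the final answer has to look
  at whether the greatest V0 is empty.\<close>

lemma witness_iff:
  "lpic_witness V \<phi> V0 V1 V2 \<longleftrightarrow> V0 \<noteq> {} \<and> lpic_witness_empty_ok V \<phi> V0 V1 V2"
  unfolding lpic_witness_def lpic_witness_empty_ok_def partially_horn_def by blast

text \<open>Necessary conditions on V2. Xor variables are outside V0, and no clause mixes V1 and V2,
  so a xor lies entirely in one of the two; V1 has room for at most two of its variables.\<close>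

definition link_closed :: "formula \<Rightarrow> nat set \<Rightarrow> bool" where
  "link_closed \<phi> Z \<longleftrightarrow> (\<forall>c\<in>set \<phi>. \<forall>x\<in>vars (xor_part c). \<forall>y\<in>vars (xor_part c).
     2 < length (xor_part c) \<or> x \<in> Z \<longrightarrow> y \<in> Z)"

text \<open>The form is chosen so that the dual \<open>{l. negate l \<notin> S}\<close> of every
  admissible S is forced. A least forced set is therefore contained in all these duals.\<close>

definition forced :: "formula \<Rightarrow> lit set \<Rightarrow> bool" where
  "forced \<phi> L \<longleftrightarrow> imp_closed \<phi> L \<and> negate ` forbidden \<phi> \<subseteq> L"

text \<open>The last conjunct is the upper bound for V0; that it is attained follows once every
  variable is marked with some sign (\<open>marked_admissible\<close>).\<close>

definition marking :: "formula \<Rightarrow> lit set \<Rightarrow> nat set \<Rightarrow> bool" where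
  "marking \<phi> L Z \<longleftrightarrow> forced \<phi> L \<and> link_closed \<phi> Z \<and>
     (\<forall>Z'. link_closed \<phi> Z' \<longrightarrow> Z \<subseteq> Z') \<and>
     (\<forall>S. admissible \<phi> S \<longrightarrow> (\<forall>l\<in>S. \<not> (l \<in> L \<and> negate l \<in> L)))"

definition doubly :: "lit set \<Rightarrow> nat set" where
  "doubly L = {x. Pos x \<in> L \<and> Neg x \<in> L}"

lemma doubly_lit_var: "lit_var l \<in> doubly L \<longleftrightarrow> l \<in> L \<and> negate l \<in> L"
  by (cases l) (auto simp: doubly_def)

text \<open>The literals that no choice of V0 can absorb.\<close>

definition rest :: "lit set \<Rightarrow> clause \<Rightarrow> lit list" where
  "rest L c = filter (\<lambda>l. lit_var l \<in> doubly L) (disj_part c)"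

text \<open>A xor has at least two variables, all in V1 or all in V2; a further variable outside V0
  would exceed the limit for V1 or violate the shape of a generalized clause. Without a xor, two
  variables outside V0 must both be in V1, since a generalized clause then has a single
  V2-literal.\<close>

definition clause_ok :: "lit set \<Rightarrow> nat set \<Rightarrow> clause \<Rightarrow> bool" where
  "clause_ok L Z c \<longleftrightarrow>
     (if xor_part c \<noteq> [] then rest L c = []
      else length (rest L c) \<le> 2 \<and> (length (rest L c) = 2 \<longrightarrow> vars (rest L c) \<inter> Z = {}))"

text \<open>The dual of an admissible S is forced and so contains the least forced L; hence no
  literal of S has its complement in L.\<close>

lemma marking_start:
  assumes "forced \<phi> L" "link_closed \<phi> Z"
    and least: "\<And>L' Z'. forced \<phi> L' \<Longrightarrow> link_closed \<phi> Z' \<Longrightarrow> L \<subseteq> L' \<and> Z \<subseteq> Z'"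
  shows "marking \<phi> L Z"
proof -
  have "l \<notin> L \<or> negate l \<notin> L" if S: "admissible \<phi> S" "l \<in> S" for S l
  proof -
    have "forced \<phi> {l. negate l \<notin> S}"
      using S(1) imp_closed_dual by (auto simp: forced_def admissible_def)
    then have "L \<subseteq> {l. negate l \<notin> S}" using least assms(2) by blast
    then show ?thesis using S(2) by auto
  qed
  then show ?thesis using assms unfolding marking_def by blast
qed

text \<open>A search does not enter what L already contains. Its result D is therefore closed only
  together with L, but it still lies in every closed set containing \<open>l\<close>.\<close>

definition least_extension :: "formula \<Rightarrow> lit set \<Rightarrow> lit \<Rightarrow> lit set \<Rightarrow> bool" where
  "least_extension \<phi> L l D \<longleftrightarrow> imp_closed \<phi> (L \<union> D) \<and> l \<in> D \<and> (\<forall>S. imp_closed \<phi> S \<longrightarrow> l \<in> S \<longrightarrow> D \<subseteq> S)"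

text \<open>The dual of L is closed and contains \<open>l\<close>, hence it contains D.\<close>

lemma least_extension_disjoint:
  assumes "forced \<phi> L" "least_extension \<phi> L l D" "negate l \<notin> L" "k \<in> D"
  shows "negate k \<notin> L"
proof -
  have "D \<subseteq> {l. negate l \<notin> L}"
    using assms imp_closed_dual by (auto simp: least_extension_def forced_def)
  with assms(4) show ?thesis by blast
qed

text \<open>D and L have no complementary literals between them, so a new double mark can only arise
  inside D; \<open>new\<close> has to exclude just these.\<close>

lemma marking_extend:
  assumes m: "marking \<phi> L Z" and D: "least_extension \<phi> L l D" and l: "l \<notin> L" "negate l \<notin> L"
    and new: "\<And>S k. admissible \<phi> S \<Longrightarrow> k \<in> S \<Longrightarrow> k \<in> D \<Longrightarrow> negate k \<notin> D"
  shows "marking \<phi> (L \<union> D) Z"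
proof -
  have f: "forced \<phi> L" using m by (simp add: marking_def)
  have "k \<notin> L \<union> D \<or> negate k \<notin> L \<union> D" if S: "admissible \<phi> S" "k \<in> S" for S k
    using m S new[OF S] least_extension_disjoint[OF f D l(2), of k]
      least_extension_disjoint[OF f D l(2), of "negate k"]
    unfolding marking_def by auto
  moreover have "forced \<phi> (L \<union> D)"
    using f D by (auto simp: forced_def least_extension_def)
  ultimately show ?thesis using m by (simp add: marking_def)
qed

lemma marking_consistent:
  assumes m: "marking \<phi> L Z" and D: "least_extension \<phi> L l D" and l: "l \<notin> L" "negate l \<notin> L"
    and cons: "\<forall>k\<in>D. negate k \<notin> D"
  shows "marking \<phi> (L \<union> D) Z"
  using marking_extend[OF m D l] cons by blast

text \<open>E shows that no admissible S contains \<open>negate l\<close>. Then \<open>l\<close> is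
  in the dual of S, and so is all of D. In this way a double mark inside D is justified too: D
  itself may be inconsistent.\<close>

lemma marking_inconsistent:
  assumes m: "marking \<phi> L Z" and D: "least_extension \<phi> L l D" and l: "l \<notin> L" "negate l \<notin> L"
    and E: "least_extension \<phi> L (negate l) E" and incons: "k \<in> E" "negate k \<in> E"
  shows "marking \<phi> (L \<union> D) Z"
proof (rule marking_extend[OF m D l])
  fix S j assume S: "admissible \<phi> S" "j \<in> S" "j \<in> D"
  have ic: "imp_closed \<phi> S" using S(1) by (simp add: admissible_def)
  have "negate l \<notin> S"
    using E ic incons S(1) unfolding least_extension_def admissible_def by blast
  then have "D \<subseteq> {l. negate l \<notin> S}"
    using D imp_closed_dual[OF ic] unfolding least_extension_def by simp
  then show "negate j \<notin> D" using S(2) by auto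
qed

section \<open>The clause checks decide whether a witness exists\<close>

definition sets_ok :: "nat \<Rightarrow> lit set \<Rightarrow> nat set \<Rightarrow> formula \<Rightarrow> bool" where
  "sets_ok n L Z \<phi> \<longleftrightarrow> lpic_witness_empty_ok {..<n} \<phi>
     ({..<n} - doubly L) ({..<n} \<inter> doubly L - Z) ({..<n} \<inter> doubly L \<inter> Z)"

lemma card_vars: "distinct (map lit_var ls) \<Longrightarrow> card (vars ls) = length ls"
  by (metis distinct_card length_map list.set_map vars_def)

text \<open>The literals marked with one sign only form the admissible set. Forbidden literals are
  left out because their complements are in L.\<close>

lemma marked_admissible:
  assumes m: "marking \<phi> L Z" and total: "\<And>x. x < n \<Longrightarrow> Pos x \<in> L \<or> Neg x \<in> L"
    and \<phi>: "formula_over {..<n} \<phi>"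
  shows "\<exists>S. admissible \<phi> S \<and> lit_var ` S = {..<n} - doubly L"
proof (intro exI conjI)
  let ?S = "{l\<in>L. negate l \<notin> L \<and> lit_var l < n}"
  have f: "imp_closed \<phi> L" "negate ` forbidden \<phi> \<subseteq> L"
    using m by (auto simp: marking_def forced_def)
  have "imp_closed \<phi> ?S"
    unfolding imp_closed_def
  proof (intro ballI impI)
    fix c l k assume c: "c \<in> set \<phi>" "l \<in> set (disj_part c)" "k \<in> set (disj_part c)" "l \<noteq> k" "negate l \<in> ?S"
    then have "k \<in> L" using imp_closedD[OF f(1)] by blast
    \<comment> \<open>By contraposition, \<open>negate k\<close> in L would put \<open>l\<close>
      into L, although \<open>negate l\<close> was assumed to be singly marked.\<close>
    moreover have "negate k \<notin> L"
      using imp_closed_dual[OF f(1)] c unfolding imp_closed_def by fastforce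
    moreover have "lit_var k < n"
      using \<phi> c(1,3) by (fastforce simp: formula_over_def clause_over_def clause_vars_def vars_def)
    ultimately show "k \<in> ?S" by simp
  qed
  then show "admissible \<phi> ?S" using f(2) by (auto simp: admissible_def)
  show "lit_var ` ?S = {..<n} - doubly L"
  proof
    show "lit_var ` ?S \<subseteq> {..<n} - doubly L" by (auto simp: doubly_lit_var)
    show "{..<n} - doubly L \<subseteq> lit_var ` ?S"
    proof
      fix x assume x: "x \<in> {..<n} - doubly L"
      then have "Pos x \<in> ?S \<or> Neg x \<in> ?S" using total[of x] by (auto simp: doubly_def)
      then show "x \<in> lit_var ` ?S" by force
    qed
  qed
qed

lemma checks_sound:
  assumes m: "marking \<phi> L Z" and total: "\<And>x. x < n \<Longrightarrow> Pos x \<in> L \<or> Neg x \<in> L"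
    and \<phi>: "formula_over {..<n} \<phi>" and ok: "\<forall>c\<in>set \<phi>. clause_ok L Z c"
  shows "sets_ok n L Z \<phi>"
  unfolding sets_ok_def empty_ok_iff[OF \<phi>]
proof (intro conjI)
  let ?U = "{..<n} \<inter> doubly L"
  let ?V0 = "{..<n} - doubly L" and ?V1 = "?U - Z" and ?V2 = "?U \<inter> Z"
  have "\<exists>S. admissible \<phi> S \<and> lit_var ` S = ?V0"
    using marked_admissible[OF m total \<phi>] by blast
  then show "\<exists>S. admissible \<phi> S \<and> lit_var ` S = ?V0" .
  have per_clause: "(clause_vars c \<inter> ?V1 = {} \<or> clause_vars c \<inter> ?V2 = {}) \<and>
     card (clause_vars c \<inter> ?V1) \<le> 2 \<and>
     (clause_vars c \<inter> ?V2 \<noteq> {} \<longrightarrow> generalized_clause ?V0 ?V2 c)" if c: "c \<in> set \<phi>" for c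
  proof -
    have over: "clause_vars c \<subseteq> {..<n}" "distinct (map lit_var (disj_part c))"
        "distinct (map lit_var (xor_part c))"
      using \<phi> c by (auto simp: formula_over_def clause_over_def)
    have okc: "clause_ok L Z c" using ok c by blast
    show ?thesis
    proof (cases "xor_part c = []")
      case False
      then have "rest L c = []" using okc by (simp add: clause_ok_def)
      then have d: "vars (disj_part c) \<inter> doubly L = {}"
        by (auto simp: rest_def filter_empty_conv vars_def)
      \<comment> \<open>Both signs of a xor literal are forbidden, and L contains the complements of
        forbidden literals.\<close>
      have x: "vars (xor_part c) \<subseteq> doubly L"
      proof -
        have "l \<in> L \<and> negate l \<in> L" if "l \<in> set (xor_part c)" for l
        proof -
          have "negate l \<in> L" "negate (negate l) \<in> L"
            using m forbidden_xor[OF c that] unfolding marking_def forced_def by blast+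
          then show ?thesis by simp
        qed
        then show ?thesis by (auto simp: vars_def doubly_lit_var)
      qed
      have "link_closed \<phi> Z" using m by (simp add: marking_def)
      then have lc: "x \<in> vars (xor_part c) \<Longrightarrow> y \<in> vars (xor_part c) \<Longrightarrow>
          2 < length (xor_part c) \<or> x \<in> Z \<Longrightarrow> y \<in> Z" for x y
        using c unfolding link_closed_def by blast
      have inter: "clause_vars c \<inter> ?V1 = vars (xor_part c) - Z" "clause_vars c \<inter> ?V2 = vars (xor_part c) \<inter> Z"
        using d x over(1) by (auto simp: clause_vars_def)
      have sub: "vars (disj_part c) \<subseteq> ?V0" using d over(1) by (auto simp: clause_vars_def)
      \<comment> \<open>Z contains all or none of the xor variables. If none, the xor has length at
        most two and may use up the whole allowance for V1, since the disjunctive part is in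
        V0.\<close>
      show ?thesis
      proof (cases "vars (xor_part c) \<inter> Z = {}")
        case True
        have "length (xor_part c) \<le> 2"
        proof (rule ccontr)
          assume a: "\<not> length (xor_part c) \<le> 2"
          then have "xor_part c \<noteq> []" by auto
          then have "lit_var (hd (xor_part c)) \<in> vars (xor_part c)" by (simp add: vars_def)
          then show False using lc a True by (metis disjoint_iff not_le)
        qed
        moreover have "card (vars (xor_part c) - Z) \<le> card (vars (xor_part c))"
          by (rule card_mono) (auto simp: vars_def)
        ultimately show ?thesis using True by (simp add: inter card_vars[OF over(3)])
      next
        case False
        then have "vars (xor_part c) \<subseteq> Z" using lc by blast
        moreover from this have "card (vars (xor_part c) - Z) = 0"
          by (simp add: Diff_eq_empty_iff[THEN iffD2])
        moreover from calculation(1) have "vars (xor_part c) \<subseteq> ?V2" using x over(1) by (auto simp: clause_vars_def)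
        ultimately show ?thesis
          using sub \<open>xor_part c \<noteq> []\<close> by (simp add: inter generalized_clause_def)
      qed
    next
      case True
      then have cv: "clause_vars c = vars (disj_part c)" by (simp add: clause_vars_def vars_def)
      have len: "length (rest L c) \<le> 2"
        and two: "length (rest L c) = 2 \<Longrightarrow> vars (rest L c) \<inter> Z = {}"
        using okc True by (auto simp: clause_ok_def)
      have int: "clause_vars c \<inter> doubly L = vars (rest L c)"
        by (auto simp: cv rest_def vars_def)
      have inU: "clause_vars c \<inter> ?V1 = vars (rest L c) - Z" "clause_vars c \<inter> ?V2 = vars (rest L c) \<inter> Z"
        using int over(1) by blast+
      have dr: "distinct (map lit_var (rest L c))"
        unfolding rest_def using over(2) by (rule distinct_map_filter)
      have "card (vars (rest L c) - Z) \<le> card (vars (rest L c))"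
        by (rule card_mono) (auto simp: vars_def)
      then have c2: "card (clause_vars c \<inter> ?V1) \<le> 2"
        using len card_vars[OF dr] by (simp add: inU)
      show ?thesis
      proof (cases "vars (rest L c) \<inter> Z = {}")
        case True
        then show ?thesis using c2 inU by simp
      next
        case False
        \<comment> \<open>Two remaining literals would have to avoid Z. The single one left here
          takes the role of the one-literal xor of a generalized clause.\<close>
        then have "length (rest L c) = 1"
          using len two by (cases "rest L c") (auto simp: vars_def le_Suc_eq)
        then obtain k where k: "rest L c = [k]" by (auto simp: length_Suc_conv)
        then have kZ: "lit_var k \<in> Z" using False by (auto simp: vars_def)
        have kd: "k \<in> set (disj_part c)" "lit_var k \<in> doubly L"
        proof -
          have "k \<in> set (rest L c)" using k by simp
          then show "k \<in> set (disj_part c)" "lit_var k \<in> doubly L" by (auto simp: rest_def)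
        qed
        have "lit_var l \<in> ?V0" if "l \<in> set (disj_part c) - {k}" for l
        proof -
          have "l \<notin> set (rest L c)" using k that by simp
          then show ?thesis using that over(1) by (auto simp: rest_def cv vars_def)
        qed
        moreover have "lit_var k \<in> ?V2" using kd kZ over(1) by (auto simp: cv vars_def)
        ultimately have "generalized_clause ?V0 ?V2 c"
          using True kd(1) by (auto simp: generalized_clause_def)
        moreover have "clause_vars c \<inter> ?V1 = {}" using kZ k by (simp add: inU vars_def)
        ultimately show ?thesis by simp
      qed
    qed
  qed
  have "?V0 \<inter> ?V1 = {}" "?V0 \<inter> ?V2 = {}" "?V1 \<inter> ?V2 = {}" "?V0 \<union> ?V1 \<union> ?V2 = {..<n}"
    by auto
  then show "lpic_partition {..<n} \<phi> ?V0 ?V1 ?V2"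
    unfolding lpic_partition_def using per_clause by simp
qed

text \<open>Also the reason for a negative answer in the strict reading: if this bound is empty,
  every V0 is.\<close>

lemma witness_V0_le:
  assumes m: "marking \<phi> L Z" and \<phi>: "formula_over {..<n} \<phi>"
    and w: "lpic_witness_empty_ok {..<n} \<phi> V0 V1 V2"
  shows "V0 \<subseteq> {..<n} - doubly L"
proof
  fix x assume x: "x \<in> V0"
  obtain S where S: "admissible \<phi> S" "lit_var ` S = V0"
    using w empty_ok_iff[OF \<phi>] by blast
  then obtain l where l: "l \<in> S" "lit_var l = x" using x by auto
  then have "x \<notin> doubly L" using m S(1) doubly_lit_var unfolding marking_def by blast
  moreover have "x < n" using w x by (auto simp: lpic_witness_empty_ok_def lpic_partition_def)
  ultimately show "x \<in> {..<n} - doubly L" by simp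
qed

text \<open>An arbitrary witness is compared with the computed sets: its V0 is smaller and its V2 is
  larger. Hence the literals in \<open>rest\<close> are all in V1 or V2, and the limits of the
  witness carry over to them.\<close>

lemma checks_complete:
  assumes m: "marking \<phi> L Z" and \<phi>: "formula_over {..<n} \<phi>"
    and w: "lpic_witness_empty_ok {..<n} \<phi> V0 V1 V2" and c: "c \<in> set \<phi>"
  shows "clause_ok L Z c"
proof -
  obtain S where S: "admissible \<phi> S" "lit_var ` S = V0"
    using w empty_ok_iff[OF \<phi>] by blast
  have disj: "V0 \<inter> V1 = {}" "V0 \<inter> V2 = {}" "V1 \<inter> V2 = {}" "V0 \<union> V1 \<union> V2 = {..<n}"
    and sep: "\<And>c. c \<in> set \<phi> \<Longrightarrow> clause_vars c \<inter> V1 = {} \<or> clause_vars c \<inter> V2 = {}"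
    and card2: "\<And>c. c \<in> set \<phi> \<Longrightarrow> card (clause_vars c \<inter> V1) \<le> 2"
    and gen: "\<And>c. c \<in> set \<phi> \<Longrightarrow> clause_vars c \<inter> V2 \<noteq> {} \<Longrightarrow> generalized_clause V0 V2 c"
    using w unfolding lpic_witness_empty_ok_def lpic_partition_def by blast+
  have V0: "V0 \<inter> doubly L = {}"
    using witness_V0_le[OF m \<phi> w] by blast
  have over: "clause_vars c \<subseteq> {..<n}" "distinct (map lit_var (disj_part c))"
        "distinct (map lit_var (xor_part c))" "length (xor_part c) \<noteq> 1"
        "vars (disj_part c) \<inter> vars (xor_part c) = {}" if "c \<in> set \<phi>" for c
    using \<phi> that by (auto simp: formula_over_def clause_over_def vars_def)
  have xor0: "vars (xor_part c) \<inter> V0 = {}" if c: "c \<in> set \<phi>" for c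
  proof -
    have "l \<notin> S" if l: "lit_var l \<in> vars (xor_part c)" for l
    proof -
      from l obtain k where k: "k \<in> set (xor_part c)" "lit_var k = lit_var l" by (auto simp: vars_def)
      then have "l \<in> forbidden \<phi>"
        using forbidden_xor[OF c k(1)] lit_var_eq_iff[of k l] by auto
      then show ?thesis using S(1) by (auto simp: admissible_def)
    qed
    then show ?thesis using S(2) by auto
  qed
  have xor12: "vars (xor_part c) \<subseteq> V1 \<or> vars (xor_part c) \<subseteq> V2" if c: "c \<in> set \<phi>" for c
  proof -
    have "vars (xor_part c) \<subseteq> V1 \<union> V2"
      using xor0[OF c] over(1)[OF c] disj(4) by (auto simp: clause_vars_def)
    with sep[OF c] show ?thesis unfolding clause_vars_def by blast
  qed
  \<comment> \<open>This makes the minimality of Z applicable to the V2 of the given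
    witness.\<close>
  have "link_closed \<phi> V2"
    unfolding link_closed_def
  proof (intro ballI impI)
    fix c x y assume c: "c \<in> set \<phi>" and xy: "x \<in> vars (xor_part c)" "y \<in> vars (xor_part c)"
      and *: "2 < length (xor_part c) \<or> x \<in> V2"
    show "y \<in> V2"
    proof (rule ccontr)
      assume "y \<notin> V2"
      then have V1: "vars (xor_part c) \<subseteq> V1" using xor12[OF c] xy by blast
      then have "x \<notin> V2" using xy disj(3) by blast
      then have "2 < card (vars (xor_part c))" using * card_vars[OF over(3)[OF c]] by simp
      also have "\<dots> \<le> card (clause_vars c \<inter> V1)"
        by (rule card_mono) (use V1 in \<open>auto simp: clause_vars_def vars_def\<close>)
      finally show False using card2[OF c] by simp
    qed
  qed
  then have Z: "Z \<subseteq> V2" using m by (simp add: marking_def)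
  have rest: "set (rest L c) \<subseteq> set (disj_part c)" "distinct (map lit_var (rest L c))"
    using over(2)[OF c] unfolding rest_def by (auto intro: distinct_map_filter)
  have r12: "lit_var l \<in> V1 \<or> lit_var l \<in> V2" "lit_var l \<notin> V0" if "l \<in> set (rest L c)" for l
  proof -
    have "lit_var l \<in> {..<n}" "lit_var l \<in> doubly L"
      using that over(1)[OF c] by (auto simp: rest_def clause_vars_def vars_def)
    then show "lit_var l \<in> V1 \<or> lit_var l \<in> V2" "lit_var l \<notin> V0" using disj V0 by auto
  qed
  show ?thesis
  proof (cases "xor_part c = []")
    case False
    have "rest L c = []"
    proof (rule ccontr)
      assume "rest L c \<noteq> []"
      then obtain l where l: "l \<in> set (rest L c)" by (cases "rest L c") auto
      then have lc: "lit_var l \<in> vars (disj_part c)" using rest(1) by (auto simp: vars_def)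
      show False
      proof (cases "lit_var l \<in> V2")
        case True
        then have "generalized_clause V0 V2 c" using gen[OF c] lc by (auto simp: clause_vars_def)
        then show False using False lc r12(2)[OF l] by (auto simp: generalized_clause_def)
      next
        case notV2: False
        then have l1: "lit_var l \<in> V1" using r12(1)[OF l] by blast
        then have "clause_vars c \<inter> V2 = {}" using sep[OF c] lc by (auto simp: clause_vars_def)
        then have x1: "vars (xor_part c) \<subseteq> V1" using xor12[OF c] by (auto simp: clause_vars_def)
        \<comment> \<open>\<open>clause_over\<close> excludes one-literal xors; together with
          \<open>l\<close> there would be three variables of V1.\<close>
        have "length (xor_part c) \<ge> 2" using over(4)[OF c] False by (cases "xor_part c" rule: list.exhaust)
            (auto simp: Suc_le_eq)
        then have "2 < card (insert (lit_var l) (vars (xor_part c)))"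
          using lc over(5)[OF c] card_vars[OF over(3)[OF c]]
          by (subst card_insert_disjoint) (auto simp: vars_def)
        also have "\<dots> \<le> card (clause_vars c \<inter> V1)"
          by (rule card_mono) (use x1 l1 lc in \<open>auto simp: clause_vars_def vars_def\<close>)
        finally show False using card2[OF c] by simp
      qed
    qed
    then show ?thesis using False by (simp add: clause_ok_def)
  next
    case True
    \<comment> \<open>A clause without a xor that meets V2 has only one literal outside V0, so two
      remaining literals are possible only within V1.\<close>
    have all1: "length (rest L c) \<le> 1 \<or> vars (rest L c) \<subseteq> V1"
    proof (rule ccontr)
      assume "\<not> (length (rest L c) \<le> 1 \<or> vars (rest L c) \<subseteq> V1)"
      then have len: "length (rest L c) \<ge> 2" and "\<not> vars (rest L c) \<subseteq> V1" by auto
      then obtain l where l: "l \<in> set (rest L c)" "lit_var l \<in> V2"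
        using r12(1) by (auto simp: vars_def)
      have "generalized_clause V0 V2 c"
        using gen[OF c] l rest(1) by (auto simp: clause_vars_def vars_def)
      then obtain k where "\<forall>l\<in>set (disj_part c) - {k}. lit_var l \<in> V0"
        using True by (auto simp: generalized_clause_def)
      then have "set (rest L c) \<subseteq> {k}" using rest(1) r12(2) by blast
      then have "card (set (rest L c)) \<le> 1" using card_mono[of "{k}"] by simp
      moreover have "card (set (rest L c)) = length (rest L c)"
        using rest(2) by (simp add: distinct_card distinct_map)
      ultimately show False using len by simp
    qed
    have "length (rest L c) \<le> 2"
    proof (rule ccontr)
      assume a: "\<not> length (rest L c) \<le> 2"
      then have "vars (rest L c) \<subseteq> V1" using all1 by auto
      then have "card (vars (rest L c)) \<le> card (clause_vars c \<inter> V1)"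
        by (intro card_mono) (use rest(1) in \<open>auto simp: clause_vars_def vars_def\<close>)
      then show False using a card2[OF c] card_vars[OF rest(2)] by simp
    qed
    moreover have "vars (rest L c) \<inter> Z = {}" if "length (rest L c) = 2"
      using all1 that Z disj(3) by auto
    ultimately show ?thesis using True by (simp add: clause_ok_def)
  qed
qed

section \<open>Weakest preconditions with running time\<close>

lemma reg_set_reg [simp]: "reg (set_reg r v s) = (reg s)(r := v)"
  and arr_set_reg [simp]: "arr (set_reg r v s) = arr s"
  and reg_set_arr [simp]: "reg (set_arr a i v s) = reg s"
  and arr_set_arr [simp]: "arr (set_arr a i v s) = (arr s)(a := (arr s a)(i := v))"
  by (simp_all add: set_reg_def set_arr_def)

text \<open>\<open>T\<close> is the time elapsed so far; the postcondition also sees the time.\<close>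

definition wp :: "prog \<Rightarrow> nat \<Rightarrow> state \<Rightarrow> (nat \<Rightarrow> state \<Rightarrow> bool) \<Rightarrow> bool" where
  "wp p T s Q \<longleftrightarrow> (\<exists>t s'. exec p s t s' \<and> Q (T + t) s')"

lemma wp_mono: "wp p T s P \<Longrightarrow> (\<And>T' s'. P T' s' \<Longrightarrow> Q T' s') \<Longrightarrow> wp p T s Q"
  unfolding wp_def by blast

text \<open>Determinism of \<open>exec\<close> gives the equivalence, which lets the simplifier
  execute straight-line code symbolically.\<close>

lemma wp_step: "exec p s 1 s' \<Longrightarrow> wp p T s Q \<longleftrightarrow> Q (Suc T) s'"
  unfolding wp_def by (metis Suc_eq_plus1 exec_deterministic)

lemma wp_basic [simp]:
  "wp (Assign r v) T s Q \<longleftrightarrow> Q (Suc T) (set_reg r v s)"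
  "wp (Copy r q) T s Q \<longleftrightarrow> Q (Suc T) (set_reg r (reg s q) s)"
  "wp (Inc r) T s Q \<longleftrightarrow> Q (Suc T) (set_reg r (Suc (reg s r)) s)"
  "wp (Dec r) T s Q \<longleftrightarrow> Q (Suc T) (set_reg r (reg s r - 1) s)"
  "wp (Read r a i) T s Q \<longleftrightarrow> Q (Suc T) (set_reg r (arr s a (reg s i)) s)"
  "wp (Write a i r) T s Q \<longleftrightarrow> Q (Suc T) (set_arr a (reg s i) (reg s r) s)"
  using wp_step[OF exec.Assign] wp_step[OF exec.Copy] wp_step[OF exec.Inc] wp_step[OF exec.Dec]
    wp_step[OF exec.Read] wp_step[OF exec.Write]
  by simp_all

lemma wp_Seq [simp]: "wp (Seq p q) T s Q \<longleftrightarrow> wp p T s (\<lambda>T' s'. wp q T' s' Q)"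
proof
  assume "wp (Seq p q) T s Q"
  then show "wp p T s (\<lambda>T' s'. wp q T' s' Q)"
    unfolding wp_def by (auto elim!: exec.cases[of "Seq p q"] simp: add.assoc)
next
  assume "wp p T s (\<lambda>T' s'. wp q T' s' Q)"
  then show "wp (Seq p q) T s Q"
    unfolding wp_def using exec.Seq by (metis add.assoc)
qed

lemma wp_If [simp]:
  "wp (If b p q) T s Q \<longleftrightarrow> (if holds b s then wp p (Suc T) s Q else wp q (Suc T) s Q)"
proof
  assume "wp (If b p q) T s Q"
  then show "if holds b s then wp p (Suc T) s Q else wp q (Suc T) s Q"
    unfolding wp_def by (auto elim!: exec.cases[of "If b p q"]) (metis add_Suc)+
next
  assume "if holds b s then wp p (Suc T) s Q else wp q (Suc T) s Q"
  then show "wp (If b p q) T s Q"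
    unfolding wp_def using exec.IfTrue[of b s p _ _ q] exec.IfFalse[of b s q _ _ p]
    by (metis Suc_eq_plus1 add_Suc add_Suc_right)
qed

text \<open>Time strictly increases, so that a bound on it replaces a termination measure.\<close>

lemma wp_While:
  assumes "I T s"
    and bound: "\<And>T s. I T s \<Longrightarrow> T \<le> B"
    and step: "\<And>T s. I T s \<Longrightarrow> holds b s \<Longrightarrow> wp p (Suc T) s I"
    and exit: "\<And>T s. I T s \<Longrightarrow> \<not> holds b s \<Longrightarrow> Q (Suc T) s"
  shows "wp (While b p) T s Q"
  using assms(1)
proof (induction "B - T" arbitrary: T s rule: less_induct)
  case less
  show ?case
  proof (cases "holds b s")
    case True
    obtain t s' where p: "exec p s t s'" "I (Suc T + t) s'"
      using step[OF less.prems True] unfolding wp_def by blast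
    have "B - (Suc T + t) < B - T" using bound[OF p(2)] by linarith
    then obtain u s'' where "exec (While b p) s' u s''" "Q (Suc T + t + u) s''"
      using less.hyps p(2) unfolding wp_def by blast
    then show ?thesis
      unfolding wp_def using exec.WhileTrue[OF True p(1)]
      by (metis Suc_eq_plus1 add.assoc add_Suc add_Suc_right)
  next
    case False
    then have "exec (While b p) s 1 s" by (rule exec.WhileFalse)
    then show ?thesis
      using wp_step[of "While b p"] exit[OF less.prems False] by blast
  qed
qed

text \<open>The list is a ghost: the machine only knows how many elements remain, in register
  \<open>k\<close>. Tests compare two registers, hence the register \<open>z\<close> that is kept at
  0.\<close>

lemma wp_for:
  assumes "P [] T s" "reg s k = length xs" "reg s z = 0" "k \<noteq> z"
    and step: "\<And>ys x zs T s. xs = ys @ x # zs \<Longrightarrow> P ys T s \<Longrightarrow> reg s z = 0 \<Longrightarrow> reg s k = Suc (length zs) \<Longrightarrow>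
      wp p (Suc T) s (\<lambda>T' s'. P (ys @ [x]) T' s' \<and> reg s' z = 0 \<and> reg s' k = length zs)"
    and exit: "\<And>T s. P xs T s \<Longrightarrow> reg s z = 0 \<Longrightarrow> reg s k = 0 \<Longrightarrow> Q (Suc T) s"
  shows "wp (While (Less z k) p) T s Q"
proof -
  have "wp (While (Less z k) p) T s Q"
    if "P ys T s" "reg s k = length zs" "reg s z = 0" "xs = ys @ zs" for ys zs T s
    using that
  proof (induction zs arbitrary: ys T s)
    case Nil
    then have "\<not> holds (Less z k) s" by simp
    moreover from Nil have "Q (Suc T) s" using exit by simp
    ultimately show ?case
      unfolding wp_def using exec.WhileFalse by (metis Suc_eq_plus1)
  next
    case (Cons x zs)
    then have h: "holds (Less z k) s" by simp
    from step[of ys x zs T s] Cons.prems obtain t s' where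
      p: "exec p s t s'" and I: "P (ys @ [x]) (Suc T + t) s'" "reg s' z = 0" "reg s' k = length zs"
      unfolding wp_def by auto
    from Cons.IH[OF I(1,3,2)] Cons.prems(4) obtain u s'' where
      "exec (While (Less z k) p) s' u s''" "Q (Suc T + t + u) s''"
      unfolding wp_def by auto
    then show ?case
      unfolding wp_def using exec.WhileTrue[OF h p]
      by (metis Suc_eq_plus1 add.assoc add_Suc add_Suc_right)
  qed
  then show ?thesis using assms(1-3) by simp
qed

section \<open>Frames read off the program text\<close>

fun wregs :: "prog \<Rightarrow> nat set" where
  "wregs (Assign r v) = {r}"
| "wregs (Copy r q) = {r}"
| "wregs (Inc r) = {r}"
| "wregs (Dec r) = {r}"
| "wregs (Read r a i) = {r}"
| "wregs (Write a i r) = {}"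
| "wregs (Seq p q) = wregs p \<union> wregs q"
| "wregs (If b p q) = wregs p \<union> wregs q"
| "wregs (While b p) = wregs p"

fun warrs :: "prog \<Rightarrow> nat set" where
  "warrs (Write a i r) = {a}"
| "warrs (Seq p q) = warrs p \<union> warrs q"
| "warrs (If b p q) = warrs p \<union> warrs q"
| "warrs (While b p) = warrs p"
| "warrs _ = {}"

definition frame :: "nat set \<Rightarrow> nat set \<Rightarrow> state \<Rightarrow> state \<Rightarrow> bool" where
  "frame R A s s' \<longleftrightarrow> (\<forall>r. r \<notin> R \<longrightarrow> reg s' r = reg s r) \<and> (\<forall>a. a \<notin> A \<longrightarrow> arr s' a = arr s a)"

lemma exec_frame: "exec p s t s' \<Longrightarrow> frame (wregs p) (warrs p) s s'"
  by (induction rule: exec.induct) (auto simp: frame_def)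

lemma frame_reg: "frame R A s s' \<Longrightarrow> r \<notin> R \<Longrightarrow> reg s' r = reg s r"
  and frame_arr: "frame R A s s' \<Longrightarrow> a \<notin> A \<Longrightarrow> arr s' a = arr s a"
  by (auto simp: frame_def)

text \<open>Specifications can stay silent about what a program does not touch; the caller recovers
  it here.\<close>

lemma wp_frame:
  "wp p T s (\<lambda>T' s'. frame (wregs p) (warrs p) s s' \<longrightarrow> Q T' s') \<Longrightarrow> wp p T s Q"
  using exec_frame unfolding wp_def by blast

section \<open>Graphs of implications in memory\<close>

text \<open>The \<open>wp\<close> rules advance the time by \<open>Suc\<close>; numerals are brought
  into the same form.\<close>

lemma plus_numeral_Suc: "(T :: nat) + numeral k = Suc (T + pred_numeral k)"
  by (simp add: numeral_eq_Suc)

definition closed :: "(nat \<Rightarrow> nat) \<Rightarrow> (nat \<Rightarrow> nat) \<Rightarrow> nat set \<Rightarrow> bool" where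
  "closed N T Y \<longleftrightarrow> (\<forall>u\<in>Y. (N u = 0 \<or> N u \<in> Y) \<and> (T u = 0 \<or> T u \<in> Y))"

text \<open>
  \<open>N\<close> and \<open>T\<close> give the two out-edges of each node below \<open>f\<close>. The closed node sets containing \<open>D\<close>,
  cut down to the nodes \<open>R\<close> of interest, are the sets satisfying \<open>\<Phi>\<close>; in this form auxiliary nodes can
  be dropped from \<open>R\<close> as soon as no further edge will touch them.
\<close>

definition represents ::
    "(nat \<Rightarrow> nat) \<Rightarrow> (nat \<Rightarrow> nat) \<Rightarrow> nat \<Rightarrow> nat set \<Rightarrow> nat set \<Rightarrow> (nat set \<Rightarrow> bool) \<Rightarrow> bool" where
  "represents N T f D R \<Phi> \<longleftrightarrow>
     R \<subseteq> {1..<f} \<and> D \<subseteq> {1..<f} \<and> (\<forall>u\<ge>f. N u = 0 \<and> T u = 0) \<and> (\<forall>u. N u < f \<and> T u < f) \<and>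
     (\<forall>X\<subseteq>R. \<Phi> X \<longleftrightarrow> (\<exists>Y\<subseteq>{1..<f}. closed N T Y \<and> D \<subseteq> Y \<and> Y \<inter> R = X))"

lemma represents_cong:
  assumes "represents N T f D R \<Phi>" "\<And>X. X \<subseteq> R \<Longrightarrow> \<Phi> X \<longleftrightarrow> \<Psi> X"
  shows "represents N T f D R \<Psi>"
  using assms unfolding represents_def by simp

lemma represents_iff:
  "represents N T f D R \<Phi> \<Longrightarrow> X \<subseteq> R \<Longrightarrow>
    \<Phi> X \<longleftrightarrow> (\<exists>Y\<subseteq>{1..<f}. closed N T Y \<and> D \<subseteq> Y \<and> Y \<inter> R = X)"
  by (simp add: represents_def)

text \<open>Hiding nodes amounts to an existential quantifier over them, because the restriction to
  \<open>R'\<close> factors through R.\<close>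

lemma represents_forget:
  assumes r: "represents N T f D R \<Phi>" and sub: "R' \<subseteq> R"
    and \<Psi>: "\<And>X. X \<subseteq> R' \<Longrightarrow> \<Psi> X \<longleftrightarrow> (\<exists>X'\<subseteq>R. X' \<inter> R' = X \<and> \<Phi> X')"
  shows "represents N T f D R' \<Psi>"
proof -
  have "\<Psi> X \<longleftrightarrow> (\<exists>Y\<subseteq>{1..<f}. closed N T Y \<and> D \<subseteq> Y \<and> Y \<inter> R' = X)" if X: "X \<subseteq> R'" for X
  proof
    assume "\<Psi> X"
    then obtain X' where "X' \<subseteq> R" "X' \<inter> R' = X" "\<Phi> X'" using \<Psi> X by blast
    moreover from this obtain Y where "Y\<subseteq>{1..<f}" "closed N T Y" "D \<subseteq> Y" "Y \<inter> R = X'"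
      using represents_iff[OF r] by blast
    ultimately show "\<exists>Y\<subseteq>{1..<f}. closed N T Y \<and> D \<subseteq> Y \<and> Y \<inter> R' = X" using sub by blast
  next
    assume "\<exists>Y\<subseteq>{1..<f}. closed N T Y \<and> D \<subseteq> Y \<and> Y \<inter> R' = X"
    then obtain Y where Y: "Y\<subseteq>{1..<f}" "closed N T Y" "D \<subseteq> Y" "Y \<inter> R' = X" by blast
    have "\<Phi> (Y \<inter> R)" using represents_iff[OF r, of "Y \<inter> R"] Y(1-3) by blast
    moreover have "Y \<inter> R \<inter> R' = X" using Y(4) sub by blast
    ultimately have "\<exists>X'\<subseteq>R. X' \<inter> R' = X \<and> \<Phi> X'" by (intro exI[of _ "Y \<inter> R"]) simp
    then show "\<Psi> X" using \<Psi>[OF X] by simp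
  qed
  moreover have "R' \<subseteq> {1..<f}" using r sub by (auto simp: represents_def)
  ultimately show ?thesis using r by (simp add: represents_def)
qed

text \<open>No edge enters or leaves the fresh node yet, so closed sets are free to contain it or
  not.\<close>

lemma represents_new:
  assumes r: "represents N T f D R \<Phi>" and f: "0 < f"
  shows "represents N T (Suc f) D (insert f R) (\<lambda>X. \<Phi> (X - {f}))"
proof -
  have b: "R \<subseteq> {1..<f}" "D \<subseteq> {1..<f}" "N f = 0" "T f = 0" "\<And>u. N u < f" "\<And>u. T u < f"
    using r unfolding represents_def by auto
  have "\<Phi> (X - {f}) \<longleftrightarrow> (\<exists>Y\<subseteq>{1..<Suc f}. closed N T Y \<and> D \<subseteq> Y \<and> Y \<inter> insert f R = X)"
    if X: "X \<subseteq> insert f R" for X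
  proof
    assume "\<Phi> (X - {f})"
    moreover have "X - {f} \<subseteq> R" using X by blast
    ultimately obtain Y where Y: "Y\<subseteq>{1..<f}" "closed N T Y" "D \<subseteq> Y" "Y \<inter> R = X - {f}"
      using represents_iff[OF r, of "X - {f}"] by blast
    let ?Y = "Y \<union> (X \<inter> {f})"
    have "?Y \<subseteq> {1..<Suc f}" using Y(1) f by auto
    moreover have "closed N T ?Y" using Y(2) b(3,4) by (auto simp: closed_def)
    moreover have "?Y \<inter> insert f R = X" using Y(1,4) X b(1) by auto
    ultimately show "\<exists>Y\<subseteq>{1..<Suc f}. closed N T Y \<and> D \<subseteq> Y \<and> Y \<inter> insert f R = X"
      using Y(3) by blast
  next
    assume "\<exists>Y\<subseteq>{1..<Suc f}. closed N T Y \<and> D \<subseteq> Y \<and> Y \<inter> insert f R = X"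
    then obtain Y where Y: "Y\<subseteq>{1..<Suc f}" "closed N T Y" "D \<subseteq> Y" "Y \<inter> insert f R = X" by blast
    have "Y - {f} \<subseteq> {1..<f}" using Y(1) by auto
    moreover have "closed N T (Y - {f})"
      using Y(2) b(5,6) unfolding closed_def by (metis Diff_iff less_irrefl singletonD)
    moreover have "D \<subseteq> Y - {f}" using Y(3) b(2) by auto
    moreover have "(Y - {f}) \<inter> R = X - {f}" using Y(4) b(1) by auto
    moreover have "X - {f} \<subseteq> R" using X by blast
    ultimately show "\<Phi> (X - {f})" using represents_iff[OF r, of "X - {f}"] by blast
  qed
  moreover have "\<forall>u\<ge>Suc f. N u = 0 \<and> T u = 0" "\<forall>u. N u < Suc f \<and> T u < Suc f"
    using r unfolding represents_def by (auto simp: less_Suc_eq)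
  ultimately show ?thesis using b f unfolding represents_def by auto
qed

text \<open>The hidden node \<open>f\<close> inherits the old successor list of \<open>u\<close> and
  points to \<open>v\<close>; a closed set can be taken to contain \<open>f\<close> exactly if it
  contains \<open>u\<close>. For \<open>u = 0\<close> the list of the null pointer is altered, but
  closed sets within \<open>{1..<f}\<close> never consult it.\<close>

lemma represents_edge:
  assumes r: "represents N T f D R \<Phi>" and f: "0 < f" and u: "u = 0 \<or> u \<in> R" and v: "v = 0 \<or> v \<in> R"
  shows "represents (N(f := N u, u := f)) (T(f := v)) (Suc f) D R
    (\<lambda>X. \<Phi> X \<and> (u \<in> X \<longrightarrow> v = 0 \<or> v \<in> X))"
    (is "represents ?N ?T _ _ _ ?\<Psi>")
proof -
  have b: "R \<subseteq> {1..<f}" "D \<subseteq> {1..<f}" "N f = 0" "T f = 0" "\<And>u. N u < f" "\<And>u. T u < f"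
    using r unfolding represents_def by auto
  have uf: "u < f" and vf: "v < f" using u v b(1) f by auto
  have "?\<Psi> X \<longleftrightarrow> (\<exists>Y\<subseteq>{1..<Suc f}. closed ?N ?T Y \<and> D \<subseteq> Y \<and> Y \<inter> R = X)" if X: "X \<subseteq> R" for X
  proof
    assume "?\<Psi> X"
    then obtain Y where Y: "Y\<subseteq>{1..<f}" "closed N T Y" "D \<subseteq> Y" "Y \<inter> R = X"
      and uv: "u \<in> X \<longrightarrow> v = 0 \<or> v \<in> X"
      using represents_iff[OF r X] by blast
    let ?Y = "Y \<union> (if u \<in> Y then {f} else {})"
    have "u \<in> Y \<longrightarrow> v = 0 \<or> v \<in> Y" using uv Y(1,4) u by auto
    then have "closed ?N ?T ?Y" using Y(1,2) uf unfolding closed_def by auto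
    moreover have "?Y \<subseteq> {1..<Suc f}" using Y(1) f by auto
    moreover have "?Y \<inter> R = X" using Y(4) b(1) by auto
    ultimately show "\<exists>Y\<subseteq>{1..<Suc f}. closed ?N ?T Y \<and> D \<subseteq> Y \<and> Y \<inter> R = X" using Y(3) by blast
  next
    assume "\<exists>Y\<subseteq>{1..<Suc f}. closed ?N ?T Y \<and> D \<subseteq> Y \<and> Y \<inter> R = X"
    then obtain Y where Y: "Y\<subseteq>{1..<Suc f}" "closed ?N ?T Y" "D \<subseteq> Y" "Y \<inter> R = X" by blast
    have fY: "u \<in> Y \<Longrightarrow> f \<in> Y" using Y(2) f by (auto simp: closed_def)
    have fY': "f \<in> Y \<Longrightarrow> (N u = 0 \<or> N u \<in> Y) \<and> (v = 0 \<or> v \<in> Y)"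
      using Y(2) uf unfolding closed_def by (metis fun_upd_apply less_irrefl)
    have NT: "w \<in> Y \<Longrightarrow> w \<noteq> f \<Longrightarrow> (w \<noteq> u \<longrightarrow> N w = 0 \<or> N w \<in> Y) \<and> (T w = 0 \<or> T w \<in> Y)" for w
      using Y(2) unfolding closed_def by (metis fun_upd_apply)
    have "Y - {f} \<subseteq> {1..<f}" using Y(1) by auto
    moreover have "closed N T (Y - {f})"
      unfolding closed_def
    proof
      fix w assume w: "w \<in> Y - {f}"
      have "(N w = 0 \<or> N w \<in> Y) \<and> (T w = 0 \<or> T w \<in> Y)"
        using NT[of w] w fY fY' by (cases "w = u") auto
      then show "(N w = 0 \<or> N w \<in> Y - {f}) \<and> (T w = 0 \<or> T w \<in> Y - {f})"
        using b(5)[of w] b(6)[of w] by auto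
    qed
    moreover have "D \<subseteq> Y - {f}" using Y(3) b(2) by auto
    moreover have "(Y - {f}) \<inter> R = X" using Y(4) b(1) by auto
    ultimately have "\<Phi> X" using represents_iff[OF r X] by blast
    moreover have "v = 0 \<or> v \<in> X" if "u \<in> X" using that fY fY' Y(4) v by blast
    ultimately show "?\<Psi> X" by blast
  qed
  moreover have "?N w = 0 \<and> ?T w = 0" if "w \<ge> Suc f" for w
    using that r uf unfolding represents_def by auto
  moreover have "?N w < Suc f \<and> ?T w < Suc f" for w
    using b(5,6) vf by (auto simp: less_Suc_eq)
  moreover have "R \<subseteq> {1..<Suc f}" "D \<subseteq> {1..<Suc f}" using b by auto
  ultimately show ?thesis unfolding represents_def by blast
qed

lemma represents_require:
  assumes r: "represents N T f D R \<Phi>" and v: "v = 0 \<or> v \<in> R"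
  shows "represents N T f (D \<union> ({v} - {0})) R (\<lambda>X. \<Phi> X \<and> (v = 0 \<or> v \<in> X))"
proof -
  have b: "R \<subseteq> {1..<f}" "D \<subseteq> {1..<f}" using r unfolding represents_def by auto
  have "(\<Phi> X \<and> (v = 0 \<or> v \<in> X)) \<longleftrightarrow>
      (\<exists>Y\<subseteq>{1..<f}. closed N T Y \<and> D \<union> ({v} - {0}) \<subseteq> Y \<and> Y \<inter> R = X)" if X: "X \<subseteq> R" for X
  proof -
    have "\<Phi> X \<longleftrightarrow> (\<exists>Y\<subseteq>{1..<f}. closed N T Y \<and> D \<subseteq> Y \<and> Y \<inter> R = X)"
      using represents_iff[OF r X] .
    then show ?thesis using v by blast
  qed
  moreover have "D \<union> ({v} - {0}) \<subseteq> {1..<f}" using b v by auto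
  ultimately show ?thesis using r unfolding represents_def by simp
qed

text \<open>Only equality with the current stamp counts, so whatever earlier searches left in
  \<open>mk\<close> acts as unvisited. Injectivity makes the length of the queue the number of
  visited nodes, on which all time bounds of searches rest.\<close>

definition queued :: "(nat \<Rightarrow> nat) \<Rightarrow> nat \<Rightarrow> (nat \<Rightarrow> nat) \<Rightarrow> nat \<Rightarrow> nat set \<Rightarrow> bool" where
  "queued mk st q t D \<longleftrightarrow> D = q ` {..<t} \<and> inj_on q {..<t} \<and> (\<forall>v. mk v = st \<longleftrightarrow> v \<in> D)"

lemma queued_push:
  assumes "queued mk st q t D" "v \<notin> D"
  shows "queued (mk(v := st)) st (q(t := v)) (Suc t) (insert v D)"
proof -
  have "(q(t := v)) ` {..<Suc t} = insert v D"
    using assms by (auto simp: queued_def lessThan_Suc)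
  moreover have "inj_on (q(t := v)) {..<Suc t}"
    using assms by (auto simp: queued_def lessThan_Suc inj_on_def)
  ultimately show ?thesis using assms by (auto simp: queued_def)
qed

lemma queued_card: "queued mk st q t D \<Longrightarrow> card D = t \<and> finite D"
  unfolding queued_def by (auto simp: card_image)

section \<open>Memory layout and elementary program pieces\<close>

abbreviation (input) seq :: "prog \<Rightarrow> prog \<Rightarrow> prog" (infixr ";;" 60) where "p ;; q \<equiv> Seq p q"

text \<open>\<open>rZero\<close> keeps its initial value throughout; register 0 cannot play this
  role because it receives the answer. Heads and tails of the two searches occupy registers 20 to
  23, and their arrays have numbers above 7, so that \<open>channel\<close> can separate them from
  everything else by ranges.\<close>

abbreviation (input) "rZero \<equiv> 33 :: nat"
abbreviation (input) "rOne \<equiv> 2 :: nat"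
abbreviation (input) "rTwo \<equiv> 3 :: nat"
abbreviation (input) "rStamp \<equiv> 4 :: nat"
abbreviation (input) "rFresh \<equiv> 5 :: nat"
abbreviation (input) "rTmp \<equiv> 6 :: nat"
abbreviation (input) "rN \<equiv> 7 :: nat"
abbreviation (input) "rM \<equiv> 8 :: nat"
abbreviation (input) "rPos \<equiv> 9 :: nat"
abbreviation (input) "rK \<equiv> 10 :: nat"
abbreviation (input) "rC \<equiv> 11 :: nat"
abbreviation (input) "rL \<equiv> 12 :: nat"
abbreviation (input) "rNl \<equiv> 13 :: nat"
abbreviation (input) "rW \<equiv> 14 :: nat"
abbreviation (input) "rSuf \<equiv> 15 :: nat"
abbreviation (input) "rPre \<equiv> 16 :: nat"
abbreviation (input) "rNew \<equiv> 17 :: nat"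
abbreviation (input) "rLen \<equiv> 18 :: nat"
abbreviation (input) "rPrev \<equiv> 19 :: nat"
abbreviation (input) "rHA \<equiv> 20 :: nat"
abbreviation (input) "rTA \<equiv> 21 :: nat"
abbreviation (input) "rHB \<equiv> 22 :: nat"
abbreviation (input) "rTB \<equiv> 23 :: nat"
abbreviation (input) "rU \<equiv> 24 :: nat"
abbreviation (input) "rV \<equiv> 25 :: nat"
abbreviation (input) "rGo \<equiv> 26 :: nat"
abbreviation (input) "rOk \<equiv> 27 :: nat"
abbreviation (input) "rI \<equiv> 28 :: nat"
abbreviation (input) "rCnt \<equiv> 29 :: nat"
abbreviation (input) "rHit \<equiv> 30 :: nat"
abbreviation (input) "rFail \<equiv> 31 :: nat"
abbreviation (input) "rSome \<equiv> 32 :: nat"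

abbreviation (input) "aIn \<equiv> 0 :: nat"
abbreviation (input) "aOut \<equiv> 1 :: nat"
abbreviation (input) "aNode \<equiv> 2 :: nat"
abbreviation (input) "aNeg \<equiv> 3 :: nat"
abbreviation (input) "aLink \<equiv> 4 :: nat"
abbreviation (input) "aNext \<equiv> 5 :: nat"
abbreviation (input) "aTarget \<equiv> 6 :: nat"
abbreviation (input) "aMark \<equiv> 7 :: nat"
abbreviation (input) "aSeenA \<equiv> 8 :: nat"
abbreviation (input) "aQueueA \<equiv> 9 :: nat"
abbreviation (input) "aSeenB \<equiv> 10 :: nat"
abbreviation (input) "aQueueB \<equiv> 11 :: nat"

lemma set_reg_twice [simp]: "set_reg r v (set_reg r w s) = set_reg r v s"
  by (simp add: set_reg_def)

definition skip :: prog where "skip = Copy rTmp rTmp"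

lemma wp_skip [simp]: "wp skip T s Q \<longleftrightarrow> Q (Suc T) s"
  by (simp add: skip_def set_reg_def)

text \<open>Node \<open>0\<close> is the null pointer; \<open>link x\<close> is the node saying that \<open>x\<close> has to be in \<open>V2\<close>.\<close>

fun node :: "lit \<Rightarrow> nat" where
  "node (Pos x) = 3 * x + 1"
| "node (Neg x) = 3 * x + 2"

definition link :: "nat \<Rightarrow> nat" where
  "link x = 3 * x + 3"

definition base :: "nat \<Rightarrow> nat set" where
  "base n = {1..<3 * n + 1}"

lemma node_inj [simp]: "node l = node k \<longleftrightarrow> l = k"
  by (cases l; cases k) (auto, presburger+)

lemma link_inj [simp]: "link x = link y \<longleftrightarrow> x = y"
  by (simp add: link_def)

lemma node_neq_link [simp]: "node l \<noteq> link x" "link x \<noteq> node l"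
  by (cases l; simp add: link_def; presburger)+

lemma node_pos [simp]: "0 < node l" "0 < link x"
  by (cases l; simp add: link_def)+

lemma node_in_base [simp]: "node l \<in> base n \<longleftrightarrow> lit_var l < n"
  by (cases l) (auto simp: base_def)

lemma link_in_base [simp]: "link x \<in> base n \<longleftrightarrow> x < n"
  by (auto simp: base_def link_def)

text \<open>The tables replace arithmetic on literal codes. The value 0 of \<open>aNeg\<close> off
  the literal nodes lets the consistency check treat all visited nodes alike, since 0 is never
  visited.\<close>

definition tables :: "nat \<Rightarrow> state \<Rightarrow> bool" where
  "tables n s \<longleftrightarrow>
     (\<forall>l. lit_var l < n \<longrightarrow> arr s aNode (encode_lit l) = node l \<and>
        arr s aNeg (node l) = node (negate l) \<and> arr s aLink (node l) = link (lit_var l)) \<and>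
     (\<forall>v. (\<nexists>l. lit_var l < n \<and> v = node l) \<longrightarrow> arr s aNeg v = 0)"

text \<open>
  A node keeps its two out-edges: the new edge is stored in a fresh node that is inserted into the
  list of successors right behind \<open>u\<close>.
\<close>

definition edge :: "nat \<Rightarrow> nat \<Rightarrow> prog" where
  "edge u v = Write aTarget rFresh v ;; Read rTmp aNext u ;; Write aNext rFresh rTmp ;;
     Write aNext u rFresh ;; Inc rFresh"

text \<open>The null pointer is marked from the outset, so the test for marked nodes also filters
  out missing successors.\<close>

definition push :: "nat \<Rightarrow> nat \<Rightarrow> nat \<Rightarrow> nat \<Rightarrow> prog" where
  "push mk q t v = Read rTmp aMark v ;;
     If (Equal rTmp rZero)
       (Read rTmp mk v ;;
        If (Equal rTmp rStamp) skip (Write mk v rStamp ;; Write q t v ;; Inc t))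
       skip"

text \<open>The required nodes D are put directly into the queue of the first search channel with
  stamp 1, so that the seed of the initial search is in place when the graph is finished.\<close>

definition building :: "(nat \<Rightarrow> nat) \<Rightarrow> nat \<Rightarrow> nat set \<Rightarrow> (nat set \<Rightarrow> bool) \<Rightarrow> state \<Rightarrow> bool" where
  "building inp n R \<Phi> s \<longleftrightarrow>
     arr s aIn = inp \<and> tables n s \<and> arr s aMark = (\<lambda>_. 0)(0 := 1) \<and>
     arr s aOut = (\<lambda>_. 0) \<and> arr s aSeenB = (\<lambda>_. 0) \<and>
     reg s rZero = 0 \<and> reg s rOne = 1 \<and> reg s rTwo = 2 \<and> reg s rStamp = 1 \<and> reg s rHA = 0 \<and>
     0 < reg s rFresh \<and> (\<forall>v. arr s aSeenA v \<le> 1) \<and>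
     (\<exists>D. represents (arr s aNext) (arr s aTarget) (reg s rFresh) D R \<Phi> \<and>
       queued (arr s aSeenA) 1 (arr s aQueueA) (reg s rTA) D)"

lemma building_set_reg [simp]:
  "r \<notin> {rZero, rOne, rTwo, rStamp, rFresh, rHA, rTA} \<Longrightarrow>
    building inp n R \<Phi> (set_reg r v s) \<longleftrightarrow> building inp n R \<Phi> s"
  by (simp add: building_def tables_def)

lemma building_cong:
  "building inp n R \<Phi> s \<Longrightarrow> (\<And>X. X \<subseteq> R \<Longrightarrow> \<Phi> X \<longleftrightarrow> \<Psi> X) \<Longrightarrow> building inp n R \<Psi> s"
  unfolding building_def using represents_cong[of _ _ _ _ R \<Phi> \<Psi>] by metis

lemma building_forget:
  assumes "building inp n R \<Phi> s" "R' \<subseteq> R"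
    "\<And>X. X \<subseteq> R' \<Longrightarrow> \<Psi> X \<longleftrightarrow> (\<exists>X'\<subseteq>R. X' \<inter> R' = X \<and> \<Phi> X')"
  shows "building inp n R' \<Psi> s"
proof -
  have "represents N T f D R' \<Psi>" if "represents N T f D R \<Phi>" for N T f D
    using that assms(2,3) by (rule represents_forget)
  then show ?thesis using assms(1) unfolding building_def by metis
qed

lemma building_bounds:
  "building inp n R \<Phi> s \<Longrightarrow> 0 < reg s rFresh \<and> R \<subseteq> {1..<reg s rFresh} \<and> reg s rZero = 0"
  by (auto simp: building_def represents_def)

lemma building_new:
  assumes "building inp n R \<Phi> s"
  shows "building inp n (insert (reg s rFresh) R) (\<lambda>X. \<Phi> (X - {reg s rFresh}))
    (set_reg rFresh (Suc (reg s rFresh)) s)"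
proof -
  obtain D where "represents (arr s aNext) (arr s aTarget) (reg s rFresh) D R \<Phi>" "0 < reg s rFresh"
      "queued (arr s aSeenA) 1 (arr s aQueueA) (reg s rTA) D"
    using assms unfolding building_def by blast
  with represents_new[OF this(1,2)] assms show ?thesis
    by (auto simp: building_def tables_def)
qed

lemma wp_edge:
  assumes b: "building inp n R \<Phi> s" and u: "reg s u = 0 \<or> reg s u \<in> R" and v: "reg s v = 0 \<or> reg s v \<in> R"
    and uv: "u \<notin> {rFresh, rTmp}" "v \<notin> {rFresh, rTmp}"
    and Q: "\<And>s'. building inp n R (\<lambda>X. \<Phi> X \<and> (reg s u \<in> X \<longrightarrow> reg s v = 0 \<or> reg s v \<in> X)) s' \<Longrightarrow>
      reg s' rFresh = Suc (reg s rFresh) \<Longrightarrow>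
      (\<And>r. r \<notin> {rFresh, rTmp} \<Longrightarrow> reg s' r = reg s r) \<Longrightarrow> Q (T + 5) s'"
  shows "wp (edge u v) T s Q"
proof -
  let ?s = "set_reg rFresh (Suc (reg s rFresh)) (set_arr aNext (reg s u) (reg s rFresh)
    (set_arr aNext (reg s rFresh) (arr s aNext (reg s u)) (set_reg rTmp (arr s aNext (reg s u))
      (set_arr aTarget (reg s rFresh) (reg s v) s))))"
  obtain D where D: "represents (arr s aNext) (arr s aTarget) (reg s rFresh) D R \<Phi>"
      "queued (arr s aSeenA) 1 (arr s aQueueA) (reg s rTA) D" "0 < reg s rFresh"
    using b unfolding building_def by blast
  have "building inp n R (\<lambda>X. \<Phi> X \<and> (reg s u \<in> X \<longrightarrow> reg s v = 0 \<or> reg s v \<in> X)) ?s"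
    using b represents_edge[OF D(1,3) u v] D(2)
    unfolding building_def by (auto simp: tables_def)
  then have "Q (T + 5) ?s" by (rule Q) auto
  then show ?thesis using uv by (simp add: edge_def plus_numeral_Suc)
qed

lemma wp_push_building:
  assumes b: "building inp n R \<Phi> s" and v: "reg s v = 0 \<or> reg s v \<in> R"
    and uv: "v \<notin> {rTmp, rTA}"
    and Q: "\<And>T' s'. T' \<le> T + 7 \<Longrightarrow> T \<le> T' \<Longrightarrow> building inp n R (\<lambda>X. \<Phi> X \<and> (reg s v = 0 \<or> reg s v \<in> X)) s' \<Longrightarrow>
      (\<And>r. r \<notin> {rTA, rTmp} \<Longrightarrow> reg s' r = reg s r) \<Longrightarrow> Q T' s'"
  shows "wp (push aSeenA aQueueA rTA v) T s Q"
proof -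
  obtain D where D: "represents (arr s aNext) (arr s aTarget) (reg s rFresh) D R \<Phi>"
      "queued (arr s aSeenA) 1 (arr s aQueueA) (reg s rTA) D"
    using b unfolding building_def by blast
  note r = represents_require[OF D(1) v]
  have m: "arr s aMark = (\<lambda>_. 0)(0 := 1)" "reg s rZero = 0" "reg s rStamp = 1"
    using b unfolding building_def by blast+
  define \<Psi> where "\<Psi> = (\<lambda>X. \<Phi> X \<and> (reg s v = 0 \<or> reg s v \<in> X))"
  note Q = Q[folded \<Psi>_def] and r = r[folded \<Psi>_def]
  have seen: "arr s aSeenA (reg s v) = 1 \<longleftrightarrow> reg s v \<in> D"
    using D(2) unfolding queued_def by blast
  show ?thesis
  proof (cases "reg s v = 0 \<or> reg s v \<in> D")
    case True
    then have "D \<union> ({reg s v} - {0}) = D" by blast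
    then have b': "building inp n R \<Psi> s"
      using b r D(2) unfolding building_def by auto
    show ?thesis
    proof (cases "reg s v = 0")
      case True
      have "Q (T + 3) (set_reg rTmp 1 s)" by (rule Q) (auto simp: b')
      then show ?thesis using True m uv by (simp add: push_def plus_numeral_Suc)
    next
      case False
      with True seen have "arr s aSeenA (reg s v) = 1" by simp
      moreover have "Q (T + 5) (set_reg rTmp 1 s)" by (rule Q) (auto simp: b')
      ultimately show ?thesis using False m uv by (simp add: push_def plus_numeral_Suc)
    qed
  next
    case False
    let ?s = "set_reg rTA (Suc (reg s rTA)) (set_arr aQueueA (reg s rTA) (reg s v)
          (set_arr aSeenA (reg s v) 1 (set_reg rTmp (arr s aSeenA (reg s v)) (set_reg rTmp 0 s))))"
    have "D \<union> ({reg s v} - {0}) = insert (reg s v) D" using False by auto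
    then have "building inp n R \<Psi> ?s"
      using b r queued_push[OF D(2)] False unfolding building_def by (auto simp: tables_def)
    then have "Q (T + 7) ?s" by (rule Q[rotated 2]) auto
    then show ?thesis
      using False seen m uv by (simp add: push_def plus_numeral_Suc)
  qed
qed

section \<open>Reading a clause\<close>

lemma wp_exec: "exec p s t s' \<Longrightarrow> wp p T s Q \<longleftrightarrow> Q (T + t) s'"
  unfolding wp_def by (metis exec_deterministic)

definition with_edge :: "(nat set \<Rightarrow> bool) \<Rightarrow> nat \<Rightarrow> nat \<Rightarrow> nat set \<Rightarrow> bool" where
  "with_edge \<Phi> u v X \<longleftrightarrow> \<Phi> X \<and> (u \<in> X \<longrightarrow> v = 0 \<or> v \<in> X)"

lemma edge_exec:
  assumes "building inp n R \<Phi> s" "reg s u = 0 \<or> reg s u \<in> R" "reg s v = 0 \<or> reg s v \<in> R"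
    "u \<notin> {rFresh, rTmp}" "v \<notin> {rFresh, rTmp}"
  obtains s' where "exec (edge u v) s 5 s'" "building inp n R (with_edge \<Phi> (reg s u) (reg s v)) s'"
    "reg s' rFresh = Suc (reg s rFresh)" "\<forall>r. r \<noteq> rFresh \<longrightarrow> r \<noteq> rTmp \<longrightarrow> reg s' r = reg s r"
proof -
  let ?P = "\<lambda>s'. building inp n R (with_edge \<Phi> (reg s u) (reg s v)) s' \<and>
    reg s' rFresh = Suc (reg s rFresh) \<and> (\<forall>r. r \<noteq> rFresh \<longrightarrow> r \<noteq> rTmp \<longrightarrow> reg s' r = reg s r)"
  have "wp (edge u v) 0 s (\<lambda>T' s'. T' = 5 \<and> ?P s')"
    by (rule wp_edge[OF assms]) (simp_all add: with_edge_def[abs_def])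
  then show ?thesis unfolding wp_def using that by auto
qed

lemma node_nonzero [simp]: "node l \<noteq> 0" "link x \<noteq> 0"
  by simp_all

definition new :: "nat \<Rightarrow> prog" where
  "new r = Copy r rFresh ;; Inc rFresh"

lemma new_exec:
  assumes b: "building inp n R \<Phi> s"
    and r: "r \<notin> {rZero, rOne, rTwo, rStamp, rFresh, rHA, rTA}"
  obtains s' where "exec (new r) s 2 s'"
    "building inp n (insert (reg s rFresh) R) (\<lambda>X. \<Phi> (X - {reg s rFresh})) s'"
    "reg s' r = reg s rFresh" "reg s' rFresh = Suc (reg s rFresh)"
    "\<forall>q. q \<noteq> r \<longrightarrow> q \<noteq> rFresh \<longrightarrow> reg s' q = reg s q"
proof -
  let ?s = "set_reg rFresh (Suc (reg s rFresh)) (set_reg r (reg s rFresh) s)"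
  have "building inp n R \<Phi> (set_reg r (reg s rFresh) s)" using b r by simp
  from building_new[OF this] have "building inp n (insert (reg s rFresh) R) (\<lambda>X. \<Phi> (X - {reg s rFresh})) ?s"
    using r by simp
  moreover have "exec (new r) s 2 ?s"
  proof -
    have "wp (new r) 0 s (\<lambda>T' s'. T' = 2 \<and> s' = ?s)"
      using r by (simp add: new_def)
    then show ?thesis unfolding wp_def by auto
  qed
  ultimately show ?thesis using that[of ?s] r by simp
qed

definition read_lit :: prog where
  "read_lit = Read rC aIn rPos ;; Inc rPos ;; Read rL aNode rC ;; Read rNl aNeg rL"

lemma read_lit_exec:
  assumes b: "building inp n R \<Phi> s" and l: "lit_var l < n" "inp (reg s rPos) = encode_lit l"
  obtains s' where "exec read_lit s 4 s'" "building inp n R \<Phi> s'"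
    "reg s' rL = node l" "reg s' rNl = node (negate l)" "reg s' rPos = Suc (reg s rPos)"
    "\<forall>q. q \<notin> {rC, rPos, rL, rNl} \<longrightarrow> reg s' q = reg s q"
proof -
  let ?s = "set_reg rNl (node (negate l)) (set_reg rL (node l) (set_reg rPos (Suc (reg s rPos))
    (set_reg rC (encode_lit l) s)))"
  have v: "arr s aIn (reg s rPos) = encode_lit l" "arr s aNode (encode_lit l) = node l"
    "arr s aNeg (node l) = node (negate l)"
    using b l unfolding building_def tables_def by auto
  have "wp read_lit 0 s (\<lambda>T' s'. T' = 4 \<and> s' = ?s)"
    by (simp add: read_lit_def v)
  then have "exec read_lit s 4 ?s" unfolding wp_def by auto
  then show ?thesis using that[of ?s] b by simp
qed

text \<open>Both contrapositives at once, hence symmetric: \<open>sorted_wrt\<close> of it covers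
  all pairs in both orders, and appending a literal adds only the pairs with that literal.\<close>

definition pair_closed :: "nat set \<Rightarrow> lit \<Rightarrow> lit \<Rightarrow> bool" where
  "pair_closed X l k \<longleftrightarrow> (node (negate l) \<in> X \<longrightarrow> node k \<in> X) \<and> (node (negate k) \<in> X \<longrightarrow> node l \<in> X)"

text \<open>
  The clause node \<open>\<sigma>\<close> is reached from the complements of all literals read so far, and \<open>t\<close> reaches
  all these literals (\<open>t = 0\<close> if there are none yet).
\<close>

definition chain :: "(nat set \<Rightarrow> bool) \<Rightarrow> nat \<Rightarrow> lit list \<Rightarrow> nat \<Rightarrow> nat \<Rightarrow> nat set \<Rightarrow> bool" where
  "chain \<Psi> n ys \<sigma> t X \<longleftrightarrow> \<Psi> (X \<inter> base n) \<and> sorted_wrt (pair_closed X) ys \<and>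
     (\<forall>l\<in>set ys. node (negate l) \<in> X \<longrightarrow> \<sigma> \<in> X) \<and> (t \<in> X \<longrightarrow> (\<forall>l\<in>set ys. node l \<in> X))"

lemma pair_closed_Int:
  "lit_var l < n \<Longrightarrow> lit_var k < n \<Longrightarrow> pair_closed (X \<inter> base n) l k \<longleftrightarrow> pair_closed X l k"
  by (simp add: pair_closed_def)

lemma sorted_pair_cong:
  assumes "X \<inter> base n = X' \<inter> base n" "\<forall>l\<in>set ys. lit_var l < n"
  shows "sorted_wrt (pair_closed X) ys \<longleftrightarrow> sorted_wrt (pair_closed X') ys"
proof -
  have "pair_closed X l k \<longleftrightarrow> pair_closed X' l k" if "l \<in> set ys" "k \<in> set ys" for l k
    using assms pair_closed_Int that by metis
  then show ?thesis using sorted_wrt_mono_rel[of ys] by metis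
qed

text \<open>Six edges replace the implications between \<open>l\<close> and all earlier literals.
  The edge from \<open>\<sigma>\<close> to \<open>l\<close> serves the complements seen before, the
  one from \<open>negate l\<close> to \<open>t\<close> gives all earlier literals; \<open>f\<close>
  and \<open>g\<close> take over the roles of \<open>\<sigma>\<close> and \<open>t\<close> for the
  longer list.\<close>

lemma chain_extend:
  assumes out: "\<sigma> \<notin> base n" "f \<notin> base n" "g \<notin> base n" "t \<notin> base n" "distinct [0, \<sigma>, f, g]" "t \<notin> {\<sigma>, f, g}"
    and ys: "\<forall>l\<in>set ys. lit_var l < n" "lit_var l < n" and t0: "t = 0 \<Longrightarrow> ys = []"
    and X: "X \<subseteq> insert f (insert g (base n))"
  defines "R \<equiv> insert g (insert f (insert \<sigma> (base n \<union> ({t} - {0}))))"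
  shows "chain \<Psi> n (ys @ [l]) f g X \<longleftrightarrow> (\<exists>X'\<subseteq>R. X' \<inter> insert f (insert g (base n)) = X \<and>
     chain \<Psi> n ys \<sigma> t X' \<and> (\<sigma> \<in> X' \<longrightarrow> node l \<in> X') \<and> (node (negate l) \<in> X' \<longrightarrow> t = 0 \<or> t \<in> X') \<and>
     (\<sigma> \<in> X' \<longrightarrow> f \<in> X') \<and> (node (negate l) \<in> X' \<longrightarrow> f \<in> X') \<and>
     (g \<in> X' \<longrightarrow> node l \<in> X') \<and> (g \<in> X' \<longrightarrow> t = 0 \<or> t \<in> X'))"
proof
  assume c: "chain \<Psi> n (ys @ [l]) f g X"
  let ?A = "\<exists>k\<in>set ys. node (negate k) \<in> X" and ?B = "t \<noteq> 0 \<and> (\<forall>k\<in>set ys. node k \<in> X)"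
  \<comment> \<open>The old auxiliary nodes are about to be hidden and must be chosen:
    \<open>\<sigma>\<close> only if an earlier complement demands it, \<open>t\<close> whenever all
    literals it points to are present.\<close>
  let ?X = "X \<union> (if ?A then {\<sigma>} else {}) \<union> (if ?B then {t} else {})"
  have nb: "node k \<noteq> \<sigma>" "node k \<noteq> t" if "lit_var k < n" for k
    using that out by (metis node_in_base)+
  have eq: "node k \<in> ?X \<longleftrightarrow> node k \<in> X" if "lit_var k < n" for k
    using nb[OF that] by auto
  have st: "\<sigma> \<in> ?X \<longleftrightarrow> ?A" "t \<in> ?X \<longleftrightarrow> ?B" "f \<in> ?X \<longleftrightarrow> f \<in> X" "g \<in> ?X \<longleftrightarrow> g \<in> X"
    using X out by auto
  have base: "?X \<inter> base n = X \<inter> base n" using out by auto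
  have "?X \<subseteq> R" using X unfolding R_def by auto
  moreover have "?X \<inter> insert f (insert g (base n)) = X" using X out by auto
  moreover have "chain \<Psi> n ys \<sigma> t ?X"
    using c sorted_pair_cong[OF base ys(1)] ys(1) eq
    unfolding chain_def base st by (auto simp: sorted_wrt_append simp del: Un_iff)
  moreover have "\<sigma> \<in> ?X \<longrightarrow> node l \<in> ?X" "node (negate l) \<in> ?X \<longrightarrow> t = 0 \<or> t \<in> ?X"
     "\<sigma> \<in> ?X \<longrightarrow> f \<in> ?X" "node (negate l) \<in> ?X \<longrightarrow> f \<in> ?X"
     "g \<in> ?X \<longrightarrow> node l \<in> ?X" "g \<in> ?X \<longrightarrow> t = 0 \<or> t \<in> ?X"
  proof -
    have "pair_closed X k l" if "k \<in> set ys" for k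
      using c that by (simp add: chain_def sorted_wrt_append)
    moreover have ln: "lit_var (negate l) < n" using ys(2) by simp
    ultimately show "\<sigma> \<in> ?X \<longrightarrow> node l \<in> ?X" "node (negate l) \<in> ?X \<longrightarrow> t = 0 \<or> t \<in> ?X"
     "\<sigma> \<in> ?X \<longrightarrow> f \<in> ?X" "node (negate l) \<in> ?X \<longrightarrow> f \<in> ?X"
     "g \<in> ?X \<longrightarrow> node l \<in> ?X" "g \<in> ?X \<longrightarrow> t = 0 \<or> t \<in> ?X"
      using c ys(2) unfolding st eq[OF ys(2)] eq[OF ln] chain_def pair_closed_def by auto
  qed
  ultimately show "\<exists>X'\<subseteq>R. X' \<inter> insert f (insert g (base n)) = X \<and>
     chain \<Psi> n ys \<sigma> t X' \<and> (\<sigma> \<in> X' \<longrightarrow> node l \<in> X') \<and> (node (negate l) \<in> X' \<longrightarrow> t = 0 \<or> t \<in> X') \<and>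
     (\<sigma> \<in> X' \<longrightarrow> f \<in> X') \<and> (node (negate l) \<in> X' \<longrightarrow> f \<in> X') \<and>
     (g \<in> X' \<longrightarrow> node l \<in> X') \<and> (g \<in> X' \<longrightarrow> t = 0 \<or> t \<in> X')"
    by (intro exI[of _ ?X] conjI) assumption+
next
  assume "\<exists>X'\<subseteq>R. X' \<inter> insert f (insert g (base n)) = X \<and>
     chain \<Psi> n ys \<sigma> t X' \<and> (\<sigma> \<in> X' \<longrightarrow> node l \<in> X') \<and> (node (negate l) \<in> X' \<longrightarrow> t = 0 \<or> t \<in> X') \<and>
     (\<sigma> \<in> X' \<longrightarrow> f \<in> X') \<and> (node (negate l) \<in> X' \<longrightarrow> f \<in> X') \<and>
     (g \<in> X' \<longrightarrow> node l \<in> X') \<and> (g \<in> X' \<longrightarrow> t = 0 \<or> t \<in> X')"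
  then obtain X' where X': "X' \<inter> insert f (insert g (base n)) = X" "chain \<Psi> n ys \<sigma> t X'"
    and i: "\<sigma> \<in> X' \<Longrightarrow> node l \<in> X'" "node (negate l) \<in> X' \<Longrightarrow> t = 0 \<or> t \<in> X'"
      "\<sigma> \<in> X' \<Longrightarrow> f \<in> X'" "node (negate l) \<in> X' \<Longrightarrow> f \<in> X'"
      "g \<in> X' \<Longrightarrow> node l \<in> X'" "g \<in> X' \<Longrightarrow> t = 0 \<or> t \<in> X'" by blast
  have base: "X \<inter> base n = X' \<inter> base n" using X'(1) by blast
  have eq: "node k \<in> X \<longleftrightarrow> node k \<in> X'" if "lit_var k < n" for k
    using base that by (metis Int_iff node_in_base)
  have fg: "f \<in> X \<longleftrightarrow> f \<in> X'" "g \<in> X \<longleftrightarrow> g \<in> X'" using X'(1) by blast+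
  have n: "lit_var (negate k) < n" "lit_var k < n" if "k \<in> set ys" for k using ys(1) that by auto
  have ln: "lit_var (negate l) < n" using ys(2) by simp
  have "pair_closed X k l" if k: "k \<in> set ys" for k
    using X'(2) i t0 k unfolding pair_closed_def eq[OF n(1)[OF k]] eq[OF n(2)[OF k]] eq[OF ys(2)] eq[OF ln] chain_def
    by auto
  moreover have "sorted_wrt (pair_closed X) ys"
    using X'(2) sorted_pair_cong[OF base ys(1)] by (simp add: chain_def)
  moreover have "\<forall>k\<in>set (ys @ [l]). node (negate k) \<in> X \<longrightarrow> f \<in> X"
    using X'(2) i eq n ys(2) ln fg by (auto simp: chain_def)
  moreover have "g \<in> X \<longrightarrow> (\<forall>k\<in>set (ys @ [l]). node k \<in> X)"
    using X'(2) i eq n ys(2) fg t0 by (auto simp: chain_def)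
  moreover have "\<Psi> (X \<inter> base n)" using X'(2) base by (simp add: chain_def)
  ultimately show "chain \<Psi> n (ys @ [l]) f g X" by (simp add: chain_def sorted_wrt_append)
qed

text \<open>\<open>b\<close> says that the clause has a xor part. Requiring \<open>t\<close> then
  forces all disjunctive literals at once, these being the complements of the literals that the
  clause forbids.\<close>

lemma chain_finish:
  assumes out: "\<sigma> \<notin> base n" "t \<notin> base n" "\<sigma> \<noteq> t" and ys: "\<forall>l\<in>set ys. lit_var l < n"
    and t0: "t = 0 \<Longrightarrow> ys = []" and X: "X \<subseteq> base n"
  defines "R \<equiv> insert \<sigma> (base n \<union> ({t} - {0}))"
  shows "\<Psi> X \<and> sorted_wrt (pair_closed X) ys \<and> (b \<longrightarrow> (\<forall>l\<in>set ys. node l \<in> X)) \<longleftrightarrow>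
    (\<exists>X'\<subseteq>R. X' \<inter> base n = X \<and> chain \<Psi> n ys \<sigma> t X' \<and> (b \<longrightarrow> t = 0 \<or> t \<in> X'))"
proof
  assume c: "\<Psi> X \<and> sorted_wrt (pair_closed X) ys \<and> (b \<longrightarrow> (\<forall>l\<in>set ys. node l \<in> X))"
  \<comment> \<open>After the last literal no edge leading onward constrains
    \<open>\<sigma>\<close>, so it can simply be included.\<close>
  let ?X = "insert \<sigma> (X \<union> (if b \<and> t \<noteq> 0 then {t} else {}))"
  have base: "?X \<inter> base n = X" "?X \<inter> base n = X \<inter> base n" using X out by auto
  moreover have "?X \<subseteq> R" using X unfolding R_def by auto
  moreover have "t \<notin> X" using X out by blast
  then have "chain \<Psi> n ys \<sigma> t ?X"
    using c out(3) sorted_pair_cong[OF base(2) ys] unfolding chain_def base(1) by auto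
  ultimately show "\<exists>X'\<subseteq>R. X' \<inter> base n = X \<and> chain \<Psi> n ys \<sigma> t X' \<and> (b \<longrightarrow> t = 0 \<or> t \<in> X')"
    by (intro exI[of _ ?X]) auto
next
  assume "\<exists>X'\<subseteq>R. X' \<inter> base n = X \<and> chain \<Psi> n ys \<sigma> t X' \<and> (b \<longrightarrow> t = 0 \<or> t \<in> X')"
  then obtain X' where X': "X' \<inter> base n = X" "chain \<Psi> n ys \<sigma> t X'" "b \<longrightarrow> t = 0 \<or> t \<in> X'" by blast
  have base: "X \<inter> base n = X' \<inter> base n" using X'(1) by blast
  have "b \<longrightarrow> (\<forall>l\<in>set ys. node l \<in> X)"
    using X' t0 ys unfolding chain_def by auto
  then show "\<Psi> X \<and> sorted_wrt (pair_closed X) ys \<and> (b \<longrightarrow> (\<forall>l\<in>set ys. node l \<in> X))"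
    using X' sorted_pair_cong[OF base ys] unfolding chain_def by auto
qed

definition disj_step :: prog where
  "disj_step = read_lit ;; edge rSuf rL ;; edge rNl rPre ;; new rNew ;; edge rSuf rNew ;;
     edge rNl rNew ;; Copy rSuf rNew ;; new rNew ;; edge rNew rL ;; edge rNew rPre ;;
     Copy rPre rNew ;; Dec rK"

definition chaining ::
    "(nat \<Rightarrow> nat) \<Rightarrow> nat \<Rightarrow> (nat set \<Rightarrow> bool) \<Rightarrow> lit list \<Rightarrow> state \<Rightarrow> bool" where
  "chaining inp n \<Psi> ys s \<longleftrightarrow> (let \<sigma> = reg s rSuf; t = reg s rPre in
     building inp n (insert \<sigma> (base n \<union> ({t} - {0}))) (chain \<Psi> n ys \<sigma> t) s \<and>
     \<sigma> \<notin> base n \<and> t \<notin> base n \<and> \<sigma> \<noteq> 0 \<and> \<sigma> \<noteq> t \<and> (t = 0 \<longrightarrow> ys = []))"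

lemma zero_not_base [simp]: "0 \<notin> base n"
  by (simp add: base_def)

text \<open>41 is the sum of one literal read (4), six edges (5 each), two new nodes (2 each) and
  three register operations. That \<open>rFresh\<close> grows by no more than the time spent is what
  later bounds the size of the graph.\<close>

lemma disj_step_exec:
  assumes c: "chaining inp n \<Psi> ys s" and l: "lit_var l < n" "inp (reg s rPos) = encode_lit l"
    and ys: "\<forall>l\<in>set ys. lit_var l < n"
  shows "\<exists>s'. exec disj_step s 41 s' \<and> chaining inp n \<Psi> (ys @ [l]) s' \<and>
    reg s' rFresh \<le> reg s rFresh + 41 \<and> reg s' rPos = Suc (reg s rPos) \<and> reg s' rK = reg s rK - 1 \<and>
    reg s' rM = reg s rM"
proof -
  define \<sigma> where "\<sigma> = reg s rSuf"
  define t where "t = reg s rPre"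
  define R where "R = insert \<sigma> (base n \<union> ({t} - {0}))"
  define a where "a = node l"
  define b where "b = node (negate l)"
  let ?\<Phi>1 = "chain \<Psi> n ys \<sigma> t"
  have c1: "building inp n R ?\<Phi>1 s"
    and out: "\<sigma> \<notin> base n" "t \<notin> base n" "\<sigma> \<noteq> 0" "\<sigma> \<noteq> t" and t0: "t = 0 \<Longrightarrow> ys = []"
    using c by (auto simp: chaining_def Let_def R_def \<sigma>_def t_def)
  have mem: "a \<in> R" "b \<in> R" "\<sigma> \<in> R" "t = 0 \<or> t \<in> R"
    using l(1) by (auto simp: R_def a_def b_def)
  obtain s1 where 1: "exec read_lit s 4 s1" "building inp n R ?\<Phi>1 s1"
      "reg s1 rL = a" "reg s1 rNl = b" "reg s1 rPos = Suc (reg s rPos)"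
      "\<forall>q. q \<notin> {rC, rPos, rL, rNl} \<longrightarrow> reg s1 q = reg s q"
    unfolding a_def b_def by (rule read_lit_exec[OF c1 l])
  have r1: "reg s1 rSuf = \<sigma>" "reg s1 rPre = t" "reg s1 rFresh = reg s rFresh" "reg s1 rK = reg s rK"
    using 1(6) by (simp_all add: \<sigma>_def t_def)
  obtain s2 where 2: "exec (edge rSuf rL) s1 5 s2" "building inp n R (with_edge ?\<Phi>1 \<sigma> a) s2"
      "reg s2 rFresh = Suc (reg s1 rFresh)" "\<forall>r. r \<noteq> rFresh \<longrightarrow> r \<noteq> rTmp \<longrightarrow> reg s2 r = reg s1 r"
    using edge_exec[OF 1(2), of rSuf rL] mem by (auto simp: 1(3,4) r1)
  let ?\<Phi>3 = "with_edge (with_edge ?\<Phi>1 \<sigma> a) b t"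
  obtain s3 where 3: "exec (edge rNl rPre) s2 5 s3" "building inp n R ?\<Phi>3 s3"
      "reg s3 rFresh = Suc (reg s2 rFresh)" "\<forall>r. r \<noteq> rFresh \<longrightarrow> r \<noteq> rTmp \<longrightarrow> reg s3 r = reg s2 r"
    using edge_exec[OF 2(2), of rNl rPre] mem by (auto simp: 1(3,4) r1 2(4))
  define f where "f = reg s3 rFresh"
  let ?\<Phi>4 = "\<lambda>X. ?\<Phi>3 (X - {f})"
  obtain s4 where 4: "exec (new rNew) s3 2 s4" "building inp n (insert f R) ?\<Phi>4 s4"
      "reg s4 rNew = f" "reg s4 rFresh = Suc f"
      "\<forall>q. q \<noteq> rNew \<longrightarrow> q \<noteq> rFresh \<longrightarrow> reg s4 q = reg s3 q"
    using new_exec[OF 3(2), of rNew] by (auto simp: f_def)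
  note r4 = 1(3,4) r1 2(4) 3(4) 4(3,4,5)
  obtain s5 where 5: "exec (edge rSuf rNew) s4 5 s5" "building inp n (insert f R) (with_edge ?\<Phi>4 \<sigma> f) s5"
      "reg s5 rFresh = Suc (reg s4 rFresh)" "\<forall>r. r \<noteq> rFresh \<longrightarrow> r \<noteq> rTmp \<longrightarrow> reg s5 r = reg s4 r"
    using edge_exec[OF 4(2), of rSuf rNew] mem by (auto simp: r4)
  let ?\<Phi>6 = "with_edge (with_edge ?\<Phi>4 \<sigma> f) b f"
  obtain s6 where 6: "exec (edge rNl rNew) s5 5 s6" "building inp n (insert f R) ?\<Phi>6 s6"
      "reg s6 rFresh = Suc (reg s5 rFresh)" "\<forall>r. r \<noteq> rFresh \<longrightarrow> r \<noteq> rTmp \<longrightarrow> reg s6 r = reg s5 r"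
    using edge_exec[OF 5(2), of rNl rNew] mem by (auto simp: r4 5(4))
  define s7 where "s7 = set_reg rSuf f s6"
  define g where "g = reg s6 rFresh"
  have s7: "building inp n (insert f R) ?\<Phi>6 s7" "reg s7 rFresh = g"
    using 6(2) by (simp_all add: s7_def g_def)
  let ?\<Phi>8 = "\<lambda>X. ?\<Phi>6 (X - {g})"
  obtain s8 where 8: "exec (new rNew) s7 2 s8" "building inp n (insert g (insert f R)) ?\<Phi>8 s8"
      "reg s8 rNew = g" "reg s8 rFresh = Suc g"
      "\<forall>q. q \<noteq> rNew \<longrightarrow> q \<noteq> rFresh \<longrightarrow> reg s8 q = reg s7 q"
    using new_exec[OF s7(1), of rNew] by (auto simp: s7(2))
  note r8 = r4 5(4) 6(4) 8(3,4,5)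
  have s8: "reg s8 rL = a" "reg s8 rPre = t" by (simp_all add: r8 s7_def)
  obtain s9 where 9: "exec (edge rNew rL) s8 5 s9" "building inp n (insert g (insert f R)) (with_edge ?\<Phi>8 g a) s9"
      "reg s9 rFresh = Suc (reg s8 rFresh)" "\<forall>r. r \<noteq> rFresh \<longrightarrow> r \<noteq> rTmp \<longrightarrow> reg s9 r = reg s8 r"
    using edge_exec[OF 8(2), of rNew rL] mem by (auto simp: 8(3) s8)
  let ?\<Phi>10 = "with_edge (with_edge ?\<Phi>8 g a) g t"
  obtain s10 where 10: "exec (edge rNew rPre) s9 5 s10" "building inp n (insert g (insert f R)) ?\<Phi>10 s10"
      "reg s10 rFresh = Suc (reg s9 rFresh)" "\<forall>r. r \<noteq> rFresh \<longrightarrow> r \<noteq> rTmp \<longrightarrow> reg s10 r = reg s9 r"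
    using edge_exec[OF 9(2), of rNew rPre] mem by (auto simp: 8(3) s8 9(4))
  let ?s = "set_reg rK (reg s rK - 1) (set_reg rPre g s10)"
  have regs: "reg s10 rNew = g" "reg s10 rK = reg s rK" "reg s6 rNew = f" "reg s10 rSuf = f"
    "reg s10 rPos = Suc (reg s rPos)"
    using r8 1(5) by (simp_all add: 9(4) 10(4) s7_def)
  have "wp disj_step 0 s (\<lambda>T' s'. T' = 41 \<and> s' = ?s)"
    unfolding disj_step_def
    by (simp add: wp_exec[OF 1(1)] wp_exec[OF 2(1)] wp_exec[OF 3(1)] wp_exec[OF 4(1)] wp_exec[OF 5(1)]
      wp_exec[OF 6(1)] regs s7_def[symmetric] wp_exec[OF 8(1)] wp_exec[OF 9(1)] wp_exec[OF 10(1)])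
  then have ex: "exec disj_step s 41 ?s" unfolding wp_def by auto
  have fR: "f \<notin> R" "f \<noteq> 0" "R \<subseteq> {1..<f}"
    using building_bounds[OF 3(2)] by (auto simp: f_def)
  have gR: "g \<notin> insert f R" "g \<noteq> 0"
    using building_bounds[OF s7(1)] by (auto simp: s7(2))
  have "base n \<subseteq> R" by (auto simp: R_def)
  then have out': "\<sigma> \<notin> base n" "f \<notin> base n" "g \<notin> base n" "t \<notin> base n" "distinct [0, \<sigma>, f, g]" "t \<notin> {\<sigma>, f, g}"
    using out fR gR by (auto simp: R_def)
  have "building inp n (insert f (insert g (base n))) (chain \<Psi> n (ys @ [l]) f g) s10"
  proof (rule building_forget[OF 10(2)])
    show "insert f (insert g (base n)) \<subseteq> insert g (insert f R)" by (auto simp: R_def)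
    fix X assume X: "X \<subseteq> insert f (insert g (base n))"
    have nb: "node l \<noteq> f" "node l \<noteq> g" "node (negate l) \<noteq> f" "node (negate l) \<noteq> g"
      using l(1) out'(2,3) node_in_base[of l n] node_in_base[of "negate l" n]
      unfolding lit_var_negate by metis+
    \<comment> \<open>The predicate for the old chain predates \<open>f\<close> and
      \<open>g\<close>, so it is applied to sets without them; \<open>chain\<close> looks only at
      base nodes, \<open>\<sigma>\<close> and \<open>t\<close>.\<close>
    have ch: "chain \<Psi> n ys \<sigma> t (Y - {g} - {f}) \<longleftrightarrow> chain \<Psi> n ys \<sigma> t Y" for Y
    proof -
      have e: "(Y - {g} - {f}) \<inter> base n = Y \<inter> base n" using out'(2,3) by auto
      have nd: "node k \<in> Y - {g} - {f} \<longleftrightarrow> node k \<in> Y" if "lit_var k < n" for k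
        using that e by (metis Int_iff node_in_base)
      have "\<sigma> \<in> Y - {g} - {f} \<longleftrightarrow> \<sigma> \<in> Y" "t \<in> Y - {g} - {f} \<longleftrightarrow> t \<in> Y" using out' by auto
      then show ?thesis
        using sorted_pair_cong[OF e ys] nd ys unfolding chain_def e by auto
    qed
    show "chain \<Psi> n (ys @ [l]) f g X \<longleftrightarrow>
      (\<exists>X'\<subseteq>insert g (insert f R). X' \<inter> insert f (insert g (base n)) = X \<and> ?\<Phi>10 X')"
      using chain_extend[OF out' ys l(1) t0 X, of \<Psi>, folded R_def] out' nb fR(2)
      unfolding with_edge_def ch a_def b_def by (simp add: conj_assoc)
  qed
  moreover have "insert f (insert g (base n)) = insert f (base n \<union> ({g} - {0}))" using gR(2) by auto
  ultimately have "building inp n (insert f (base n \<union> ({g} - {0}))) (chain \<Psi> n (ys @ [l]) f g) s10"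
    by argo
  then have "chaining inp n \<Psi> (ys @ [l]) ?s"
    using out' regs(4) by (simp add: chaining_def Let_def)
  moreover have "reg s10 rFresh \<le> reg s rFresh + 41"
    by (simp add: 10(3) 9(3) 8(4) g_def 6(3) 5(3) 4(4) f_def 3(3) 2(3) r1)
  moreover have "reg ?s rM = reg s rM"
    using frame_reg[OF exec_frame[OF ex], of rM]
    by (simp add: disj_step_def read_lit_def edge_def new_def)
  ultimately show ?thesis using ex regs by (intro exI[of _ ?s]) simp
qed

section \<open>Links along a xor part\<close>

lemma push_exec:
  assumes "building inp n R \<Phi> s" "reg s v = 0 \<or> reg s v \<in> R" "v \<notin> {rTmp, rTA}"
  obtains t s' where "exec (push aSeenA aQueueA rTA v) s t s'" "t \<le> 7"
    "building inp n R (\<lambda>X. \<Phi> X \<and> (reg s v = 0 \<or> reg s v \<in> X)) s'"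
    "\<forall>r. r \<noteq> rTA \<longrightarrow> r \<noteq> rTmp \<longrightarrow> reg s' r = reg s r"
proof -
  let ?P = "\<lambda>s'. building inp n R (\<lambda>X. \<Phi> X \<and> (reg s v = 0 \<or> reg s v \<in> X)) s' \<and>
    (\<forall>r. r \<noteq> rTA \<longrightarrow> r \<noteq> rTmp \<longrightarrow> reg s' r = reg s r)"
  have "wp (push aSeenA aQueueA rTA v) 0 s (\<lambda>T' s'. T' \<le> 7 \<and> ?P s')"
    by (rule wp_push_building[OF assms]) simp_all
  then show ?thesis unfolding wp_def using that by auto
qed

definition linked :: "(nat set \<Rightarrow> bool) \<Rightarrow> bool \<Rightarrow> lit list \<Rightarrow> nat set \<Rightarrow> bool" where
  "linked \<Psi> b ys X \<longleftrightarrow> \<Psi> X \<and>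
     (\<forall>l\<in>set ys. node l \<in> X \<and> node (negate l) \<in> X \<and> (b \<longrightarrow> link (lit_var l) \<in> X)) \<and>
     (\<forall>l\<in>set ys. \<forall>k\<in>set ys. link (lit_var l) \<in> X \<longrightarrow> link (lit_var k) \<in> X)"

definition last_link :: "lit list \<Rightarrow> nat" where
  "last_link ys = (if ys = [] then 0 else link (lit_var (last ys)))"

text \<open>All earlier links are already equivalent, so connecting the new one to the last of them
  in both directions suffices. Since 0 is not in X, the null value of \<open>last_link\<close> makes
  the first literal fit the same formula.\<close>

lemma linked_extend:
  assumes "0 \<notin> X"
  shows "linked \<Psi> b (ys @ [l]) X \<longleftrightarrow> linked \<Psi> b ys X \<and> node l \<in> X \<and> node (negate l) \<in> X \<and>
    (b \<longrightarrow> link (lit_var l) \<in> X) \<and>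
    (last_link ys \<in> X \<longrightarrow> link (lit_var l) \<in> X) \<and>
    (link (lit_var l) \<in> X \<longrightarrow> last_link ys = 0 \<or> last_link ys \<in> X)"
proof (cases "ys = []")
  case True
  then show ?thesis using assms by (auto simp: linked_def last_link_def)
next
  case False
  then have "last ys \<in> set ys" by simp
  then show ?thesis using False unfolding linked_def last_link_def by auto
qed

text \<open>For the first literal \<open>rPrev\<close> is the null pointer; both edges are inserted
  nevertheless and constrain no closed set.\<close>

definition xor_step :: prog where
  "xor_step = read_lit ;; Read rW aLink rL ;; push aSeenA aQueueA rTA rL ;;
     push aSeenA aQueueA rTA rNl ;; If (Less rTwo rLen) (push aSeenA aQueueA rTA rW) skip ;;
     edge rPrev rW ;; edge rW rPrev ;; Copy rPrev rW ;; Dec rK"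

lemma xor_step_exec:
  assumes b: "building inp n (base n) (linked \<Psi> (2 < reg s rLen) ys) s"
    and l: "lit_var l < n" "inp (reg s rPos) = encode_lit l"
    and ys: "\<forall>l\<in>set ys. lit_var l < n" and prev: "reg s rPrev = last_link ys"
  shows "\<exists>t s'. exec xor_step s t s' \<and> t \<le> 41 \<and>
    building inp n (base n) (linked \<Psi> (2 < reg s rLen) (ys @ [l])) s' \<and> reg s' rPrev = last_link (ys @ [l]) \<and>
    reg s' rFresh \<le> reg s rFresh + t \<and> reg s' rPos = Suc (reg s rPos) \<and> reg s' rK = reg s rK - 1 \<and>
    reg s' rM = reg s rM \<and> reg s' rLen = reg s rLen"
proof -
  define \<Phi> where "\<Phi> = linked \<Psi> (2 < reg s rLen) ys"
  define w where "w = link (lit_var l)"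
  define p where "p = last_link ys"
  have mem: "node l \<in> base n" "node (negate l) \<in> base n" "w \<in> base n" "p = 0 \<or> p \<in> base n" "w \<noteq> 0"
    using l(1) ys by (auto simp: w_def p_def last_link_def)
  obtain s1 where 1: "exec read_lit s 4 s1" "building inp n (base n) \<Phi> s1"
      "reg s1 rL = node l" "reg s1 rNl = node (negate l)" "reg s1 rPos = Suc (reg s rPos)"
      "\<forall>q. q \<notin> {rC, rPos, rL, rNl} \<longrightarrow> reg s1 q = reg s q"
    by (rule read_lit_exec[OF b[folded \<Phi>_def] l])
  have rw: "arr s1 aLink (node l) = w"
    using 1(2) l(1) unfolding building_def tables_def w_def by blast
  define s2 where "s2 = set_reg rW w s1"
  have b2: "building inp n (base n) \<Phi> s2" using 1(2) by (simp add: s2_def)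
  obtain t3 s3 where 3: "exec (push aSeenA aQueueA rTA rL) s2 t3 s3" "t3 \<le> 7"
    "building inp n (base n) (\<lambda>X. \<Phi> X \<and> (node l = 0 \<or> node l \<in> X)) s3"
    "\<forall>r. r \<noteq> rTA \<longrightarrow> r \<noteq> rTmp \<longrightarrow> reg s3 r = reg s2 r"
    using push_exec[OF b2, of rL] mem 1(3) by (auto simp: s2_def)
  obtain t4 s4 where 4: "exec (push aSeenA aQueueA rTA rNl) s3 t4 s4" "t4 \<le> 7"
    "building inp n (base n) (\<lambda>X. (\<Phi> X \<and> (node l = 0 \<or> node l \<in> X)) \<and> (node (negate l) = 0 \<or> node (negate l) \<in> X)) s4"
    "\<forall>r. r \<noteq> rTA \<longrightarrow> r \<noteq> rTmp \<longrightarrow> reg s4 r = reg s3 r"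
    using push_exec[OF 3(3), of rNl] mem 1(4) 3(4) by (auto simp: s2_def)
  define \<Phi>' where "\<Phi>' X \<longleftrightarrow> \<Phi> X \<and> node l \<in> X \<and> node (negate l) \<in> X" for X
  have b4: "building inp n (base n) \<Phi>' s4"
    by (rule building_cong[OF 4(3)]) (auto simp: \<Phi>'_def)
  have r4: "reg s4 rW = w" "reg s4 rLen = reg s rLen" "reg s4 rPrev = p" "reg s4 rPos = Suc (reg s rPos)"
      "reg s4 rFresh = reg s rFresh" "reg s4 rTwo = 2" "reg s4 rK = reg s rK" "reg s4 rM = reg s rM"
    using 1(5,6) b2 by (simp_all add: 3(4) 4(4) s2_def prev p_def building_def)
  let ?br = "if 2 < reg s rLen then push aSeenA aQueueA rTA rW else skip"
  let ?\<Phi>5 = "\<lambda>X. \<Phi>' X \<and> (2 < reg s rLen \<longrightarrow> w \<in> X)"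
  obtain t5 s5 where 5: "exec ?br s4 t5 s5" "t5 \<le> 7" "building inp n (base n) ?\<Phi>5 s5"
    "\<forall>r. r \<noteq> rTA \<longrightarrow> r \<noteq> rTmp \<longrightarrow> reg s5 r = reg s4 r"
  proof (cases "2 < reg s rLen")
    case True
    then show ?thesis
      using push_exec[OF b4, of rW] mem that by (auto simp: r4)
  next
    case False
    have "exec skip s4 1 s4"
      using wp_skip[of 0 s4 "\<lambda>T' s'. T' = 1 \<and> s' = s4"] unfolding wp_def by auto
    then show ?thesis using False b4 that[of 1 s4] by simp
  qed
  obtain s6 where 6: "exec (edge rPrev rW) s5 5 s6"
    "building inp n (base n) (with_edge ?\<Phi>5 p w) s6"
    "reg s6 rFresh = Suc (reg s5 rFresh)" "\<forall>r. r \<noteq> rFresh \<longrightarrow> r \<noteq> rTmp \<longrightarrow> reg s6 r = reg s5 r"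
    using edge_exec[OF 5(3), of rPrev rW] mem by (auto simp: 5(4) r4)
  obtain s7 where 7: "exec (edge rW rPrev) s6 5 s7"
    "building inp n (base n) (with_edge (with_edge ?\<Phi>5 p w) w p) s7"
    "reg s7 rFresh = Suc (reg s6 rFresh)" "\<forall>r. r \<noteq> rFresh \<longrightarrow> r \<noteq> rTmp \<longrightarrow> reg s7 r = reg s6 r"
    using edge_exec[OF 6(2), of rW rPrev] mem by (auto simp: 5(4) 6(4) r4)
  let ?s = "set_reg rK (reg s rK - 1) (set_reg rPrev w s7)"
  have r7: "reg s7 rW = w" "reg s7 rK = reg s rK" "reg s7 rPos = Suc (reg s rPos)" "reg s7 rM = reg s rM"
      "reg s7 rLen = reg s rLen"
    by (simp_all add: 7(4) 6(4) 5(4) r4)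
  have ex: "exec xor_step s (4 + 1 + t3 + t4 + (1 + t5) + 5 + 5 + 1 + 1) ?s"
  proof -
    have "wp xor_step 0 s (\<lambda>T' s'. T' = 4 + 1 + t3 + t4 + (1 + t5) + 5 + 5 + 1 + 1 \<and> s' = ?s)"
      using 5(1) unfolding xor_step_def
      by (cases "2 < reg s rLen")
        (simp_all del: wp_skip add: wp_exec[OF 1(1)] rw 1(3) s2_def[symmetric] wp_exec[OF 3(1)] wp_exec[OF 4(1)]
          wp_exec[of _ s4 t5 s5] r4 wp_exec[OF 6(1)] wp_exec[OF 7(1)] r7)
    then show ?thesis unfolding wp_def by auto
  qed
  have "building inp n (base n) (linked \<Psi> (2 < reg s rLen) (ys @ [l])) s7"
  proof (rule building_cong[OF 7(2)])
    fix X assume "X \<subseteq> base n"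
    then have "0 \<notin> X" by auto
    from linked_extend[OF this]
    show "with_edge (with_edge ?\<Phi>5 p w) w p X \<longleftrightarrow> linked \<Psi> (2 < reg s rLen) (ys @ [l]) X"
      unfolding with_edge_def \<Phi>'_def \<Phi>_def w_def p_def by simp
  qed
  then have "building inp n (base n) (linked \<Psi> (2 < reg s rLen) (ys @ [l])) ?s" by simp
  moreover have "reg ?s rPrev = last_link (ys @ [l])" by (simp add: last_link_def w_def)
  moreover have "reg ?s rFresh \<le> reg s rFresh + 2" by (simp add: 7(3) 6(3) 5(4) r4)
  ultimately show ?thesis
    using ex 3(2) 4(2) 5(2) r7
    by (intro exI[of _ "4 + 1 + t3 + t4 + (1 + t5) + 5 + 5 + 1 + 1"] exI[of _ ?s]) simp
qed

section \<open>Building the graph\<close>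

text \<open>The share of a single clause in \<open>forced\<close> and \<open>link_closed\<close>,
  phrased for node sets; \<open>obeys_iff\<close> makes the connection.\<close>

definition obeys :: "clause \<Rightarrow> nat set \<Rightarrow> bool" where
  "obeys c X \<longleftrightarrow> sorted_wrt (pair_closed X) (disj_part c) \<and>
     (xor_part c \<noteq> [] \<longrightarrow> (\<forall>l\<in>set (disj_part c). node l \<in> X)) \<and>
     (\<forall>l\<in>set (xor_part c). node l \<in> X \<and> node (negate l) \<in> X \<and>
        (2 < length (xor_part c) \<longrightarrow> link (lit_var l) \<in> X)) \<and>
     (\<forall>l\<in>set (xor_part c). \<forall>k\<in>set (xor_part c). link (lit_var l) \<in> X \<longrightarrow> link (lit_var k) \<in> X)"

definition clause_at :: "(nat \<Rightarrow> nat) \<Rightarrow> nat \<Rightarrow> clause \<Rightarrow> bool" where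
  "clause_at inp p c \<longleftrightarrow>
     inp p = length (disj_part c) \<and>
     (\<forall>i<length (disj_part c). inp (Suc p + i) = encode_lit (disj_part c ! i)) \<and>
     inp (Suc p + length (disj_part c)) = length (xor_part c) \<and>
     (\<forall>i<length (xor_part c). inp (Suc (Suc p + length (disj_part c)) + i) = encode_lit (xor_part c ! i))"

definition code_length :: "formula \<Rightarrow> nat" where
  "code_length cs = length (concat (map encode_clause cs))"

lemma code_length_append [simp]:
  "code_length [] = 0"
  "code_length (cs @ [c]) = code_length cs + 2 + length (disj_part c) + length (xor_part c)"
  by (simp_all add: code_length_def encode_clause_def)

definition formula_at :: "(nat \<Rightarrow> nat) \<Rightarrow> formula \<Rightarrow> bool" where
  "formula_at inp \<phi> \<longleftrightarrow> (\<forall>ds c cs. \<phi> = ds @ c # cs \<longrightarrow> clause_at inp (2 + code_length ds) c)"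

definition weight :: "formula \<Rightarrow> nat" where
  "weight \<phi> = (\<Sum>c\<leftarrow>\<phi>. 1 + length (disj_part c) + length (xor_part c))"

lemma weight_append [simp]:
  "weight [] = 0"
  "weight (cs @ [c]) = weight cs + 1 + length (disj_part c) + length (xor_part c)"
  by (simp_all add: weight_def)

lemma wp_disj_loop:
  assumes c: "chaining inp n \<Psi> [] s" and k: "reg s rK = length ds"
    and pos: "\<forall>i<length ds. inp (reg s rPos + i) = encode_lit (ds ! i)"
    and ds: "\<forall>l\<in>set ds. lit_var l < n" and T: "reg s rFresh \<le> T"
    and Q: "\<And>T' s'. T' \<le> Suc T + 42 * length ds \<Longrightarrow> chaining inp n \<Psi> ds s' \<Longrightarrow> reg s' rFresh \<le> T' \<Longrightarrow>
      reg s' rPos = reg s rPos + length ds \<Longrightarrow> reg s' rM = reg s rM \<Longrightarrow> Q T' s'"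
  shows "wp (While (Less rZero rK) disj_step) T s Q"
proof (rule wp_for[where xs = ds and P = "\<lambda>ys T' s'. T' \<le> T + 42 * length ys \<and> chaining inp n \<Psi> ys s' \<and>
    reg s' rFresh \<le> T' \<and> reg s' rPos = reg s rPos + length ys \<and> reg s' rM = reg s rM"])
  show "T \<le> T + 42 * length [] \<and> chaining inp n \<Psi> [] s \<and>
    reg s rFresh \<le> T \<and> reg s rPos = reg s rPos + length [] \<and> reg s rM = reg s rM"
    using c T by simp
  show "reg s rZero = 0" using c building_bounds by (auto simp: chaining_def Let_def)
next
  fix ys l zs T' s'
  assume eq: "ds = ys @ l # zs"
    and P: "T' \<le> T + 42 * length ys \<and> chaining inp n \<Psi> ys s' \<and>
      reg s' rFresh \<le> T' \<and> reg s' rPos = reg s rPos + length ys \<and> reg s' rM = reg s rM"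
    and k: "reg s' rK = Suc (length zs)"
  have "lit_var l < n" "\<forall>l\<in>set ys. lit_var l < n" using ds eq by auto
  moreover have "inp (reg s' rPos) = encode_lit l"
    using pos[rule_format, of "length ys"] P by (simp add: eq)
  ultimately obtain s1 where s1: "exec disj_step s' 41 s1" "chaining inp n \<Psi> (ys @ [l]) s1"
    "reg s1 rFresh \<le> reg s' rFresh + 41" "reg s1 rPos = Suc (reg s' rPos)" "reg s1 rK = reg s' rK - 1"
    "reg s1 rM = reg s' rM"
    using disj_step_exec[of inp n \<Psi> ys s' l] P by auto
  have "reg s1 rZero = 0" using s1(2) building_bounds by (auto simp: chaining_def Let_def)
  then show "wp disj_step (Suc T') s' (\<lambda>T' s'. (T' \<le> T + 42 * length (ys @ [l]) \<and> chaining inp n \<Psi> (ys @ [l]) s' \<and>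
      reg s' rFresh \<le> T' \<and> reg s' rPos = reg s rPos + length (ys @ [l]) \<and> reg s' rM = reg s rM) \<and>
      reg s' rZero = 0 \<and> reg s' rK = length zs)"
    using s1(2-) P k by (simp add: wp_exec[OF s1(1)])
qed (use k Q in auto)

lemma wp_xor_loop:
  assumes b: "building inp n (base n) \<Psi> s" and k: "reg s rK = length xs" "reg s rLen = length xs"
    and pos: "\<forall>i<length xs. inp (reg s rPos + i) = encode_lit (xs ! i)"
    and xs: "\<forall>l\<in>set xs. lit_var l < n" and T: "reg s rFresh \<le> T" and prev: "reg s rPrev = 0"
    and Q: "\<And>T' s'. T' \<le> Suc T + 42 * length xs \<Longrightarrow>
      building inp n (base n) (linked \<Psi> (2 < length xs) xs) s' \<Longrightarrow> reg s' rFresh \<le> T' \<Longrightarrow>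
      reg s' rPos = reg s rPos + length xs \<Longrightarrow> reg s' rM = reg s rM \<Longrightarrow> Q T' s'"
  shows "wp (While (Less rZero rK) xor_step) T s Q"
proof (rule wp_for[where xs = xs and P = "\<lambda>ys T' s'. T' \<le> T + 42 * length ys \<and>
    building inp n (base n) (linked \<Psi> (2 < length xs) ys) s' \<and>
    reg s' rFresh \<le> T' \<and> reg s' rPos = reg s rPos + length ys \<and> reg s' rM = reg s rM \<and>
    reg s' rLen = length xs \<and> reg s' rPrev = last_link ys"])
  have "building inp n (base n) (linked \<Psi> (2 < length xs) []) s"
    by (rule building_cong[OF b]) (simp add: linked_def)
  then show "T \<le> T + 42 * length [] \<and> building inp n (base n) (linked \<Psi> (2 < length xs) []) s \<and>
    reg s rFresh \<le> T \<and> reg s rPos = reg s rPos + length [] \<and> reg s rM = reg s rM \<and>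
    reg s rLen = length xs \<and> reg s rPrev = last_link []"
    using T prev k by (simp add: last_link_def)
  show "reg s rZero = 0" using building_bounds[OF b] by simp
next
  fix ys l zs T' s'
  assume eq: "xs = ys @ l # zs"
    and P: "T' \<le> T + 42 * length ys \<and> building inp n (base n) (linked \<Psi> (2 < length xs) ys) s' \<and>
      reg s' rFresh \<le> T' \<and> reg s' rPos = reg s rPos + length ys \<and> reg s' rM = reg s rM \<and>
      reg s' rLen = length xs \<and> reg s' rPrev = last_link ys"
    and k: "reg s' rK = Suc (length zs)"
  have "lit_var l < n" "\<forall>l\<in>set ys. lit_var l < n" using xs eq by auto
  moreover have "inp (reg s' rPos) = encode_lit l"
    using pos[rule_format, of "length ys"] P by (simp add: eq)
  ultimately obtain t s1 where s1: "exec xor_step s' t s1" "t \<le> 41"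
    "building inp n (base n) (linked \<Psi> (2 < length xs) (ys @ [l])) s1" "reg s1 rPrev = last_link (ys @ [l])"
    "reg s1 rFresh \<le> reg s' rFresh + t" "reg s1 rPos = Suc (reg s' rPos)" "reg s1 rK = reg s' rK - 1"
    "reg s1 rM = reg s' rM" "reg s1 rLen = reg s' rLen"
    using xor_step_exec[of inp n \<Psi> s' ys l] P by auto
  have "reg s1 rZero = 0" using building_bounds[OF s1(3)] by simp
  then show "wp xor_step (Suc T') s' (\<lambda>T' s'. (T' \<le> T + 42 * length (ys @ [l]) \<and>
      building inp n (base n) (linked \<Psi> (2 < length xs) (ys @ [l])) s' \<and>
      reg s' rFresh \<le> T' \<and> reg s' rPos = reg s rPos + length (ys @ [l]) \<and> reg s' rM = reg s rM \<and>
      reg s' rLen = length xs \<and> reg s' rPrev = last_link (ys @ [l])) \<and>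
      reg s' rZero = 0 \<and> reg s' rK = length zs)"
    using s1(2-) P k by (simp add: wp_exec[OF s1(1)])
qed (use k Q in auto)

definition clause_step :: prog where
  "clause_step =
     Read rK aIn rPos ;; Inc rPos ;; new rSuf ;; Copy rPre rZero ;;
     While (Less rZero rK) disj_step ;;
     Read rK aIn rPos ;; Inc rPos ;; Copy rLen rK ;; Copy rPrev rZero ;;
     If (Less rZero rK) (push aSeenA aQueueA rTA rPre) skip ;;
     While (Less rZero rK) xor_step ;;
     Dec rM"

text \<open>Both ends of the chain become hidden once \<open>t\<close> has been required, if it has
  to be; between clauses only the nodes of \<open>base n\<close> are visible, so the invariant does
  not grow.\<close>

lemma wp_clause_step:
  assumes b: "building inp n (base n) \<Psi> s" and c: "clause_at inp (reg s rPos) c" "clause_over {..<n} c"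
    and T: "reg s rFresh \<le> T"
    and Q: "\<And>T' s'. T' \<le> T + 42 * (1 + length (disj_part c) + length (xor_part c)) \<Longrightarrow>
      building inp n (base n) (\<lambda>X. \<Psi> X \<and> obeys c X) s' \<Longrightarrow> reg s' rFresh \<le> T' \<Longrightarrow>
      reg s' rPos = reg s rPos + 2 + length (disj_part c) + length (xor_part c) \<Longrightarrow>
      reg s' rM = reg s rM - 1 \<Longrightarrow> Q T' s'"
  shows "wp clause_step T s Q"
proof -
  let ?ds = "disj_part c" and ?xs = "xor_part c" and ?p = "reg s rPos"
  have ds: "\<forall>l\<in>set ?ds. lit_var l < n" and xs: "\<forall>l\<in>set ?xs. lit_var l < n"
    using c(2) by (auto simp: clause_over_def clause_vars_def vars_def)
  have at: "inp ?p = length ?ds" "\<forall>i<length ?ds. inp (Suc ?p + i) = encode_lit (?ds ! i)"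
      "inp (Suc ?p + length ?ds) = length ?xs"
      "\<forall>i<length ?xs. inp (Suc (Suc ?p + length ?ds) + i) = encode_lit (?xs ! i)"
    using c(1) by (auto simp: clause_at_def)
  have inp: "arr s aIn = inp" using b by (simp add: building_def)
  define s1 where "s1 = set_reg rPos (Suc ?p) (set_reg rK (length ?ds) s)"
  have b1: "building inp n (base n) \<Psi> s1" using b by (simp add: s1_def)
  define \<sigma> where "\<sigma> = reg s rFresh"
  obtain s2 where 2: "exec (new rSuf) s1 2 s2" "building inp n (insert \<sigma> (base n)) (\<lambda>X. \<Psi> (X - {\<sigma>})) s2"
    "reg s2 rSuf = \<sigma>" "reg s2 rFresh = Suc \<sigma>" "\<forall>q. q \<noteq> rSuf \<longrightarrow> q \<noteq> rFresh \<longrightarrow> reg s2 q = reg s1 q"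
    using new_exec[OF b1, of rSuf] by (auto simp: s1_def \<sigma>_def)
  have \<sigma>: "\<sigma> \<notin> base n" "\<sigma> \<noteq> 0" using building_bounds[OF b] by (auto simp: \<sigma>_def)
  let ?s = "set_reg rPre 0 s2"
  have z2: "reg s2 rZero = 0" using building_bounds[OF 2(2)] by simp
  have "building inp n (insert \<sigma> (base n)) (chain \<Psi> n [] \<sigma> 0) s2"
  proof (rule building_cong[OF 2(2)])
    fix X assume "X \<subseteq> insert \<sigma> (base n)"
    then have "X - {\<sigma>} = X \<inter> base n" using \<sigma> by auto
    then show "\<Psi> (X - {\<sigma>}) \<longleftrightarrow> chain \<Psi> n [] \<sigma> 0 X" by (simp add: chain_def)
  qed
  then have ch: "chaining inp n \<Psi> [] ?s"
    using \<sigma> 2(3) by (simp add: chaining_def Let_def)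
  have "wp (While (Less rZero rK) disj_step) (T + 5) ?s
    (\<lambda>T' s'. wp (Read rK aIn rPos ;; Inc rPos ;; Copy rLen rK ;; Copy rPrev rZero ;;
     If (Less rZero rK) (push aSeenA aQueueA rTA rPre) skip ;;
     While (Less rZero rK) xor_step ;; Dec rM) T' s' Q)"
  proof (rule wp_disj_loop[OF ch, where ds = ?ds])
    show "reg ?s rK = length ?ds" by (simp add: 2(5) s1_def)
    show "\<forall>i<length ?ds. inp (reg ?s rPos + i) = encode_lit (?ds ! i)" using at(2) by (simp add: 2(5) s1_def)
    show "\<forall>l\<in>set ?ds. lit_var l < n" by (rule ds)
    show "reg ?s rFresh \<le> T + 5" using T by (simp add: 2(4) \<sigma>_def)
    fix T3 s3
    assume T3: "T3 \<le> Suc (T + 5) + 42 * length ?ds" and ch3: "chaining inp n \<Psi> ?ds s3"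
      and f3: "reg s3 rFresh \<le> T3" and p3: "reg s3 rPos = reg ?s rPos + length ?ds" and m3: "reg s3 rM = reg ?s rM"
    have p3': "reg s3 rPos = Suc ?p + length ?ds" "reg s3 rM = reg s rM"
      using p3 m3 by (simp_all add: 2(5) s1_def)
    define \<sigma>' where "\<sigma>' = reg s3 rSuf"
    define t where "t = reg s3 rPre"
    let ?R = "insert \<sigma>' (base n \<union> ({t} - {0}))"
    have b3: "building inp n ?R (chain \<Psi> n ?ds \<sigma>' t) s3"
      and out: "\<sigma>' \<notin> base n" "t \<notin> base n" "\<sigma>' \<noteq> t" and t0: "t = 0 \<Longrightarrow> ?ds = []"
      using ch3 unfolding chaining_def Let_def \<sigma>'_def t_def by blast+
    let ?k = "length ?xs"
    let ?s3 = "set_reg rPrev 0 (set_reg rLen ?k (set_reg rPos (Suc (reg s3 rPos)) (set_reg rK ?k s3)))"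
    have in3: "arr s3 aIn (Suc (?p + length ?ds)) = ?k" "reg s3 rZero = 0"
      using at(3) b3 by (simp_all add: building_def)
    let ?\<Psi> = "\<lambda>X. \<Psi> X \<and> sorted_wrt (pair_closed X) ?ds \<and> (?xs \<noteq> [] \<longrightarrow> (\<forall>l\<in>set ?ds. node l \<in> X))"
    let ?br = "if 0 < ?k then push aSeenA aQueueA rTA rPre else skip"
    have b3': "building inp n ?R (chain \<Psi> n ?ds \<sigma>' t) ?s3" using b3 by simp
    obtain u s4 where 4: "exec ?br ?s3 u s4" "u \<le> 7"
      "building inp n ?R (\<lambda>X. chain \<Psi> n ?ds \<sigma>' t X \<and> (?xs \<noteq> [] \<longrightarrow> t = 0 \<or> t \<in> X)) s4"
      "\<forall>r. r \<noteq> rTA \<longrightarrow> r \<noteq> rTmp \<longrightarrow> reg s4 r = reg ?s3 r"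
    proof (cases "?xs = []")
      case False
      have tR: "reg s3 rPre = t" by (simp add: t_def)
      show ?thesis
        using push_exec[OF b3', of rPre] False that by (auto simp: tR)
    next
      case True
      have "exec skip ?s3 1 ?s3"
        using wp_skip[of 0 ?s3 "\<lambda>T' s'. T' = 1 \<and> s' = ?s3"] unfolding wp_def by auto
      then show ?thesis using True b3 that[of 1 ?s3] by simp
    qed
    have b4: "building inp n (base n) ?\<Psi> s4"
    proof (rule building_forget[OF 4(3)])
      fix X assume X: "X \<subseteq> base n"
      show "?\<Psi> X \<longleftrightarrow> (\<exists>X'\<subseteq>?R. X' \<inter> base n = X \<and> chain \<Psi> n ?ds \<sigma>' t X' \<and> (?xs \<noteq> [] \<longrightarrow> t = 0 \<or> t \<in> X'))"
        by (rule chain_finish[OF out ds t0 X])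
    qed auto
    have r4: "reg s4 rK = ?k" "reg s4 rLen = ?k" "reg s4 rPrev = 0" "reg s4 rPos = Suc (Suc ?p + length ?ds)"
      "reg s4 rFresh = reg s3 rFresh" "reg s4 rM = reg s rM"
      by (simp_all add: 4(4) p3')
    have "wp (While (Less rZero rK) xor_step) (Suc (T3 + 4 + u)) s4 (\<lambda>T' s'. Q (Suc T') (set_reg rM (reg s' rM - 1) s'))"
    proof (rule wp_xor_loop[OF b4, where xs = ?xs])
      show "reg s4 rK = length ?xs" "reg s4 rLen = length ?xs" "reg s4 rPrev = 0" by (fact r4)+
      show "\<forall>i<length ?xs. inp (reg s4 rPos + i) = encode_lit (?xs ! i)" using at(4) by (simp add: r4)
      show "\<forall>l\<in>set ?xs. lit_var l < n" by (rule xs)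
      show "reg s4 rFresh \<le> Suc (T3 + 4 + u)" using f3 by (simp add: r4)
      fix T5 s5
      assume T5: "T5 \<le> Suc (Suc (T3 + 4 + u)) + 42 * length ?xs"
        and b5: "building inp n (base n) (linked ?\<Psi> (2 < length ?xs) ?xs) s5"
        and f5: "reg s5 rFresh \<le> T5" and p5: "reg s5 rPos = reg s4 rPos + length ?xs" and m5: "reg s5 rM = reg s4 rM"
      show "Q (Suc T5) (set_reg rM (reg s5 rM - 1) s5)"
      proof (rule Q)
        show "Suc T5 \<le> T + 42 * (1 + length ?ds + length ?xs)" using T5 4(2) T3 by simp
        have "building inp n (base n) (\<lambda>X. \<Psi> X \<and> obeys c X) s5"
          by (rule building_cong[OF b5]) (auto simp: linked_def obeys_def)
        then show "building inp n (base n) (\<lambda>X. \<Psi> X \<and> obeys c X) (set_reg rM (reg s5 rM - 1) s5)" by simp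
      qed (use f5 p5 m5 in \<open>simp_all add: r4\<close>)
    qed
    then show "wp (Read rK aIn rPos ;; Inc rPos ;; Copy rLen rK ;; Copy rPrev rZero ;;
       If (Less rZero rK) (push aSeenA aQueueA rTA rPre) skip ;;
       While (Less rZero rK) xor_step ;; Dec rM) T3 s3 Q"
      using 4(1) by (cases "?xs = []")
        (simp_all del: wp_skip add: p3' in3 wp_exec[of _ _ u s4] plus_numeral_Suc)
  qed
  then show ?thesis
    unfolding clause_step_def
    by (simp add: inp at(1) s1_def[symmetric] wp_exec[OF 2(1)] z2 plus_numeral_Suc)
qed

lemma wp_build:
  assumes b: "building inp n (base n) (\<lambda>_. True) s" and \<phi>: "formula_over {..<n} \<phi>" "formula_at inp \<phi>"
    and m: "reg s rM = length \<phi>" "reg s rPos = 2" and T: "reg s rFresh \<le> T"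
    and Q: "\<And>T' s'. T' \<le> Suc T + 43 * weight \<phi> \<Longrightarrow>
      building inp n (base n) (\<lambda>X. \<forall>c\<in>set \<phi>. obeys c X) s' \<Longrightarrow> reg s' rFresh \<le> T' \<Longrightarrow> Q T' s'"
  shows "wp (While (Less rZero rM) clause_step) T s Q"
proof (rule wp_for[where xs = \<phi> and P = "\<lambda>ys T' s'. T' \<le> T + 43 * weight ys \<and>
    building inp n (base n) (\<lambda>X. \<forall>c\<in>set ys. obeys c X) s' \<and> reg s' rFresh \<le> T' \<and>
    reg s' rPos = 2 + code_length ys"])
  show "T \<le> T + 43 * weight [] \<and> building inp n (base n) (\<lambda>X. \<forall>c\<in>set []. obeys c X) s \<and>
    reg s rFresh \<le> T \<and> reg s rPos = 2 + code_length []"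
    using b T m by simp
  show "reg s rZero = 0" using building_bounds[OF b] by simp
next
  fix ys c zs T' s'
  assume eq: "\<phi> = ys @ c # zs"
    and P: "T' \<le> T + 43 * weight ys \<and> building inp n (base n) (\<lambda>X. \<forall>c\<in>set ys. obeys c X) s' \<and>
      reg s' rFresh \<le> T' \<and> reg s' rPos = 2 + code_length ys"
    and k: "reg s' rM = Suc (length zs)"
  have c: "clause_at inp (reg s' rPos) c" "clause_over {..<n} c"
    using \<phi> P unfolding formula_at_def formula_over_def by (auto simp: eq)
  show "wp clause_step (Suc T') s' (\<lambda>T' s'. (T' \<le> T + 43 * weight (ys @ [c]) \<and>
      building inp n (base n) (\<lambda>X. \<forall>c\<in>set (ys @ [c]). obeys c X) s' \<and> reg s' rFresh \<le> T' \<and>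
      reg s' rPos = 2 + code_length (ys @ [c])) \<and> reg s' rZero = 0 \<and> reg s' rM = length zs)"
  proof (rule wp_clause_step[OF _ c])
    show "building inp n (base n) (\<lambda>X. \<forall>c\<in>set ys. obeys c X) s'" "reg s' rFresh \<le> Suc T'"
      using P by auto
    fix T1 s1
    assume *: "T1 \<le> Suc T' + 42 * (1 + length (disj_part c) + length (xor_part c))"
      "building inp n (base n) (\<lambda>X. (\<forall>c\<in>set ys. obeys c X) \<and> obeys c X) s1" "reg s1 rFresh \<le> T1"
      "reg s1 rPos = reg s' rPos + 2 + length (disj_part c) + length (xor_part c)"
      "reg s1 rM = reg s' rM - 1"
    have "building inp n (base n) (\<lambda>X. \<forall>c\<in>set (ys @ [c]). obeys c X) s1"
      by (rule building_cong[OF *(2)]) auto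
    moreover have "reg s1 rZero = 0" using building_bounds[OF *(2)] by simp
    ultimately show "(T1 \<le> T + 43 * weight (ys @ [c]) \<and>
      building inp n (base n) (\<lambda>X. \<forall>c\<in>set (ys @ [c]). obeys c X) s1 \<and> reg s1 rFresh \<le> T1 \<and>
      reg s1 rPos = 2 + code_length (ys @ [c])) \<and> reg s1 rZero = 0 \<and> reg s1 rM = length zs"
      using * P k by simp
  qed
qed (use m Q in auto)

section \<open>Breadth-first search\<close>

definition marked :: "state \<Rightarrow> nat set" where
  "marked s = {v. arr s aMark v \<noteq> 0}"

definition visited :: "nat \<Rightarrow> nat \<Rightarrow> state \<Rightarrow> nat set" where
  "visited q t s = arr s q ` {..<reg s t}"

lemma visited_set_reg [simp]: "r \<noteq> t \<Longrightarrow> visited q t (set_reg r v s) = visited q t s"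
  by (simp add: visited_def)

lemma marked_set_reg [simp]: "marked (set_reg r v s) = marked s"
  by (simp add: marked_def)

text \<open>The two competing searches share their code; a channel collects the memory names in
  which they differ.\<close>

definition channel :: "nat \<Rightarrow> nat \<Rightarrow> nat \<Rightarrow> nat \<Rightarrow> bool" where
  "channel mk q h t \<longleftrightarrow> mk \<noteq> q \<and> 7 < mk \<and> 7 < q \<and> h \<noteq> t \<and> h \<in> {20..<24} \<and> t \<in> {20..<24}"

lemma channelD:
  assumes "channel mk q h t"
  shows "mk \<noteq> q" "q \<noteq> mk" "h \<noteq> t" "t \<noteq> h" "mk \<notin> {0..7}" "q \<notin> {0..7}"
    "h \<notin> {..<20}" "t \<notin> {..<20}" "h \<notin> {24..}" "t \<notin> {24..}"
  using assms by (auto simp: channel_def)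

text \<open>The last conjunct replaces reachability by minimality among closed sets, the notion in
  which \<open>represents\<close> describes the graph. The bound on all stamps means that
  incrementing \<open>rStamp\<close> discards a finished search in one step.\<close>

definition search :: "nat \<Rightarrow> nat \<Rightarrow> nat \<Rightarrow> nat \<Rightarrow> nat set \<Rightarrow> state \<Rightarrow> bool" where
  "search mk q h t S s \<longleftrightarrow>
     queued (arr s mk) (reg s rStamp) (arr s q) (reg s t) (visited q t s) \<and>
     (\<forall>v. arr s mk v \<le> reg s rStamp) \<and>
     reg s h \<le> reg s t \<and> visited q t s \<inter> marked s = {} \<and> S \<subseteq> visited q t s \<and>
     (\<forall>i<reg s h. arr s aNext (arr s q i) \<in> visited q t s \<union> marked s \<and>
        arr s aTarget (arr s q i) \<in> visited q t s \<union> marked s) \<and>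
     (\<forall>Y. closed (arr s aNext) (arr s aTarget) Y \<longrightarrow> S \<subseteq> Y \<longrightarrow> visited q t s \<subseteq> Y)"

lemma search_cong:
  assumes "search mk q h t S s"
    and "arr s' mk = arr s mk" "arr s' q = arr s q" "reg s' h = reg s h" "reg s' t = reg s t"
      "reg s' rStamp = reg s rStamp" "arr s' aMark = arr s aMark" "arr s' aNext = arr s aNext"
      "arr s' aTarget = arr s aTarget"
  shows "search mk q h t S s'"
  using assms by (simp add: search_def visited_def marked_def)

lemma push_visited:
  assumes ch: "channel mk q h t" and v: "v \<notin> {20..<24}" "v \<noteq> rTmp"
    and q: "queued (arr s mk) (reg s rStamp) (arr s q) (reg s t) (visited q t s)" and z: "reg s rZero = 0"
    and le: "\<forall>v. arr s mk v \<le> reg s rStamp"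
  obtains u s' where "exec (push mk q t v) s u s'" "u \<le> 7"
    "queued (arr s' mk) (reg s' rStamp) (arr s' q) (reg s' t) (visited q t s')"
    "\<forall>v. arr s' mk v \<le> reg s' rStamp"
    "visited q t s' = visited q t s \<union> ({reg s v} - marked s)"
    "\<forall>i<reg s t. arr s' q i = arr s q i" "reg s t \<le> reg s' t"
proof -
  have r: "v \<noteq> rTmp" "rStamp \<noteq> t" "rZero \<noteq> t" "v \<noteq> t" "rTmp \<noteq> t" "aMark \<noteq> mk" "q \<noteq> mk"
    using ch v by (auto simp: channel_def)
  note D = q[unfolded queued_def]
  let ?P = "\<lambda>(T' :: nat) s'. T' \<le> 7 \<and> queued (arr s' mk) (reg s' rStamp) (arr s' q) (reg s' t) (visited q t s') \<and>
    (\<forall>v. arr s' mk v \<le> reg s' rStamp) \<and>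
    visited q t s' = visited q t s \<union> ({reg s v} - marked s) \<and>
    (\<forall>i<reg s t. arr s' q i = arr s q i) \<and> reg s t \<le> reg s' t"
  have same: "?P T' s'" if "T' \<le> 7" "arr s' = arr s" "reg s' t = reg s t" "reg s' rStamp = reg s rStamp"
      "reg s v \<in> visited q t s \<or> reg s v \<in> marked s" for T' s'
    using that q le by (auto simp: visited_def)
  have "wp (push mk q t v) 0 s ?P"
  proof (cases "reg s v \<in> marked s")
    case True
    have "?P 3 (set_reg rTmp (arr s aMark (reg s v)) s)"
      by (rule same) (use True r in auto)
    then show ?thesis using True r z by (simp add: push_def marked_def numeral_3_eq_3)
  next
    case False
    show ?thesis
    proof (cases "arr s mk (reg s v) = reg s rStamp")
      case True
      then have "reg s v \<in> visited q t s" using D by blast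
      then have "?P 5 (set_reg rTmp (reg s rStamp) s)"
        by (intro same) (use r in auto)
      then show ?thesis using True False r z by (simp add: push_def marked_def)
    next
      case new: False
      then have nv: "reg s v \<notin> visited q t s" using D by blast
      let ?s = "set_reg t (Suc (reg s t)) (set_arr q (reg s t) (reg s v)
          (set_arr mk (reg s v) (reg s rStamp) (set_reg rTmp (arr s mk (reg s v)) s)))"
      have vis: "visited q t ?s = insert (reg s v) (visited q t s)"
        using r by (auto simp: visited_def lessThan_Suc)
      have "queued (arr ?s mk) (reg ?s rStamp) (arr ?s q) (reg ?s t) (visited q t ?s)"
        unfolding vis using queued_push[OF q nv] r by (auto simp: fun_upd_def)
      moreover have eq: "visited q t ?s = visited q t s \<union> ({reg s v} - marked s)"
        using vis False by auto
      ultimately have "?P 7 ?s" using r le by auto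
      moreover have "arr s aMark (reg s v) = 0" using False by (simp add: marked_def)
      ultimately show ?thesis using new r z
        by (simp add: push_def eq)
    qed
  qed
  then show ?thesis unfolding wp_def using that by auto
qed

definition search_step :: "nat \<Rightarrow> nat \<Rightarrow> nat \<Rightarrow> nat \<Rightarrow> prog" where
  "search_step mk q h t = Read rU q h ;; Inc h ;; Read rV aNext rU ;; push mk q t rV ;;
     Read rV aTarget rU ;; push mk q t rV"

lemma frame_search_step:
  assumes "channel mk q h t" "exec (search_step mk q h t) s u s'"
  shows "frame {h, t, rU, rV, rTmp} {mk, q} s s'"
proof -
  have "wregs (search_step mk q h t) = {h, t, rU, rV, rTmp}" "warrs (search_step mk q h t) = {mk, q}"
    by (auto simp: search_step_def push_def skip_def)
  then show ?thesis using exec_frame[OF assms(2)] by simp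
qed

text \<open>18 is four operations plus two pushes of at most 7 each.\<close>

lemma search_step_exec:
  assumes ch: "channel mk q h t" and s: "search mk q h t S s" and z: "reg s rZero = 0" and z0: "0 \<in> marked s"
    and lt: "reg s h < reg s t"
  obtains u s' where "exec (search_step mk q h t) s u s'" "u \<le> 18" "search mk q h t S s'"
    "reg s' h = Suc (reg s h)" "frame {h, t, rU, rV, rTmp} {mk, q} s s'"
proof -
  note c = channelD[OF ch]
  have ne: "h \<noteq> rU" "h \<noteq> rV" "h \<noteq> rTmp" "t \<noteq> rU" "t \<noteq> rV" "h \<noteq> rStamp" "t \<noteq> rStamp" "h \<noteq> rZero" "t \<noteq> rTmp" "t \<noteq> rZero"
    "mk \<noteq> aNext" "mk \<noteq> aTarget" "mk \<noteq> aMark" "q \<noteq> aNext" "q \<noteq> aTarget" "q \<noteq> aMark"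
    using c by auto
  let ?u = "arr s q (reg s h)"
  let ?s1 = "set_reg rV (arr s aNext ?u) (set_reg h (Suc (reg s h)) (set_reg rU ?u s))"
  have q: "queued (arr s mk) (reg s rStamp) (arr s q) (reg s t) (visited q t s)"
    and le: "\<forall>v. arr s mk v \<le> reg s rStamp"
    using s by (auto simp: search_def)
  have v1: "visited q t ?s1 = visited q t s" "marked ?s1 = marked s"
    using ne c(3) by (simp_all add: visited_def marked_def)
  obtain u2 s2 where 2: "exec (push mk q t rV) ?s1 u2 s2" "u2 \<le> 7"
    "queued (arr s2 mk) (reg s2 rStamp) (arr s2 q) (reg s2 t) (visited q t s2)"
    "\<forall>v. arr s2 mk v \<le> reg s2 rStamp"
    "visited q t s2 = visited q t s \<union> ({arr s aNext ?u} - marked s)"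
    "\<forall>i<reg s t. arr s2 q i = arr s q i" "reg s t \<le> reg s2 t"
    using push_visited[OF ch, of rV ?s1] q le z ne c(3) v1 by auto
  have f2: "frame {t, rTmp} {mk, q} ?s1 s2"
    using exec_frame[OF 2(1)] by (simp add: push_def skip_def insert_commute)
  have fr2: "reg s2 r = reg ?s1 r" if "r \<noteq> t" "r \<noteq> rTmp" for r
    using frame_reg[OF f2] that by simp
  have fa2: "arr s2 a = arr s a" if "a \<noteq> mk" "a \<noteq> q" for a
    using frame_arr[OF f2] that by simp
  let ?s3 = "set_reg rV (arr s aTarget ?u) s2"
  have v3: "visited q t ?s3 = visited q t s2" "marked ?s3 = marked s"
    using ne fa2[of aMark] by (simp_all add: visited_def marked_def)
  have m2: "marked s2 = marked s" using ne fa2[of aMark] by (simp add: marked_def)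
  have z2: "reg s2 rZero = 0" using fr2[of rZero] ne z by simp
  obtain u4 s4 where 4: "exec (push mk q t rV) ?s3 u4 s4" "u4 \<le> 7"
    "queued (arr s4 mk) (reg s4 rStamp) (arr s4 q) (reg s4 t) (visited q t s4)"
    "\<forall>v. arr s4 mk v \<le> reg s4 rStamp"
    "visited q t s4 = visited q t s2 \<union> ({arr s aTarget ?u} - marked s)"
    "\<forall>i<reg s2 t. arr s4 q i = arr s2 q i" "reg s2 t \<le> reg s4 t"
    using push_visited[OF ch, of rV ?s3] 2(3,4) z2 ne v3 by auto
  have f4: "frame {t, rTmp} {mk, q} ?s3 s4"
    using exec_frame[OF 4(1)] by (simp add: push_def skip_def insert_commute)
  have fr4: "reg s4 r = reg ?s3 r" if "r \<noteq> t" "r \<noteq> rTmp" for r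
    using frame_reg[OF f4] that by simp
  have fa4: "arr s4 a = arr s a" if "a \<noteq> mk" "a \<noteq> q" for a
    using frame_arr[OF f4] that fa2 by simp
  have "reg s2 rU = ?u" "arr s2 aTarget = arr s aTarget" using fr2[of rU] fa2[of aTarget] ne by simp_all
  then have "wp (search_step mk q h t) 0 s (\<lambda>T' s'. T' = 4 + u2 + u4 \<and> s' = s4)"
    using ne unfolding search_step_def
    by (simp add: wp_exec[OF 2(1)] wp_exec[OF 4(1)])
  then have ex: "exec (search_step mk q h t) s (4 + u2 + u4) s4" unfolding wp_def by auto
  have vis: "visited q t s4 = visited q t s \<union> ({arr s aNext ?u, arr s aTarget ?u} - marked s)"
    using 2(5) 4(5) by auto
  have h4: "reg s4 h = Suc (reg s h)" using fr4[of h] fr2[of h] ne c(3) by simp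
  have m4: "marked s4 = marked s" "arr s4 aNext = arr s aNext" "arr s4 aTarget = arr s aTarget"
    using ne fa4 by (simp_all add: marked_def)
  have q4: "arr s4 q i = arr s q i" if "i < reg s t" for i
    using that 2(6,7) 4(6) by simp
  have hu: "?u \<in> visited q t s" using lt by (auto simp: visited_def)
  have "search mk q h t S s4"
    unfolding search_def
  proof (intro conjI)
    show "reg s4 h \<le> reg s4 t" using h4 lt 2(7) 4(7) by simp
    show "visited q t s4 \<inter> marked s4 = {}" using s vis m4 by (auto simp: search_def)
    show "S \<subseteq> visited q t s4" using s vis by (auto simp: search_def)
    show "\<forall>i<reg s4 h. arr s4 aNext (arr s4 q i) \<in> visited q t s4 \<union> marked s4 \<and>
        arr s4 aTarget (arr s4 q i) \<in> visited q t s4 \<union> marked s4"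
    proof (intro allI impI)
      fix i assume i: "i < reg s4 h"
      then have it: "i < reg s t" using h4 lt by simp
      consider "i < reg s h" | "i = reg s h" using i h4 by (auto simp: less_Suc_eq)
      then show "arr s4 aNext (arr s4 q i) \<in> visited q t s4 \<union> marked s4 \<and>
        arr s4 aTarget (arr s4 q i) \<in> visited q t s4 \<union> marked s4"
      proof cases
        case 1
        then have "arr s aNext (arr s q i) \<in> visited q t s \<union> marked s \<and>
            arr s aTarget (arr s q i) \<in> visited q t s \<union> marked s"
          using s by (simp add: search_def)
        then show ?thesis by (auto simp: m4 vis q4[OF it])
      qed (use q4[OF it] in \<open>simp add: m4 vis\<close>)
    qed
    show "\<forall>Y. closed (arr s4 aNext) (arr s4 aTarget) Y \<longrightarrow> S \<subseteq> Y \<longrightarrow> visited q t s4 \<subseteq> Y"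
    proof (intro allI impI)
      fix Y assume Y: "closed (arr s4 aNext) (arr s4 aTarget) Y" "S \<subseteq> Y"
      then have sub: "visited q t s \<subseteq> Y" using s m4 by (simp add: search_def)
      then have "?u \<in> Y" using hu by blast
      \<comment> \<open>\<open>closed\<close> says nothing about successor 0, but 0 is marked and
        thus never enters the queue.\<close>
      then have "{arr s aNext ?u, arr s aTarget ?u} - {0} \<subseteq> Y" using Y(1) m4 by (auto simp: closed_def)
      then show "visited q t s4 \<subseteq> Y" using sub z0 by (auto simp: vis)
    qed
  qed (use 4 in auto)
  moreover have "frame {h, t, rU, rV, rTmp} {mk, q} s s4"
    by (rule frame_search_step[OF ch ex])
  ultimately show ?thesis using that[OF ex] 2(2) 4(2) h4 by simp
qed

text \<open>The queue has no repetitions and stays within the closed set of all nodes. This bound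
  provides the limit that \<open>wp_While\<close> asks for.\<close>

lemma search_bound:
  assumes "search mk q h t S s" "S \<subseteq> {1..<f}" "closed (arr s aNext) (arr s aTarget) {1..<f}"
  shows "reg s t \<le> f"
proof -
  have q: "queued (arr s mk) (reg s rStamp) (arr s q) (reg s t) (visited q t s)"
    and "visited q t s \<subseteq> {1..<f}" using assms by (simp_all add: search_def)
  then have "card (visited q t s) \<le> card {1..<f}" by (intro card_mono) auto
  then show ?thesis using queued_card[OF q] by simp
qed

text \<open>Every iteration advances the head and costs at most 18 + 1, so only the nodes still to
  be processed are charged.\<close>

lemma wp_finish:
  assumes ch: "channel mk q h t" and s: "search mk q h t S s" and z: "reg s rZero = 0" and z0: "0 \<in> marked s"
    and S: "S \<subseteq> {1..<f}" and cl: "closed (arr s aNext) (arr s aTarget) {1..<f}"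
    and Q: "\<And>T' s'. T' \<le> Suc T + 19 * (reg s' t - reg s h) \<Longrightarrow> search mk q h t S s' \<Longrightarrow> reg s' h = reg s' t \<Longrightarrow>
      reg s h \<le> reg s' h \<Longrightarrow> frame {h, t, rU, rV, rTmp} {mk, q} s s' \<Longrightarrow> Q T' s'"
  shows "wp (While (Less h t) (search_step mk q h t)) T s Q"
proof -
  note c = channelD[OF ch]
  have ne: "h \<noteq> rZero" "t \<noteq> rZero" "mk \<noteq> aNext" "mk \<noteq> aTarget" "mk \<noteq> aMark" "q \<noteq> aNext" "q \<noteq> aTarget" "q \<noteq> aMark"
    using c by auto
  let ?I = "\<lambda>T' s'. T' \<le> T + 19 * (reg s' h - reg s h) \<and> search mk q h t S s' \<and> reg s h \<le> reg s' h \<and>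
      frame {h, t, rU, rV, rTmp} {mk, q} s s'"
  have fr: "reg s' rZero = 0" "marked s' = marked s" "arr s' aNext = arr s aNext" "arr s' aTarget = arr s aTarget"
    if "?I T' s'" for T' s'
  proof -
    have f: "frame {h, t, rU, rV, rTmp} {mk, q} s s'" using that by blast
    show "reg s' rZero = 0" "arr s' aNext = arr s aNext" "arr s' aTarget = arr s aTarget"
      using frame_reg[OF f, of rZero] frame_arr[OF f, of aNext] frame_arr[OF f, of aTarget] z ne by simp_all
    show "marked s' = marked s" using frame_arr[OF f, of aMark] ne by (simp add: marked_def)
  qed
  have bound: "reg s' t \<le> f" if "?I T' s'" for T' s'
    by (rule search_bound[OF _ S]) (use that fr[OF that] cl in auto)
  show ?thesis
  proof (rule wp_While[where I = ?I and B = "T + 19 * f"])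
    show "?I T s" using s by (simp add: frame_def)
    show "T' \<le> T + 19 * f" if "?I T' s'" for T' s'
    proof -
      have "reg s' h \<le> reg s' t" using that by (simp add: search_def)
      then show ?thesis using that bound[OF that] by linarith
    qed
    show "Q (Suc T') s'" if "?I T' s'" "\<not> holds (Less h t) s'" for T' s'
    proof (rule Q)
      have "reg s' h = reg s' t" using that by (simp add: search_def)
      then show "Suc T' \<le> Suc T + 19 * (reg s' t - reg s h)" "reg s' h = reg s' t" using that by auto
    qed (use that in auto)
    show "wp (search_step mk q h t) (Suc T') s' ?I" if I: "?I T' s'" and b: "holds (Less h t) s'" for T' s'
    proof -
      obtain u s2 where 2: "exec (search_step mk q h t) s' u s2" "u \<le> 18" "search mk q h t S s2"
        "reg s2 h = Suc (reg s' h)" "frame {h, t, rU, rV, rTmp} {mk, q} s' s2"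
        using search_step_exec[OF ch, of S s'] I fr[OF I] b z0 by auto
      have "frame {h, t, rU, rV, rTmp} {mk, q} s s2"
        using I 2(5) by (simp add: frame_def)
      then show ?thesis using 2 I by (simp add: wp_exec[OF 2(1)] Suc_diff_le)
    qed
  qed
qed

section \<open>Committing and checking an exhausted search\<close>

definition commit :: "nat \<Rightarrow> nat \<Rightarrow> prog" where
  "commit q t = Copy rI rZero ;; While (Less rI t) (Read rU q rI ;; Write aMark rU rOne ;; Inc rI)"

lemma wp_commit:
  assumes ch: "channel mk q h t" and one: "reg s rOne = 1" "reg s rZero = 0"
    and Q: "\<And>T' s'. T' \<le> T + 2 + 4 * reg s t \<Longrightarrow> marked s' = marked s \<union> visited q t s \<Longrightarrow>
      frame {rI, rU} {aMark} s s' \<Longrightarrow> Q T' s'"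
  shows "wp (commit q t) T s Q"
proof -
  have ne: "t \<noteq> rI" "t \<noteq> rU" "q \<noteq> aMark" using ch by (auto simp: channel_def)
  let ?I = "\<lambda>T' s'. T' \<le> Suc T + 4 * reg s' rI \<and> reg s' rI \<le> reg s t \<and>
     marked s' = marked s \<union> arr s q ` {..<reg s' rI} \<and> frame {rI, rU} {aMark} s s'"
  have fr: "reg s' t = reg s t" "arr s' q = arr s q" "reg s' rOne = 1" if "?I T' s'" for T' s'
    using that ne one by (auto simp: frame_def)
  have "wp (While (Less rI t) (Read rU q rI ;; Write aMark rU rOne ;; Inc rI)) (Suc T) (set_reg rI 0 s) Q"
  proof (rule wp_While[where I = ?I and B = "Suc T + 4 * reg s t"])
    show "?I (Suc T) (set_reg rI 0 s)" by (auto simp: marked_def frame_def)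
    show "T' \<le> Suc T + 4 * reg s t" if "?I T' s'" for T' s' using that by linarith
    show "Q (Suc T') s'" if "?I T' s'" "\<not> holds (Less rI t) s'" for T' s'
      using that fr[OF that(1)] by (intro Q) (auto simp: visited_def)
    show "wp (Read rU q rI ;; Write aMark rU rOne ;; Inc rI) (Suc T') s' ?I"
      if I: "?I T' s'" and b: "holds (Less rI t) s'" for T' s'
    proof -
      let ?s = "set_reg rI (Suc (reg s' rI)) (set_arr aMark (arr s q (reg s' rI)) 1 (set_reg rU (arr s q (reg s' rI)) s'))"
      have "marked ?s = insert (arr s q (reg s' rI)) (marked s')" by (auto simp: marked_def)
      then have "marked ?s = marked s \<union> arr s q ` {..<Suc (reg s' rI)}"
        using I by (auto simp: lessThan_Suc)
      moreover have "frame {rI, rU} {aMark} s ?s" using I by (auto simp: frame_def)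
      ultimately show ?thesis using I b fr[OF I] by simp
    qed
  qed
  then show ?thesis using one by (simp add: commit_def)
qed

definition check :: "nat \<Rightarrow> nat \<Rightarrow> nat \<Rightarrow> prog" where
  "check mk q t = Copy rOk rOne ;; Copy rI rZero ;;
     While (Less rI t) (Read rU q rI ;; Read rV aNeg rU ;; Read rTmp mk rV ;;
       If (Equal rTmp rStamp) (Copy rOk rZero) skip ;; Inc rI)"

lemma wp_check:
  assumes ch: "channel mk q h t" and one: "reg s rOne = 1" "reg s rZero = 0"
    and qd: "queued (arr s mk) (reg s rStamp) (arr s q) (reg s t) (visited q t s)"
    and Q: "\<And>T' s'. T' \<le> T + 3 + 7 * reg s t \<Longrightarrow>
      reg s' rOk = (if \<exists>u\<in>visited q t s. arr s aNeg u \<in> visited q t s then 0 else 1) \<Longrightarrow>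
      frame {rI, rU, rV, rTmp, rOk} {} s s' \<Longrightarrow> Q T' s'"
  shows "wp (check mk q t) T s Q"
proof -
  have ne: "t \<noteq> rI" "t \<noteq> rU" "t \<noteq> rV" "t \<noteq> rTmp" "t \<noteq> rOk" using ch by (auto simp: channel_def)
  have mk: "arr s mk v = reg s rStamp \<longleftrightarrow> v \<in> visited q t s" for v
    using qd unfolding queued_def by blast
  let ?bad = "\<lambda>i. arr s aNeg (arr s q i) \<in> visited q t s"
  let ?I = "\<lambda>T' s'. T' \<le> T + 2 + 7 * reg s' rI \<and> reg s' rI \<le> reg s t \<and>
     reg s' rOk = (if \<exists>i<reg s' rI. ?bad i then 0 else 1) \<and> frame {rI, rU, rV, rTmp, rOk} {} s s'"
  have fr: "reg s' t = reg s t" "arr s' = arr s" "reg s' rOne = 1" "reg s' rZero = 0" "reg s' rStamp = reg s rStamp"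
    if "?I T' s'" for T' s'
    using that ne one by (auto simp: frame_def fun_eq_iff)
  let ?body = "Read rU q rI ;; Read rV aNeg rU ;; Read rTmp mk rV ;;
       If (Equal rTmp rStamp) (Copy rOk rZero) skip ;; Inc rI"
  have "wp (While (Less rI t) ?body) (Suc (Suc T)) (set_reg rI 0 (set_reg rOk 1 s)) Q"
  proof (rule wp_While[where I = ?I and B = "T + 2 + 7 * reg s t"])
    show "?I (Suc (Suc T)) (set_reg rI 0 (set_reg rOk 1 s))" by (auto simp: frame_def)
    show "T' \<le> T + 2 + 7 * reg s t" if "?I T' s'" for T' s' using that by linarith
    show "Q (Suc T') s'" if "?I T' s'" "\<not> holds (Less rI t) s'" for T' s'
    proof (rule Q)
      have "reg s' rI = reg s t" using that fr[OF that(1)] by auto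
      moreover have "(\<exists>i<reg s t. ?bad i) \<longleftrightarrow> (\<exists>u\<in>visited q t s. arr s aNeg u \<in> visited q t s)"
        by (auto simp: visited_def)
      ultimately show "reg s' rOk = (if \<exists>u\<in>visited q t s. arr s aNeg u \<in> visited q t s then 0 else 1)"
        "Suc T' \<le> T + 3 + 7 * reg s t"
        using that by auto
    qed (use that in auto)
    show "wp ?body (Suc T') s' ?I" if I: "?I T' s'" and b: "holds (Less rI t) s'" for T' s'
    proof -
      let ?i = "reg s' rI"
      let ?s1 = "set_reg rTmp (arr s mk (arr s aNeg (arr s q ?i))) (set_reg rV (arr s aNeg (arr s q ?i))
        (set_reg rU (arr s q ?i) s'))"
      have ex: "(\<exists>i<Suc ?i. ?bad i) \<longleftrightarrow> ?bad ?i \<or> (\<exists>i<?i. ?bad i)" by (auto simp: less_Suc_eq)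
      have f: "frame {rI, rU, rV, rTmp, rOk} {} s (set_reg rI (Suc ?i) ?s1)"
        "frame {rI, rU, rV, rTmp, rOk} {} s (set_reg rI (Suc ?i) (set_reg rOk 0 ?s1))"
        using I by (auto simp: frame_def)
      show ?thesis
      proof (cases "?bad ?i")
        case True
        then show ?thesis using I b f fr[OF I] ex mk by simp
      next
        case False
        then show ?thesis using I b f fr[OF I] ex mk by simp
      qed
    qed
  qed
  then show ?thesis using one by (simp add: check_def)
qed

section \<open>Extending the set of marked literals\<close>

definition lits :: "nat set \<Rightarrow> lit set" where
  "lits X = {l. node l \<in> X}"

definition links :: "nat set \<Rightarrow> nat set" where
  "links X = {x. link x \<in> X}"

lemma sorted_wrt_symmetric:
  assumes "distinct xs" "\<And>x y. P x y \<longleftrightarrow> P y x"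
  shows "sorted_wrt P xs \<longleftrightarrow> (\<forall>x\<in>set xs. \<forall>y\<in>set xs. x \<noteq> y \<longrightarrow> P x y)"
  using assms(1)
proof (induction xs)
  case (Cons x xs)
  then show ?case using assms(2) by auto
qed simp

lemma sorted_pair_closed:
  assumes "distinct (map lit_var ds)"
  shows "sorted_wrt (pair_closed X) ds \<longleftrightarrow>
    (\<forall>l\<in>set ds. \<forall>k\<in>set ds. l \<noteq> k \<longrightarrow> negate l \<in> lits X \<longrightarrow> k \<in> lits X)"
proof -
  have "distinct ds" using assms by (simp add: distinct_map)
  then have "sorted_wrt (pair_closed X) ds \<longleftrightarrow> (\<forall>l\<in>set ds. \<forall>k\<in>set ds. l \<noteq> k \<longrightarrow> pair_closed X l k)"
    by (rule sorted_wrt_symmetric) (auto simp: pair_closed_def)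
  then show ?thesis by (auto simp: pair_closed_def lits_def)
qed

text \<open>The complements of the forbidden literals are the disjunctive literals accompanying a
  xor and both signs of the xor literals, which is what \<open>obeys\<close> requires outright; the
  symmetric pairs over a distinct list give \<open>imp_closed\<close>.\<close>

lemma obeys_iff:
  assumes "formula_over {..<n} \<phi>"
  shows "(\<forall>c\<in>set \<phi>. obeys c X) \<longleftrightarrow> forced \<phi> (lits X) \<and> link_closed \<phi> (links X)"
proof -
  have d: "distinct (map lit_var (disj_part c))" if "c \<in> set \<phi>" for c
    using assms that by (auto simp: formula_over_def clause_over_def)
  have forb: "negate ` forbidden \<phi> \<subseteq> lits X \<longleftrightarrow> (\<forall>c\<in>set \<phi>. xor_part c \<noteq> [] \<longrightarrow>
      (\<forall>l\<in>set (disj_part c). node l \<in> X) \<and> (\<forall>l\<in>set (xor_part c). node l \<in> X \<and> node (negate l) \<in> X))"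
    (is "?L \<longleftrightarrow> ?R")
  proof
    assume L: ?L
    then have in_X: "node k \<in> X" if "negate k \<in> forbidden \<phi>" for k
      using that by (force simp: lits_def)
    show ?R
    proof (intro ballI impI conjI)
      fix c l assume "c \<in> set \<phi>" "xor_part c \<noteq> []" "l \<in> set (disj_part c)"
      then show "node l \<in> X" by (intro in_X) (auto simp: forbidden_def)
    next
      fix c l assume "c \<in> set \<phi>" "xor_part c \<noteq> []" "l \<in> set (xor_part c)"
      then show "node l \<in> X" "node (negate l) \<in> X"
        using forbidden_xor[of c \<phi> l] by (auto intro: in_X)
    qed
  next
    assume R: ?R
    show ?L
    proof
      fix k assume "k \<in> negate ` forbidden \<phi>"
      then obtain l c where k: "k = negate l" and c: "c \<in> set \<phi>" "xor_part c \<noteq> []"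
        and l: "negate l \<in> set (disj_part c) \<or> l \<in> set (xor_part c) \<or> negate l \<in> set (xor_part c)"
        by (auto simp: forbidden_def)
      then show "k \<in> lits X" using R c by (auto simp: lits_def)
    qed
  qed
  have imp: "imp_closed \<phi> (lits X) \<longleftrightarrow> (\<forall>c\<in>set \<phi>. sorted_wrt (pair_closed X) (disj_part c))"
    unfolding imp_closed_def using sorted_pair_closed[OF d] by simp
  have lc: "link_closed \<phi> (links X) \<longleftrightarrow> (\<forall>c\<in>set \<phi>. (\<forall>l\<in>set (xor_part c). 2 < length (xor_part c) \<longrightarrow> link (lit_var l) \<in> X) \<and>
     (\<forall>l\<in>set (xor_part c). \<forall>k\<in>set (xor_part c). link (lit_var l) \<in> X \<longrightarrow> link (lit_var k) \<in> X))"
    unfolding link_closed_def links_def vars_def by auto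
  have ne: "l \<in> set (xor_part c) \<Longrightarrow> xor_part c \<noteq> []" for l c by auto
  show ?thesis
    unfolding forced_def imp forb lc obeys_def using ne by blast
qed

section \<open>From closed node sets to literal sets and back\<close>

definition graph :: "nat \<Rightarrow> formula \<Rightarrow> (nat \<Rightarrow> nat) \<Rightarrow> (nat \<Rightarrow> nat) \<Rightarrow> nat \<Rightarrow> nat set \<Rightarrow> bool" where
  "graph n \<phi> N T f D \<longleftrightarrow> formula_over {..<n} \<phi> \<and>
     represents N T f D (base n) (\<lambda>X. \<forall>c\<in>set \<phi>. obeys c X)"

lemma graph_bounds:
  assumes "graph n \<phi> N T f D"
  shows "D \<subseteq> {1..<f}" "base n \<subseteq> {1..<f}" "closed N T {1..<f}" "formula_over {..<n} \<phi>"
  using assms unfolding graph_def represents_def closed_def by auto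

lemma graph_closed:
  assumes g: "graph n \<phi> N T f D" and Y: "closed N T Y" "D \<subseteq> Y" "Y \<subseteq> {1..<f}"
  shows "forced \<phi> (lits (Y \<inter> base n))" "link_closed \<phi> (links (Y \<inter> base n))"
proof -
  have r: "represents N T f D (base n) (\<lambda>X. \<forall>c\<in>set \<phi>. obeys c X)" using g by (simp add: graph_def)
  have "\<forall>c\<in>set \<phi>. obeys c (Y \<inter> base n)"
    using represents_iff[OF r, of "Y \<inter> base n"] Y by blast
  then show "forced \<phi> (lits (Y \<inter> base n))" "link_closed \<phi> (links (Y \<inter> base n))"
    using obeys_iff g unfolding graph_def by blast+
qed

lemma link_closed_range:
  assumes "formula_over {..<n} \<phi>" "link_closed \<phi> Z"
  shows "link_closed \<phi> {x\<in>Z. x < n}"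
proof -
  have v: "x < n" if "c \<in> set \<phi>" "x \<in> vars (xor_part c)" for c x
    using assms(1) that by (fastforce simp: formula_over_def clause_over_def clause_vars_def)
  show ?thesis
    unfolding link_closed_def
  proof (intro ballI impI)
    fix c x y assume *: "c \<in> set \<phi>" "x \<in> vars (xor_part c)" "y \<in> vars (xor_part c)"
      "2 < length (xor_part c) \<or> x \<in> {x\<in>Z. x < n}"
    then have "y \<in> Z" using assms(2) unfolding link_closed_def by blast
    then show "y \<in> {x\<in>Z. x < n}" using v[OF *(1,3)] by simp
  qed
qed

text \<open>The abstract sets are over all literals, node sets only over the first \<open>n\<close>
  variables; the clauses do not see the difference.\<close>

lemma forced_range:
  assumes "formula_over {..<n} \<phi>" "forced \<phi> L"
  shows "forced \<phi> {l\<in>L. lit_var l < n}"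
proof -
  have v: "lit_var l < n" if "c \<in> set \<phi>" "l \<in> set (disj_part c) \<or> l \<in> set (xor_part c)" for c l
    using assms(1) that by (fastforce simp: formula_over_def clause_over_def clause_vars_def vars_def)
  have "imp_closed \<phi> {l\<in>L. lit_var l < n}"
    unfolding imp_closed_def
  proof (intro ballI impI)
    fix c l k assume *: "c \<in> set \<phi>" "l \<in> set (disj_part c)" "k \<in> set (disj_part c)" "l \<noteq> k"
      "negate l \<in> {l\<in>L. lit_var l < n}"
    have "imp_closed \<phi> L" using assms(2) by (simp add: forced_def)
    from imp_closedD[OF this *(1-4)] have "k \<in> L" using *(5) by simp
    then show "k \<in> {l\<in>L. lit_var l < n}" using v *(1,3) by simp
  qed
  moreover have "lit_var l < n" if f: "l \<in> forbidden \<phi>" for l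
  proof -
    from f obtain c where c: "c \<in> set \<phi>"
      "negate l \<in> set (disj_part c) \<or> l \<in> set (xor_part c) \<or> negate l \<in> set (xor_part c)"
      by (auto simp: forbidden_def)
    then show ?thesis using v[of c "negate l"] v[of c l] by auto
  qed
  ultimately show ?thesis using assms(2) by (auto simp: forced_def)
qed

text \<open>Supplies the auxiliary nodes for a given pair of literal and variable sets. It carries
  the minimality of a search, known for node sets, over to literal sets.\<close>

lemma graph_extend:
  assumes g: "graph n \<phi> N T f D" and LZ: "forced \<phi> L" "link_closed \<phi> Z"
  obtains Y where "closed N T Y" "D \<subseteq> Y" "Y \<subseteq> {1..<f}" "lits (Y \<inter> base n) = {l\<in>L. lit_var l < n}"
    "links (Y \<inter> base n) = {x\<in>Z. x < n}"
proof -
  let ?X = "node ` {l\<in>L. lit_var l < n} \<union> link ` {x\<in>Z. x < n}"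
  have r: "represents N T f D (base n) (\<lambda>X. \<forall>c\<in>set \<phi>. obeys c X)" and \<phi>: "formula_over {..<n} \<phi>"
    using g by (simp_all add: graph_def)
  have X: "lits ?X = {l\<in>L. lit_var l < n}" "links ?X = {x\<in>Z. x < n}"
    by (auto simp: lits_def links_def)
  have "?X \<subseteq> base n" by auto
  moreover have "\<forall>c\<in>set \<phi>. obeys c ?X"
    unfolding obeys_iff[OF \<phi>] X using forced_range[OF \<phi> LZ(1)] link_closed_range[OF \<phi> LZ(2)] by blast
  ultimately obtain Y where "Y \<subseteq> {1..<f}" "closed N T Y" "D \<subseteq> Y" "Y \<inter> base n = ?X"
    using represents_iff[OF r, of ?X] by blast
  then show ?thesis using that X by metis
qed

lemma lits_Un: "lits ((M \<union> V) \<inter> B) = lits (M \<inter> B) \<union> lits (V \<inter> B)"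
  and links_Un: "links ((M \<union> V) \<inter> B) = links (M \<inter> B) \<union> links (V \<inter> B)"
  by (auto simp: lits_def links_def)

lemma zero_base: "(M - {0}) \<inter> base n = M \<inter> base n"
  by auto

text \<open>M is what is marked and V what an exhausted search has visited. Minimality of V is
  tested against a node set Y built from an arbitrary closed S together with M; V is disjoint from
  M, so its literals must come from S.\<close>

lemma search_extension:
  assumes g: "graph n \<phi> N T f D" and M: "0 \<in> M" "closed N T (M - {0})" "D \<subseteq> M" "M \<subseteq> {..<f}"
    and V: "V \<inter> M = {}" "node l \<in> V" "\<And>u. u \<in> V \<Longrightarrow> N u \<in> V \<union> M \<and> T u \<in> V \<union> M"
    and least: "\<And>Y. closed N T Y \<Longrightarrow> node l \<in> Y \<Longrightarrow> V \<subseteq> Y" and l: "lit_var l < n"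
  shows "least_extension \<phi> (lits (M \<inter> base n)) l (lits (V \<inter> base n))"
    "links ((M \<union> V) \<inter> base n) = links (M \<inter> base n)"
    "V \<subseteq> {1..<f}" "closed N T (M \<union> V - {0})"
proof -
  note b = graph_bounds[OF g]
  have nb: "node l \<in> base n" using l by simp
  show Vf: "V \<subseteq> {1..<f}" by (rule least[OF b(3)]) (use nb b(2) in blast)
  have "\<forall>u\<in>M - {0}. (N u = 0 \<or> N u \<in> M) \<and> (T u = 0 \<or> T u \<in> M)"
    using M(2) unfolding closed_def by blast
  then show cl: "closed N T (M \<union> V - {0})"
    using V(3) unfolding closed_def by blast
  have sub: "M - {0} \<subseteq> {1..<f}" "D \<subseteq> M - {0}" "D \<subseteq> M \<union> V - {0}" using M b(1) by auto
  have sub2: "M \<union> V - {0} \<subseteq> {1..<f}" using sub Vf by auto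
  note fM = graph_closed[OF g M(2) sub(2,1), unfolded zero_base]
  note fMV = graph_closed[OF g cl sub(3) sub2, unfolded zero_base]
  have ext: "lits (V \<inter> base n) \<subseteq> S \<and> links (V \<inter> base n) \<subseteq> links (M \<inter> base n)"
    if S: "imp_closed \<phi> S" "l \<in> S" for S
  proof -
    \<comment> \<open>S alone may lack the complements of the forbidden literals, which every closed
      node set containing D must have; the marked literals provide them.\<close>
    have "forced \<phi> (S \<union> lits (M \<inter> base n))"
      using fM(1) S(1) imp_closed_Un by (auto simp: forced_def)
    from graph_extend[OF g this fM(2)] obtain Y where Y: "closed N T Y"
      "lits (Y \<inter> base n) = {k \<in> S \<union> lits (M \<inter> base n). lit_var k < n}"
      "links (Y \<inter> base n) = {x \<in> links (M \<inter> base n). x < n}" by metis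
    have "l \<in> lits (Y \<inter> base n)" using Y(2) S(2) l by simp
    then have "V \<subseteq> Y" using least[OF Y(1)] by (simp add: lits_def)
    then have "lits (V \<inter> base n) \<subseteq> lits (Y \<inter> base n)" "links (V \<inter> base n) \<subseteq> links (Y \<inter> base n)"
      by (auto simp: lits_def links_def)
    moreover have "lits (V \<inter> base n) \<inter> lits (M \<inter> base n) = {}" using V(1) by (auto simp: lits_def)
    ultimately show ?thesis using Y(2,3) by blast
  qed
  \<comment> \<open>The set of all literals is closed as well, and no restriction on literals can
    then be the reason for a new link: there is none.\<close>
  show "links ((M \<union> V) \<inter> base n) = links (M \<inter> base n)"
    unfolding links_Un using ext[OF imp_closed_UNIV] by blast
  show "least_extension \<phi> (lits (M \<inter> base n)) l (lits (V \<inter> base n))"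
    unfolding least_extension_def
  proof (intro conjI allI impI)
    show "imp_closed \<phi> (lits (M \<inter> base n) \<union> lits (V \<inter> base n))"
      using fMV(1) unfolding lits_Un forced_def by blast
    show "l \<in> lits (V \<inter> base n)" using V(2) nb by (simp add: lits_def)
  qed (use ext in blast)
qed

section \<open>Deciding a variable by an exhausted search\<close>

definition ready :: "(nat \<Rightarrow> nat) \<Rightarrow> nat \<Rightarrow> (nat \<Rightarrow> nat) \<Rightarrow> (nat \<Rightarrow> nat) \<Rightarrow> state \<Rightarrow> bool" where
  "ready inp n N T s \<longleftrightarrow> arr s aIn = inp \<and> tables n s \<and> arr s aOut = (\<lambda>_. 0) \<and>
     arr s aNext = N \<and> arr s aTarget = T \<and> reg s rZero = 0 \<and> reg s rOne = 1 \<and> reg s rTwo = 2"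

lemma ready_frame:
  assumes "ready inp n N T s" "frame R A s s'" "{rZero, rOne, rTwo} \<inter> R = {}"
    "{aIn, aOut, aNode, aNeg, aLink, aNext, aTarget} \<inter> A = {}"
  shows "ready inp n N T s'"
  using assms frame_reg[OF assms(2)] frame_arr[OF assms(2)] by (simp add: ready_def tables_def)

definition invar :: "nat \<Rightarrow> formula \<Rightarrow> (nat \<Rightarrow> nat) \<Rightarrow> (nat \<Rightarrow> nat) \<Rightarrow> nat \<Rightarrow> nat set \<Rightarrow> nat set \<Rightarrow> bool" where
  "invar n \<phi> N T f D M \<longleftrightarrow> 0 \<in> M \<and> closed N T (M - {0}) \<and> D \<subseteq> M \<and> M \<subseteq> {..<f} \<and>
     marking \<phi> (lits (M \<inter> base n)) (links (M \<inter> base n))"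

lemma search_done:
  assumes g: "graph n \<phi> N T f D" and i: "invar n \<phi> N T f D (marked s)" and r: "ready inp n N T s"
    and s: "search mk q h t {node l} s" and halt: "reg s h = reg s t" and l: "lit_var l < n"
  shows "least_extension \<phi> (lits (marked s \<inter> base n)) l (lits (visited q t s \<inter> base n))"
    "links ((marked s \<union> visited q t s) \<inter> base n) = links (marked s \<inter> base n)"
    "visited q t s \<subseteq> {1..<f}" "closed N T (marked s \<union> visited q t s - {0})"
proof -
  have NT: "arr s aNext = N" "arr s aTarget = T" using r by (simp_all add: ready_def)
  have M: "0 \<in> marked s" "closed N T (marked s - {0})" "D \<subseteq> marked s" "marked s \<subseteq> {..<f}"
    using i by (simp_all add: invar_def)
  have V: "visited q t s \<inter> marked s = {}" "node l \<in> visited q t s"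
    and least: "\<And>Y. closed N T Y \<Longrightarrow> node l \<in> Y \<Longrightarrow> visited q t s \<subseteq> Y"
    and all: "\<forall>i<reg s t. N (arr s q i) \<in> visited q t s \<union> marked s \<and> T (arr s q i) \<in> visited q t s \<union> marked s"
    using s halt NT by (simp_all add: search_def)
  have "N u \<in> visited q t s \<union> marked s \<and> T u \<in> visited q t s \<union> marked s" if u: "u \<in> visited q t s" for u
  proof -
    obtain i where "i < reg s t" "u = arr s q i" using u by (auto simp: visited_def)
    then show ?thesis using all by blast
  qed
  note E = search_extension[OF g M V this least l]
  show "least_extension \<phi> (lits (marked s \<inter> base n)) l (lits (visited q t s \<inter> base n))"
    "links ((marked s \<union> visited q t s) \<inter> base n) = links (marked s \<inter> base n)"
    "visited q t s \<subseteq> {1..<f}" "closed N T (marked s \<union> visited q t s - {0})"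
    by (rule E; assumption)+
qed

lemma tables_neg: "tables n s \<Longrightarrow> lit_var l < n \<Longrightarrow> arr s aNeg (node l) = node (negate l)"
  by (simp add: tables_def)

lemma tables_neg_nonzero: "tables n s \<Longrightarrow> arr s aNeg v \<noteq> 0 \<Longrightarrow> \<exists>l. lit_var l < n \<and> v = node l"
  by (metis tables_def)

text \<open>The program inspects auxiliary and link nodes too; their entry in \<open>aNeg\<close> is
  0, which is not in V.\<close>

lemma bad_iff:
  assumes r: "tables n s" and V: "0 \<notin> V"
  shows "(\<exists>u\<in>V. arr s aNeg u \<in> V) \<longleftrightarrow> (\<exists>k\<in>lits (V \<inter> base n). negate k \<in> lits (V \<inter> base n))"
proof
  assume "\<exists>u\<in>V. arr s aNeg u \<in> V"
  then obtain u where u: "u \<in> V" "arr s aNeg u \<in> V" by blast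
  then have "arr s aNeg u \<noteq> 0" using V by metis
  then obtain l where l: "lit_var l < n" "u = node l" using tables_neg_nonzero[OF r] by blast
  then have "arr s aNeg u = node (negate l)" using tables_neg[OF r] by simp
  then have "l \<in> lits (V \<inter> base n)" "negate l \<in> lits (V \<inter> base n)"
    using u l by (auto simp: lits_def)
  then show "\<exists>k\<in>lits (V \<inter> base n). negate k \<in> lits (V \<inter> base n)" by blast
next
  assume "\<exists>k\<in>lits (V \<inter> base n). negate k \<in> lits (V \<inter> base n)"
  then obtain k where k: "node k \<in> V" "lit_var k < n" "node (negate k) \<in> V" by (auto simp: lits_def)
  then have "arr s aNeg (node k) = node (negate k)" using tables_neg[OF r] by simp
  then show "\<exists>u\<in>V. arr s aNeg u \<in> V" using k by metis
qed

text \<open>Run when the search on the first channel is exhausted; the other one may still be unfinished.\<close>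

definition decide :: "nat \<Rightarrow> nat \<Rightarrow> nat \<Rightarrow> nat \<Rightarrow> nat \<Rightarrow> nat \<Rightarrow> nat \<Rightarrow> nat \<Rightarrow> prog" where
  "decide mk q h t mk' q' h' t' = check mk q t ;;
     If (Equal rOk rOne) (commit q t) (While (Less h' t') (search_step mk' q' h' t') ;; commit q' t')"

definition grown :: "nat \<Rightarrow> formula \<Rightarrow> (nat \<Rightarrow> nat) \<Rightarrow> (nat \<Rightarrow> nat) \<Rightarrow> nat \<Rightarrow> nat set \<Rightarrow> lit \<Rightarrow> nat set \<Rightarrow> nat set \<Rightarrow> bool" where
  "grown n \<phi> N T f D l M M' \<longleftrightarrow> invar n \<phi> N T f D M' \<and> M \<subseteq> M' \<and> (node l \<in> M' \<or> node (negate l) \<in> M')"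

text \<open>By \<open>half\<close>, the other search has already processed as many nodes as the
  exhausted one visited. Checking (7 per node) is therefore paid for by whichever search is
  committed; with completion (19) and commitment (4) this is 30 per new node, within the 32 charged.
  That at least \<open>reg s t\<close> nodes are new pays for the preceding race.\<close>

lemma wp_decide:
  assumes g: "graph n \<phi> N T f D" and i: "invar n \<phi> N T f D (marked s)" and r: "ready inp n N T s"
    and ch: "channel mk q h t" and ch': "channel mk' q' h' t'"
    and dis: "{mk, q} \<inter> {mk', q'} = {}" "{h, t} \<inter> {h', t'} = {}"
    and s: "search mk q h t {node l} s" and halt: "reg s h = reg s t" and l: "lit_var l < n"
    and s': "search mk' q' h' t' {node (negate l)} s" and half: "reg s t \<le> reg s h'"
    and new: "node l \<notin> marked s" "node (negate l) \<notin> marked s"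
    and Q: "\<And>T' s'. T' + 32 * card (marked s) \<le> \<tau> + 10 + 32 * card (marked s') \<Longrightarrow>
      grown n \<phi> N T f D l (marked s) (marked s') \<Longrightarrow> reg s t + card (marked s) \<le> card (marked s') \<Longrightarrow>
      ready inp n N T s' \<Longrightarrow>
      frame {rI, rU, rV, rTmp, rOk, h', t'} {aMark, mk', q'} s s' \<Longrightarrow>
      (\<forall>v. arr s' mk' v \<le> reg s' rStamp) \<Longrightarrow> Q T' s'"
  shows "wp (decide mk q h t mk' q' h' t') \<tau> s Q"
proof -
  let ?L = "lits (marked s \<inter> base n)" and ?Z = "links (marked s \<inter> base n)"
  let ?V = "visited q t s"
  have ri: "reg s rOne = 1" "reg s rZero = 0" "tables n s" using r by (simp_all add: ready_def)
  have fin: "finite (marked s)" using i finite_subset by (auto simp: invar_def)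
  have m: "marking \<phi> ?L ?Z" and z0: "0 \<in> marked s" using i by (simp_all add: invar_def)
  have nl: "l \<notin> ?L" "negate l \<notin> ?L" using new by (simp_all add: lits_def)
  have qd: "queued (arr s mk) (reg s rStamp) (arr s q) (reg s t) ?V"
    and dj: "?V \<inter> marked s = {}" using s by (auto simp: search_def)
  have zV: "0 \<notin> ?V" using dj z0 by blast
  have card: "card ?V = reg s t" "finite ?V" using queued_card[OF qd] by auto
  note D = search_done[OF g i r s halt l]
  have grow: "grown n \<phi> N T f D l (marked s) (marked s \<union> V)"
    if "marking \<phi> (?L \<union> lits (V \<inter> base n)) ?Z" "links ((marked s \<union> V) \<inter> base n) = ?Z" "V \<subseteq> {1..<f}"
      "closed N T (marked s \<union> V - {0})" "node l \<in> V \<or> node (negate l) \<in> V" for V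
    using that i unfolding grown_def invar_def lits_Un by auto
  have le': "\<forall>v. arr s mk' v \<le> reg s rStamp" using s' by (simp add: search_def)
  have ne: "rStamp \<notin> {h', t'}" "mk' \<noteq> aMark" "h' \<notin> {rI, rU, rV, rTmp, rOk}" "t' \<notin> {rI, rU, rV, rTmp, rOk}"
    "rZero \<notin> {h', t'}" "rOne \<notin> {h', t'}" "rTwo \<notin> {h', t'}" "t \<notin> {rI, rU, rV, rTmp, rOk}"
    "mk' \<notin> {0..7}" "q' \<notin> {0..7}"
    using ch ch' by (auto simp: channel_def)
  show ?thesis
    unfolding decide_def wp_Seq
  proof (rule wp_check[OF ch ri(1,2) qd])
    fix T1 s1
    assume T1: "T1 \<le> \<tau> + 3 + 7 * reg s t"
      and ok: "reg s1 rOk = (if \<exists>u\<in>?V. arr s aNeg u \<in> ?V then 0 else 1)"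
      and f1: "frame {rI, rU, rV, rTmp, rOk} {} s s1"
    have r1: "ready inp n N T s1" by (rule ready_frame[OF r f1]) auto
    have same: "arr s1 = arr s" using f1 by (auto simp: frame_def)
    have reg1: "reg s1 v = reg s v" if "v \<notin> {rI, rU, rV, rTmp, rOk}" for v
      using f1 that by (simp add: frame_def)
    have vis1: "visited q t s1 = ?V" "marked s1 = marked s" "visited q' t' s1 = visited q' t' s"
      using same reg1[of t] reg1[of t'] ne by (simp_all add: visited_def marked_def)
    have one1: "reg s1 rOne = 1" "reg s1 rZero = 0" using r1 by (simp_all add: ready_def)
    show "wp (If (Equal rOk rOne) (commit q t)
        (Seq (While (Less h' t') (search_step mk' q' h' t')) (commit q' t'))) T1 s1 Q"
    proof (cases "\<exists>u\<in>?V. arr s aNeg u \<in> ?V")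
      case False
      then have cons: "\<forall>k\<in>lits (?V \<inter> base n). negate k \<notin> lits (?V \<inter> base n)"
        unfolding bad_iff[OF ri(3) zV] by blast
      have "wp (commit q t) (Suc T1) s1 Q"
      proof (rule wp_commit[OF ch one1])
        fix T2 s2
        assume T2: "T2 \<le> Suc T1 + 2 + 4 * reg s1 t" and m2: "marked s2 = marked s1 \<union> visited q t s1"
          and f2: "frame {rI, rU} {aMark} s1 s2"
        have m2': "marked s2 = marked s \<union> ?V" using m2 vis1 by simp
        have c2: "card (marked s2) = card (marked s) + reg s t"
          unfolding m2' using card fin dj by (simp add: card_Un_disjoint Int_commute)
        have gr: "grown n \<phi> N T f D l (marked s) (marked s2)"
          unfolding m2' by (rule grow[OF marking_consistent[OF m D(1) nl cons] D(2-4)])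
            (use s in \<open>simp add: search_def\<close>)
        show "Q T2 s2"
        proof (rule Q)
          have "1 \<le> reg s t" using card s by (cases "reg s t") (auto simp: search_def)
          then show "T2 + 32 * card (marked s) \<le> \<tau> + 10 + 32 * card (marked s2)"
            using T1 T2 c2 reg1[of t] ne by simp
          show "ready inp n N T s2" by (rule ready_frame[OF r1 f2]) auto
          show "frame {rI, rU, rV, rTmp, rOk, h', t'} {aMark, mk', q'} s s2"
            using f1 f2 by (auto simp: frame_def)
          show "\<forall>v. arr s2 mk' v \<le> reg s2 rStamp"
            using le' frame_arr[OF f2, of mk'] frame_reg[OF f2, of rStamp] reg1[of rStamp] same ne by simp
        qed (use c2 gr in auto)
      qed
      then show ?thesis using ok False one1 by simp
    next
      case True
      then obtain k where k: "k \<in> lits (?V \<inter> base n)" "negate k \<in> lits (?V \<inter> base n)"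
        unfolding bad_iff[OF ri(3) zV] by blast
      have s1: "search mk' q' h' t' {node (negate l)} s1"
        by (rule search_cong[OF s']) (use same reg1[of h'] reg1[of t'] reg1[of rStamp] ne in simp_all)
      have NT: "arr s1 aNext = N" "arr s1 aTarget = T" using r1 by (simp_all add: ready_def)
      have seed: "{node (negate l)} \<subseteq> {1..<f}"
      proof -
        have "node (negate l) \<in> base n" using l by simp
        then show ?thesis using graph_bounds(2)[OF g] by blast
      qed
      have "wp (While (Less h' t') (search_step mk' q' h' t')) (Suc T1) s1 (\<lambda>T' s'. wp (commit q' t') T' s' Q)"
      proof (rule wp_finish[OF ch' s1 one1(2) _ seed])
        show "0 \<in> marked s1" using z0 vis1 by simp
        show "closed (arr s1 aNext) (arr s1 aTarget) {1..<f}" using graph_bounds(3)[OF g] NT by simp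
        fix T2 s2
        assume T2: "T2 \<le> Suc (Suc T1) + 19 * (reg s2 t' - reg s1 h')"
          and s2: "search mk' q' h' t' {node (negate l)} s2" and halt2: "reg s2 h' = reg s2 t'"
          and le2: "reg s1 h' \<le> reg s2 h'"
          and f2: "frame {h', t', rU, rV, rTmp} {mk', q'} s1 s2"
        have r2: "ready inp n N T s2" by (rule ready_frame[OF r1 f2]) (use ne in auto)
        have m2: "marked s2 = marked s" using frame_arr[OF f2, of aMark] ne vis1 by (simp add: marked_def)
        have i2: "invar n \<phi> N T f D (marked s2)" using i m2 by simp
        let ?V2 = "visited q' t' s2"
        note D2 = search_done[OF g i2 r2 s2 halt2, unfolded m2 lit_var_negate, OF l]
        have dj2: "?V2 \<inter> marked s = {}" using s2 m2 by (simp add: search_def)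
        have q2: "queued (arr s2 mk') (reg s2 rStamp) (arr s2 q') (reg s2 t') ?V2"
          using s2 by (simp add: search_def)
        have card2: "card ?V2 = reg s2 t'" "finite ?V2" using queued_card[OF q2] by auto
        have one2: "reg s2 rOne = 1" "reg s2 rZero = 0" using r2 by (simp_all add: ready_def)
        show "wp (commit q' t') T2 s2 Q"
        proof (rule wp_commit[OF ch' one2])
          fix T3 s3
          assume T3: "T3 \<le> T2 + 2 + 4 * reg s2 t'" and m3: "marked s3 = marked s2 \<union> visited q' t' s2"
            and f3: "frame {rI, rU} {aMark} s2 s3"
          have m3': "marked s3 = marked s \<union> ?V2" using m2 m3 by simp
          have c3: "card (marked s3) = card (marked s) + reg s2 t'"
            unfolding m3' using card2 fin dj2 by (simp add: card_Un_disjoint Int_commute)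
          \<comment> \<open>The exhausted search has refuted \<open>l\<close>, so the literal to be
            added is \<open>negate l\<close> and the two literals change roles.\<close>
          have E: "least_extension \<phi> ?L (negate (negate l)) (lits (?V \<inter> base n))" using D(1) by simp
          have nl': "negate l \<notin> ?L" "negate (negate l) \<notin> ?L" using nl by simp_all
          have gr: "grown n \<phi> N T f D l (marked s) (marked s3)"
            unfolding m3' by (rule grow[OF marking_inconsistent[OF m D2(1) nl' E k] D2(2-4)])
              (use s2 in \<open>simp add: search_def\<close>)
          \<comment> \<open>The committed search is at least as large as the inconsistent one, so it
            can pay for the latter.\<close>
          have tt: "reg s t \<le> reg s2 t'" using half le2 halt2 reg1[of h'] ne by simp
          show "Q T3 s3"
          proof (rule Q)
            have "1 \<le> reg s2 t'" using card2 s2 by (cases "reg s2 t'") (auto simp: search_def)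
            then show "T3 + 32 * card (marked s) \<le> \<tau> + 10 + 32 * card (marked s3)"
              using T1 T2 T3 c3 tt by simp
            show "ready inp n N T s3" by (rule ready_frame[OF r2 f3]) auto
            show "frame {rI, rU, rV, rTmp, rOk, h', t'} {aMark, mk', q'} s s3"
              using f1 f2 f3 by (auto simp: frame_def)
            show "\<forall>v. arr s3 mk' v \<le> reg s3 rStamp"
              using s2 frame_arr[OF f3, of mk'] frame_reg[OF f3, of rStamp] ne by (simp add: search_def)
          qed (use c3 gr tt in auto)
        qed
      qed
      then show ?thesis using ok True one1 by simp
    qed
  qed
qed

section \<open>Racing the searches from a literal and its complement\<close>

abbreviation (input) "stepA \<equiv> search_step aSeenA aQueueA rHA rTA"
abbreviation (input) "stepB \<equiv> search_step aSeenB aQueueB rHB rTB"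
abbreviation (input) "searchA \<equiv> search aSeenA aQueueA rHA rTA"
abbreviation (input) "searchB \<equiv> search aSeenB aQueueB rHB rTB"

lemma channels: "channel aSeenA aQueueA rHA rTA" "channel aSeenB aQueueB rHB rTB"
  by (simp_all add: channel_def)

text \<open>The strict inequality results from incrementing \<open>rStamp\<close>: no cell carries
  the new stamp, so the search starts with nothing visited.\<close>

lemma search_start:
  assumes ch: "channel mk q h t" and v: "v \<notin> {20..<24}" "v \<noteq> rTmp" and z: "reg s rZero = 0"
    and le: "\<forall>w. arr s mk w < reg s rStamp" and ht: "reg s h = 0" "reg s t = 0"
    and new: "reg s v \<notin> marked s"
  obtains u s' where "exec (push mk q t v) s u s'" "u \<le> 7" "search mk q h t {reg s v} s'"
    "reg s' h < reg s' t" "frame {t, rTmp} {mk, q} s s'"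
proof -
  have vis: "visited q t s = {}" using ht by (simp add: visited_def)
  have "arr s mk w \<noteq> reg s rStamp" for w
    using le by (metis less_irrefl)
  then have "queued (arr s mk) (reg s rStamp) (arr s q) (reg s t) (visited q t s)"
    unfolding vis queued_def using ht by simp
  moreover have "\<forall>w. arr s mk w \<le> reg s rStamp" using le by (simp add: less_imp_le)
  ultimately obtain u s' where 1: "exec (push mk q t v) s u s'" "u \<le> 7"
    "queued (arr s' mk) (reg s' rStamp) (arr s' q) (reg s' t) (visited q t s')"
    "\<forall>v. arr s' mk v \<le> reg s' rStamp"
    "visited q t s' = visited q t s \<union> ({reg s v} - marked s)"
    using push_visited[OF ch v _ z] by metis
  have f: "frame {t, rTmp} {mk, q} s s'"
    using exec_frame[OF 1(1)] by (simp add: push_def skip_def insert_commute)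
  have ne: "h \<noteq> t" "h \<noteq> rTmp" "mk \<noteq> aMark" "q \<noteq> aMark" using ch by (auto simp: channel_def)
  have h: "reg s' h = 0" and m: "marked s' = marked s"
    using frame_reg[OF f, of h] frame_arr[OF f, of aMark] ne ht by (auto simp: marked_def)
  have v': "visited q t s' = {reg s v}" using 1(5) vis new by auto
  have "reg s' t = 1" using queued_card[OF 1(3)] v' by simp
  then have "search mk q h t {reg s v} s'" "reg s' h < reg s' t"
    using 1 h m new v' by (simp_all add: search_def)
  then show ?thesis using that 1 f by blast
qed

text \<open>A loop test is a single comparison; \<open>rGo\<close> holds the conjunction of the two
  conditions for continuing.\<close>

definition both_steps :: prog where
  "both_steps = stepA ;; stepB ;;
     If (Less rHA rTA) (If (Less rHB rTB) skip (Copy rGo rZero)) (Copy rGo rZero)"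

definition round :: prog where
  "round = Inc rStamp ;; Copy rHA rZero ;; Copy rTA rZero ;; Copy rHB rZero ;; Copy rTB rZero ;;
     push aSeenA aQueueA rTA rL ;; push aSeenB aQueueB rTB rNl ;; Copy rGo rOne ;;
     While (Equal rGo rOne) both_steps ;;
     If (Less rHA rTA) (decide aSeenB aQueueB rHB rTB aSeenA aQueueA rHA rTA)
       (decide aSeenA aQueueA rHA rTA aSeenB aQueueB rHB rTB)"

text \<open>Equal heads express the lockstep: both searches have processed the same number of
  nodes.\<close>

definition racing :: "(nat \<Rightarrow> nat) \<Rightarrow> nat \<Rightarrow> (nat \<Rightarrow> nat) \<Rightarrow> (nat \<Rightarrow> nat) \<Rightarrow> lit \<Rightarrow> nat set \<Rightarrow> state \<Rightarrow> bool" where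
  "racing inp n N T l M s \<longleftrightarrow> ready inp n N T s \<and> marked s = M \<and>
     searchA {node l} s \<and> searchB {node (negate l)} s \<and> reg s rHA = reg s rHB"

lemma both_steps_exec:
  assumes r: "racing inp n N T l M s" and z0: "0 \<in> M" and lt: "reg s rHA < reg s rTA" "reg s rHB < reg s rTB"
    and go: "reg s rGo = 1"
  obtains u s' where "exec both_steps s u s'" "u \<le> 39" "racing inp n N T l M s'"
    "reg s' rHA = Suc (reg s rHA)" "reg s' rGo = 1 \<longleftrightarrow> reg s' rHA < reg s' rTA \<and> reg s' rHB < reg s' rTB"
proof -
  have rr: "ready inp n N T s" "marked s = M" "searchA {node l} s" "searchB {node (negate l)} s"
    "reg s rHA = reg s rHB" using r by (simp_all add: racing_def)
  have z: "reg s rZero = 0" using rr(1) by (simp add: ready_def)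
  obtain u1 s1 where 1: "exec stepA s u1 s1" "u1 \<le> 18" "searchA {node l} s1"
    "reg s1 rHA = Suc (reg s rHA)" "frame {rHA, rTA, rU, rV, rTmp} {aSeenA, aQueueA} s s1"
    using search_step_exec[OF channels(1) rr(3) z _ lt(1)] z0 rr(2) by blast
  have r1: "ready inp n N T s1" by (rule ready_frame[OF rr(1) 1(5)]) auto
  have m1: "marked s1 = M" using frame_arr[OF 1(5), of aMark] rr(2) by (simp add: marked_def)
  have reg1: "reg s1 rHB = reg s rHB" "reg s1 rTB = reg s rTB" "reg s1 rStamp = reg s rStamp" "reg s1 rGo = 1"
    using frame_reg[OF 1(5)] go by simp_all
  have b1: "searchB {node (negate l)} s1"
    by (rule search_cong[OF rr(4)]) (use frame_arr[OF 1(5)] reg1 in simp_all)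
  have z1: "reg s1 rZero = 0" using r1 by (simp add: ready_def)
  obtain u2 s2 where 2: "exec stepB s1 u2 s2" "u2 \<le> 18" "searchB {node (negate l)} s2"
    "reg s2 rHB = Suc (reg s1 rHB)" "frame {rHB, rTB, rU, rV, rTmp} {aSeenB, aQueueB} s1 s2"
    using search_step_exec[OF channels(2) b1 z1] z0 m1 lt(2) reg1 by auto
  have r2: "ready inp n N T s2" by (rule ready_frame[OF r1 2(5)]) auto
  have m2: "marked s2 = M" using frame_arr[OF 2(5), of aMark] m1 by (simp add: marked_def)
  have reg2: "reg s2 rHA = reg s1 rHA" "reg s2 rTA = reg s1 rTA" "reg s2 rStamp = reg s1 rStamp" "reg s2 rGo = 1"
    using frame_reg[OF 2(5)] reg1 by simp_all
  have a2: "searchA {node l} s2"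
    by (rule search_cong[OF 1(3)]) (use frame_arr[OF 2(5)] reg2 in simp_all)
  have z2: "reg s2 rZero = 0" using r2 by (simp add: ready_def)
  have rac: "racing inp n N T l M s2"
    using r2 m2 a2 2(3,4) 1(4) rr(5) reg1 reg2 by (simp add: racing_def)
  have set_go: "racing inp n N T l M (set_reg rGo v s2)" for v
    using rac by (auto simp: racing_def ready_def tables_def intro: search_cong)
  have "wp both_steps 0 s (\<lambda>T' s'. T' \<le> 39 \<and> racing inp n N T l M s' \<and>
    reg s' rHA = Suc (reg s rHA) \<and> (reg s' rGo = 1 \<longleftrightarrow> reg s' rHA < reg s' rTA \<and> reg s' rHB < reg s' rTB))"
    using 1(2,4) 2(2) rac set_go reg2 z2
    by (simp add: both_steps_def wp_exec[OF 1(1)] wp_exec[OF 2(1)])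
  then obtain u s' where *: "exec both_steps s u s'" "0 + u \<le> 39 \<and> racing inp n N T l M s' \<and>
    reg s' rHA = Suc (reg s rHA) \<and> (reg s' rGo = 1 \<longleftrightarrow> reg s' rHA < reg s' rTA \<and> reg s' rHB < reg s' rTB)"
    unfolding wp_def by blast
  show ?thesis by (rule that[OF *(1)]) (use *(2) in simp_all)
qed

text \<open>The charge 72 is 40 + 32. A lockstep iteration costs at most 39 + 1, and the number of
  iterations is the common head, which equals the tail of the exhausted search and hence is at most
  the number of newly marked nodes; 32 is the charge of \<open>wp_decide\<close>.\<close>

lemma wp_round:
  assumes g: "graph n \<phi> N T f D" and i: "invar n \<phi> N T f D (marked s)" and r: "ready inp n N T s"
    and l: "reg s rL = node l" "reg s rNl = node (negate l)" "lit_var l < n"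
    and new: "node l \<notin> marked s" "node (negate l) \<notin> marked s"
    and le: "\<forall>v. arr s aSeenA v \<le> reg s rStamp" "\<forall>v. arr s aSeenB v \<le> reg s rStamp"
    and Q: "\<And>T' s'. T' + 72 * card (marked s) \<le> \<tau> + 35 + 72 * card (marked s') \<Longrightarrow>
      grown n \<phi> N T f D l (marked s) (marked s') \<Longrightarrow> ready inp n N T s' \<Longrightarrow>
      \<forall>v. arr s' aSeenA v \<le> reg s' rStamp \<Longrightarrow> \<forall>v. arr s' aSeenB v \<le> reg s' rStamp \<Longrightarrow> Q T' s'"
  shows "wp round \<tau> s Q"
proof -
  let ?M = "marked s"
  let ?s1 = "set_reg rTB 0 (set_reg rHB 0 (set_reg rTA 0 (set_reg rHA 0 (set_reg rStamp (Suc (reg s rStamp)) s))))"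
  have z: "reg s rZero = 0" "reg s rOne = 1" using r by (simp_all add: ready_def)
  have z0: "0 \<in> ?M" using i by (simp add: invar_def)
  have r1: "ready inp n N T ?s1" using r by (simp add: ready_def tables_def)
  obtain u2 s2 where 2: "exec (push aSeenA aQueueA rTA rL) ?s1 u2 s2" "u2 \<le> 7" "searchA {node l} s2"
    "reg s2 rHA < reg s2 rTA" "frame {rTA, rTmp} {aSeenA, aQueueA} ?s1 s2"
    using search_start[OF channels(1), of rL ?s1] z le(1) l(1) new(1) by (auto simp: le_imp_less_Suc)
  have r2: "ready inp n N T s2" by (rule ready_frame[OF r1 2(5)]) auto
  have reg2: "reg s2 v = reg ?s1 v" if "v \<noteq> rTA" "v \<noteq> rTmp" for v
    using frame_reg[OF 2(5)] that by simp
  have arr2: "arr s2 v = arr s v" if "v \<noteq> aSeenA" "v \<noteq> aQueueA" for v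
    using frame_arr[OF 2(5)] that by simp
  have m2: "marked s2 = ?M" by (simp add: marked_def arr2)
  obtain u3 s3 where 3: "exec (push aSeenB aQueueB rTB rNl) s2 u3 s3" "u3 \<le> 7" "searchB {node (negate l)} s3"
    "reg s3 rHB < reg s3 rTB" "frame {rTB, rTmp} {aSeenB, aQueueB} s2 s3"
    using search_start[OF channels(2), of rNl s2] z le(2) l(2) new(2) m2 by (auto simp: le_imp_less_Suc reg2 arr2)
  have r3: "ready inp n N T s3" by (rule ready_frame[OF r2 3(5)]) auto
  have reg3: "reg s3 v = reg s2 v" if "v \<noteq> rTB" "v \<noteq> rTmp" for v
    using frame_reg[OF 3(5)] that by simp
  have arr3: "arr s3 v = arr s2 v" if "v \<noteq> aSeenB" "v \<noteq> aQueueB" for v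
    using frame_arr[OF 3(5)] that by simp
  have m3: "marked s3 = ?M" using m2 by (simp add: marked_def arr3)
  let ?s4 = "set_reg rGo 1 s3"
  have a3: "searchA {node l} s3"
    by (rule search_cong[OF 2(3)]) (simp_all add: reg3 arr3)
  have "reg s3 rHA = reg s3 rHB" by (simp add: reg3 reg2)
  then have rac: "racing inp n N T l ?M ?s4"
    using r3 m3 a3 3(3) by (auto simp: racing_def ready_def tables_def intro: search_cong)
  have lt4: "reg ?s4 rHA < reg ?s4 rTA \<and> reg ?s4 rHB < reg ?s4 rTB"
    using 2(4) 3(4) by (simp add: reg3)
  let ?I = "\<lambda>T' s'. T' \<le> \<tau> + 20 + 40 * reg s' rHA \<and> racing inp n N T l ?M s' \<and>
     (reg s' rGo = 1 \<longleftrightarrow> reg s' rHA < reg s' rTA \<and> reg s' rHB < reg s' rTB)"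
  have seeds: "{node l} \<subseteq> {1..<f}" "{node (negate l)} \<subseteq> {1..<f}"
  proof -
    have "node l \<in> base n" "node (negate l) \<in> base n" using l(3) by simp_all
    then show "{node l} \<subseteq> {1..<f}" "{node (negate l)} \<subseteq> {1..<f}" using graph_bounds(2)[OF g] by blast+
  qed
  have loop: "wp (While (Equal rGo rOne) both_steps) (\<tau> + 6 + u2 + u3) ?s4 (\<lambda>T' s'.
     wp (If (Less rHA rTA) (decide aSeenB aQueueB rHB rTB aSeenA aQueueA rHA rTA)
       (decide aSeenA aQueueA rHA rTA aSeenB aQueueB rHB rTB)) T' s' Q)"
  proof (rule wp_While[where I = ?I and B = "\<tau> + 20 + 40 * f"])
    show "?I (\<tau> + 6 + u2 + u3) ?s4" using rac lt4 2(2) 3(2) by simp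
  next
    fix T' s' assume I: "?I T' s'"
    have s: "searchA {node l} s'" "ready inp n N T s'" using I by (auto simp: racing_def)
    have "reg s' rTA \<le> f"
      by (rule search_bound[OF s(1) seeds(1)]) (use graph_bounds(3)[OF g] s(2) in \<open>simp add: ready_def\<close>)
    moreover have "reg s' rHA \<le> reg s' rTA" using s(1) by (simp add: search_def)
    ultimately show "T' \<le> \<tau> + 20 + 40 * f" using I by linarith
  next
    fix T' s' assume I: "?I T' s'" and b: "holds (Equal rGo rOne) s'"
    have one: "reg s' rOne = 1" using I by (simp add: racing_def ready_def)
    obtain u s5 where 5: "exec both_steps s' u s5" "u \<le> 39" "racing inp n N T l ?M s5"
      "reg s5 rHA = Suc (reg s' rHA)" "reg s5 rGo = 1 \<longleftrightarrow> reg s5 rHA < reg s5 rTA \<and> reg s5 rHB < reg s5 rTB"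
      using both_steps_exec[of inp n N T l ?M s'] I b one z0 by auto
    then show "wp both_steps (Suc T') s' ?I" using I by (simp add: wp_exec[OF 5(1)])
  next
    fix T' s' assume I: "?I T' s'" and b: "\<not> holds (Equal rGo rOne) s'"
    have s': "ready inp n N T s'" "marked s' = ?M" "searchA {node l} s'" "searchB {node (negate l)} s'"
      "reg s' rHA = reg s' rHB" using I by (simp_all add: racing_def)
    have one: "reg s' rOne = 1" using s'(1) by (simp add: ready_def)
    have i': "invar n \<phi> N T f D (marked s')" using i s'(2) by simp
    have ht: "reg s' rHA \<le> reg s' rTA" "reg s' rHB \<le> reg s' rTB"
      and leA: "\<forall>v. arr s' aSeenA v \<le> reg s' rStamp" and leB: "\<forall>v. arr s' aSeenB v \<le> reg s' rStamp"
      using s'(3,4) by (simp_all add: search_def)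
    have stop: "\<not> (reg s' rHA < reg s' rTA \<and> reg s' rHB < reg s' rTB)" using I b one by simp
    show "wp (If (Less rHA rTA) (decide aSeenB aQueueB rHB rTB aSeenA aQueueA rHA rTA)
       (decide aSeenA aQueueA rHA rTA aSeenB aQueueB rHB rTB)) (Suc T') s' Q"
    proof (cases "reg s' rHA < reg s' rTA")
      case True
      then have eq: "reg s' rHB = reg s' rTB" using stop ht by simp
      have "wp (decide aSeenB aQueueB rHB rTB aSeenA aQueueA rHA rTA) (Suc (Suc T')) s' Q"
      proof (rule wp_decide[OF g i' s'(1) channels(2,1) _ _ s'(4) eq])
        fix T6 s6
        assume 6: "T6 + 32 * card (marked s') \<le> Suc (Suc T') + 10 + 32 * card (marked s6)"
          "grown n \<phi> N T f D (negate l) (marked s') (marked s6)"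
          "reg s' rTB + card (marked s') \<le> card (marked s6)" "ready inp n N T s6"
          "frame {rI, rU, rV, rTmp, rOk, rHA, rTA} {aMark, aSeenA, aQueueA} s' s6"
          "\<forall>v. arr s6 aSeenA v \<le> reg s6 rStamp"
        show "Q T6 s6"
        proof (rule Q)
          show "T6 + 72 * card ?M \<le> \<tau> + 35 + 72 * card (marked s6)"
            using 6(1,3) I s'(2,5) eq by simp
          show "grown n \<phi> N T f D l ?M (marked s6)" using 6(2) s'(2) by (auto simp: grown_def)
          show "\<forall>v. arr s6 aSeenB v \<le> reg s6 rStamp"
            using leB frame_arr[OF 6(5), of aSeenB] frame_reg[OF 6(5), of rStamp] by simp
        qed (use 6 in auto)
      qed (use l(3) s' new eq in auto)
      then show ?thesis using True by simp
    next
      case False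
      then have eq: "reg s' rHA = reg s' rTA" using ht by simp
      have "wp (decide aSeenA aQueueA rHA rTA aSeenB aQueueB rHB rTB) (Suc (Suc T')) s' Q"
      proof (rule wp_decide[OF g i' s'(1) channels(1,2) _ _ s'(3) eq])
        fix T6 s6
        assume 6: "T6 + 32 * card (marked s') \<le> Suc (Suc T') + 10 + 32 * card (marked s6)"
          "grown n \<phi> N T f D l (marked s') (marked s6)"
          "reg s' rTA + card (marked s') \<le> card (marked s6)" "ready inp n N T s6"
          "frame {rI, rU, rV, rTmp, rOk, rHB, rTB} {aMark, aSeenB, aQueueB} s' s6"
          "\<forall>v. arr s6 aSeenB v \<le> reg s6 rStamp"
        show "Q T6 s6"
        proof (rule Q)
          show "T6 + 72 * card ?M \<le> \<tau> + 35 + 72 * card (marked s6)"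
            using 6(1,3) I s'(2) eq by simp
          show "grown n \<phi> N T f D l ?M (marked s6)" using 6(2) s'(2) by simp
          show "\<forall>v. arr s6 aSeenA v \<le> reg s6 rStamp"
            using leA frame_arr[OF 6(5), of aSeenA] frame_reg[OF 6(5), of rStamp] by simp
        qed (use 6 in auto)
      qed (use l(3) s' new eq in auto)
      then show ?thesis using False by simp
    qed
  qed
  have "reg s3 rOne = 1" using r3 by (simp add: ready_def)
  then show ?thesis
    using loop z by (simp add: round_def wp_exec[OF 2(1)] wp_exec[OF 3(1)] plus_numeral_Suc)
qed

text \<open>\<open>rL\<close> runs through the nodes of the positive literals, which lie three
  apart. A variable already marked with some sign is skipped; its sign is settled or it is excluded
  from V0.\<close>

definition rounds :: prog where
  "rounds = Copy rK rN ;; Copy rL rOne ;;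
     While (Less rZero rK)
       (Read rNl aNeg rL ;; Read rC aMark rL ;; Read rU aMark rNl ;;
        If (Equal rC rZero) (If (Equal rU rZero) round skip) skip ;;
        Inc rL ;; Inc rL ;; Inc rL ;; Dec rK)"

lemma frame_round: "{rK, rL, rN, rM, rFail, rSome} \<inter> wregs round = {}"
  by (simp add: round_def both_steps_def decide_def search_step_def push_def skip_def check_def commit_def)

text \<open>An amortized bound with potential 72 times the number of marked nodes. Marks are never
  removed and there are at most \<open>f\<close> of them, so all rounds together cost at most 72 per
  node plus a constant per variable.\<close>

lemma wp_rounds:
  assumes g: "graph n \<phi> N T f D" and i: "invar n \<phi> N T f D (marked s)" and r: "ready inp n N T s"
    and n: "reg s rN = n"
    and le: "\<forall>v. arr s aSeenA v \<le> reg s rStamp" "\<forall>v. arr s aSeenB v \<le> reg s rStamp"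
    and Q: "\<And>T' s'. T' \<le> \<tau> + 3 + 50 * n + 72 * f \<Longrightarrow> invar n \<phi> N T f D (marked s') \<Longrightarrow>
      (\<forall>x<n. node (Pos x) \<in> marked s' \<or> node (Neg x) \<in> marked s') \<Longrightarrow> ready inp n N T s' \<Longrightarrow> Q T' s'"
  shows "wp rounds \<tau> s Q"
proof -
  let ?s = "set_reg rL 1 (set_reg rK n s)"
  let ?body = "Read rNl aNeg rL ;; Read rC aMark rL ;; Read rU aMark rNl ;;
        If (Equal rC rZero) (If (Equal rU rZero) round skip) skip ;;
        Inc rL ;; Inc rL ;; Inc rL ;; Dec rK"
  let ?P = "\<lambda>ys T' s'. T' + 72 * card (marked s) \<le> \<tau> + 2 + 50 * length ys + 72 * card (marked s') \<and>
     invar n \<phi> N T f D (marked s') \<and> ready inp n N T s' \<and>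
     (\<forall>v. arr s' aSeenA v \<le> reg s' rStamp) \<and> (\<forall>v. arr s' aSeenB v \<le> reg s' rStamp) \<and>
     reg s' rL = Suc (3 * length ys) \<and>
     (\<forall>x<length ys. node (Pos x) \<in> marked s' \<or> node (Neg x) \<in> marked s')"
  have "wp (While (Less rZero rK) ?body) (Suc (Suc \<tau>)) ?s Q"
  proof (rule wp_for[where xs = "[0..<n]" and P = ?P])
    have "ready inp n N T ?s" using r by (simp add: ready_def tables_def)
    then show "?P [] (Suc (Suc \<tau>)) ?s" using i le by simp
    show "reg ?s rZero = 0" using r by (simp add: ready_def)
  next
    fix T' s' assume P: "?P [0..<n] T' s'"
    have "card (marked s') \<le> f"
      using P card_mono[of "{..<f}" "marked s'"] by (simp add: invar_def)
    then show "Q (Suc T') s'" using P by (intro Q) auto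
  next
    fix ys x zs T' s'
    assume eq: "[0..<n] = ys @ x # zs" and P: "?P ys T' s'" and k: "reg s' rK = Suc (length zs)"
    have len: "length ys + Suc (length zs) = n" using arg_cong[OF eq, of length] by simp
    have x: "x = length ys" using arg_cong[OF eq, of "\<lambda>xs. xs ! length ys"] len by (simp add: nth_append)
    have xn: "x < n" using len x by simp
    have rL: "reg s' rL = node (Pos x)" using P x by simp
    have rs': "ready inp n N T s'" "invar n \<phi> N T f D (marked s')" using P by auto
    have tab: "arr s' aNeg (node (Pos x)) = node (Neg x)"
      using tables_neg[of n s' "Pos x"] rs'(1) xn by (simp add: ready_def)
    let ?s1 = "set_reg rU (arr s' aMark (node (Neg x))) (set_reg rC (arr s' aMark (node (Pos x)))
      (set_reg rNl (node (Neg x)) s'))"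
    have r1: "ready inp n N T ?s1" using rs'(1) by (simp add: ready_def tables_def)
    have z: "reg s' rZero = 0" using rs'(1) by (simp add: ready_def)
    define Post where "Post T' s' \<longleftrightarrow> ?P (ys @ [x]) T' s' \<and> reg s' rZero = 0 \<and> reg s' rK = length zs" for T' s'
    have fin: "Post (Suc (Suc (Suc (Suc T2)))) (set_reg rK (length zs) (set_reg rL (Suc (Suc (Suc (reg s2 rL)))) s2))"
      if *: "T2 + 72 * card (marked s') \<le> T' + 45 + 72 * card (marked s2)" "invar n \<phi> N T f D (marked s2)"
        "ready inp n N T s2" "\<forall>v. arr s2 aSeenA v \<le> reg s2 rStamp" "\<forall>v. arr s2 aSeenB v \<le> reg s2 rStamp"
        "reg s2 rL = reg s' rL" "marked s' \<subseteq> marked s2"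
        "node (Pos x) \<in> marked s2 \<or> node (Neg x) \<in> marked s2" for T2 s2
    proof -
      have "ready inp n N T (set_reg rK (length zs) (set_reg rL (Suc (Suc (Suc (reg s2 rL)))) s2))"
        using *(3) by (simp add: ready_def tables_def)
      moreover have "\<forall>y<length (ys @ [x]). node (Pos y) \<in> marked s2 \<or> node (Neg y) \<in> marked s2"
        using P * x by (auto simp: less_Suc_eq)
      ultimately show ?thesis using * P by (simp add: ready_def Post_def)
    qed
    have "wp ?body (Suc T') s' Post"
    proof (cases "node (Pos x) \<in> marked s' \<or> node (Neg x) \<in> marked s'")
      case True
      have A: "Post (Suc (Suc (Suc (Suc T2)))) (set_reg rK (length zs) (set_reg rL (Suc (Suc (Suc (reg ?s1 rL)))) ?s1))"
        if "T2 \<le> T' + 45" for T2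
        by (rule fin) (use that P r1 True in auto)
      consider "arr s' aMark (node (Pos x)) \<noteq> 0" | "arr s' aMark (node (Pos x)) = 0" "arr s' aMark (node (Neg x)) \<noteq> 0"
        using True by (auto simp: marked_def)
      then show ?thesis
      proof cases
        case 1
        then show ?thesis using A[of "T' + 6"] rL tab z k
          by (simp add: plus_numeral_Suc del: node.simps)
      next
        case 2
        then show ?thesis using A[of "T' + 7"] rL tab z k
          by (simp add: plus_numeral_Suc del: node.simps)
      qed
    next
      case False
      have "wp round (T' + 6) ?s1 (\<lambda>T' s'. wp (Inc rL ;; Inc rL ;; Inc rL ;; Dec rK) T' s' Post)"
      proof (rule wp_frame, rule wp_round[OF g _ r1, of "Pos x"])
        fix T2 s2
        assume 2: "T2 + 72 * card (marked ?s1) \<le> T' + 6 + 35 + 72 * card (marked s2)"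
          "grown n \<phi> N T f D (Pos x) (marked ?s1) (marked s2)" "ready inp n N T s2"
          "\<forall>v. arr s2 aSeenA v \<le> reg s2 rStamp" "\<forall>v. arr s2 aSeenB v \<le> reg s2 rStamp"
        show "frame (wregs round) (warrs round) ?s1 s2 \<longrightarrow> wp (Inc rL ;; Inc rL ;; Inc rL ;; Dec rK) T2 s2 Post"
        proof
          assume f2: "frame (wregs round) (warrs round) ?s1 s2"
          have regs: "reg s2 rL = reg s' rL" "reg s2 rK = reg s' rK"
            using frame_reg[OF f2, of rL] frame_reg[OF f2, of rK] frame_round by auto
          have "Post (Suc (Suc (Suc (Suc T2)))) (set_reg rK (length zs) (set_reg rL (Suc (Suc (Suc (reg s2 rL)))) s2))"
            by (rule fin) (use 2 regs in \<open>auto simp: grown_def\<close>)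
          then show "wp (Inc rL ;; Inc rL ;; Inc rL ;; Dec rK) T2 s2 Post"
            using regs k by simp
        qed
      qed (use False P rs' rL xn in \<open>auto simp del: node.simps\<close>)
      then show ?thesis using False rL tab z
        by (simp add: plus_numeral_Suc marked_def del: node.simps)
    qed
    then show "wp ?body (Suc T') s' (\<lambda>T' s'. ?P (ys @ [x]) T' s' \<and> reg s' rZero = 0 \<and> reg s' rK = length zs)"
      unfolding Post_def .
  qed (use n in auto)
  then show ?thesis using r n by (simp add: rounds_def ready_def)
qed

section \<open>Checking the clauses and writing the output\<close>

definition check_lit :: prog where
  "check_lit = read_lit ;; Read rW aLink rL ;; Read rC aMark rL ;; Read rU aMark rNl ;;
     If (Equal rC rZero) skip (If (Equal rU rZero) skip
       (Inc rCnt ;; Read rV aMark rW ;; If (Equal rV rZero) skip (Copy rHit rOne))) ;;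
     Dec rK"

text \<open>Evaluates \<open>clause_ok\<close> from the number of doubly marked literals and one
  flag for a hit in Z. \<open>rFail\<close> is only ever set, so it accumulates the conjunction over
  all clauses. Of a xor part only the length matters here; its literals are passed over.\<close>

definition check_clause :: prog where
  "check_clause =
     Read rK aIn rPos ;; Inc rPos ;; Copy rCnt rZero ;; Copy rHit rZero ;;
     While (Less rZero rK) check_lit ;;
     Read rK aIn rPos ;; Inc rPos ;;
     If (Equal rK rZero)
       (If (Less rTwo rCnt) (Copy rFail rOne)
         (If (Equal rCnt rTwo) (If (Equal rHit rOne) (Copy rFail rOne) skip) skip))
       (If (Equal rCnt rZero) skip (Copy rFail rOne)) ;;
     While (Less rZero rK) (Inc rPos ;; Dec rK) ;;
     Dec rM"

lemma tables_set_reg [simp]: "tables n (set_reg r v s) \<longleftrightarrow> tables n s"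
  by (simp add: tables_def)

lemma tables_set_out [simp]: "tables n (set_arr (Suc 0) i v s) \<longleftrightarrow> tables n s"
  by (simp add: tables_def)

lemma ready_set_reg [simp]:
  "r \<notin> {rZero, rOne, rTwo} \<Longrightarrow> ready inp n N T (set_reg r v s) \<longleftrightarrow> ready inp n N T s"
  by (auto simp: ready_def tables_def)

lemma wp_check_lits:
  assumes r: "ready inp n N T s" and k: "reg s rK = length ds"
    and pos: "\<forall>i<length ds. inp (reg s rPos + i) = encode_lit (ds ! i)"
    and ds: "\<forall>l\<in>set ds. lit_var l < n" and cnt: "reg s rCnt = 0" "reg s rHit = 0"
  defines "L \<equiv> lits (marked s \<inter> base n)" and "Z \<equiv> links (marked s \<inter> base n)"
  defines "both \<equiv> \<lambda>l. lit_var l \<in> doubly L"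
  assumes Q: "\<And>T' s'. T' \<le> Suc \<tau> + 15 * length ds \<Longrightarrow> ready inp n N T s' \<Longrightarrow> marked s' = marked s \<Longrightarrow>
      reg s' rPos = reg s rPos + length ds \<Longrightarrow> reg s' rCnt = length (filter both ds) \<Longrightarrow>
      reg s' rHit = (if \<exists>l\<in>set ds. both l \<and> lit_var l \<in> Z then 1 else 0) \<Longrightarrow>
      reg s' rM = reg s rM \<Longrightarrow> reg s' rFail = reg s rFail \<Longrightarrow> Q T' s'"
  shows "wp (While (Less rZero rK) check_lit) \<tau> s Q"
proof (rule wp_for[where xs = ds and P = "\<lambda>ys T' s'. T' \<le> \<tau> + 15 * length ys \<and> ready inp n N T s' \<and>
    marked s' = marked s \<and> reg s' rPos = reg s rPos + length ys \<and> reg s' rCnt = length (filter both ys) \<and>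
    reg s' rHit = (if \<exists>l\<in>set ys. both l \<and> lit_var l \<in> Z then 1 else 0) \<and>
    reg s' rM = reg s rM \<and> reg s' rFail = reg s rFail"])
  fix ys l zs T' s'
  assume eq: "ds = ys @ l # zs" and P: "T' \<le> \<tau> + 15 * length ys \<and> ready inp n N T s' \<and>
    marked s' = marked s \<and> reg s' rPos = reg s rPos + length ys \<and> reg s' rCnt = length (filter both ys) \<and>
    reg s' rHit = (if \<exists>l\<in>set ys. both l \<and> lit_var l \<in> Z then 1 else 0) \<and>
    reg s' rM = reg s rM \<and> reg s' rFail = reg s rFail"
    and k: "reg s' rK = Suc (length zs)"
  define Post where "Post T' s' \<longleftrightarrow> (T' \<le> \<tau> + 15 * length (ys @ [l]) \<and> ready inp n N T s' \<and>
    marked s' = marked s \<and> reg s' rPos = reg s rPos + length (ys @ [l]) \<and>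
    reg s' rCnt = length (filter both (ys @ [l])) \<and>
    reg s' rHit = (if \<exists>l\<in>set (ys @ [l]). both l \<and> lit_var l \<in> Z then 1 else 0) \<and>
    reg s' rM = reg s rM \<and> reg s' rFail = reg s rFail) \<and> reg s' rZero = 0 \<and> reg s' rK = length zs" for T' s'
  have l: "lit_var l < n" using ds eq by simp
  have r': "ready inp n N T s'" using P by blast
  have z: "reg s' rZero = 0" "reg s' rOne = 1" using r' by (simp_all add: ready_def)
  have v: "arr s' aIn (reg s' rPos) = encode_lit l" "arr s' aNode (encode_lit l) = node l"
    "arr s' aNeg (node l) = node (negate l)" "arr s' aLink (node l) = link (lit_var l)"
    using r' P l pos[rule_format, of "length ys"] by (simp_all add: ready_def tables_def eq)
  have m: "arr s' aMark (node l) \<noteq> 0 \<longleftrightarrow> l \<in> L" "arr s' aMark (node (negate l)) \<noteq> 0 \<longleftrightarrow> negate l \<in> L"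
    "arr s' aMark (link (lit_var l)) \<noteq> 0 \<longleftrightarrow> lit_var l \<in> Z"
    using l P by (auto simp: L_def Z_def lits_def links_def marked_def)
  let ?s1 = "set_reg rU (arr s' aMark (node (negate l))) (set_reg rC (arr s' aMark (node l))
    (set_reg rW (link (lit_var l)) (set_reg rNl (node (negate l)) (set_reg rL (node l)
    (set_reg rPos (Suc (reg s' rPos)) (set_reg rC (encode_lit l) s'))))))"
  have "wp check_lit (Suc T') s' Post"
  proof (cases "both l")
    case False
    have fin: "Post T2 (set_reg rK (length zs) ?s1)" if "T2 \<le> T' + 15" for T2
      using False P that by (auto simp: Post_def ready_def)
    have "arr s' aMark (node l) = 0 \<or> arr s' aMark (node (negate l)) = 0"
      using False m by (auto simp: both_def doubly_lit_var)
    then show ?thesis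
      using z k fin[of "T' + 11"] fin[of "T' + 12"] by (auto simp: check_lit_def read_lit_def v plus_numeral_Suc)
  next
    case True
    then have nz: "arr s' aMark (node l) \<noteq> 0" "arr s' aMark (node (negate l)) \<noteq> 0"
      using m by (auto simp: both_def doubly_lit_var)
    let ?s2 = "set_reg rV (arr s' aMark (link (lit_var l))) (set_reg rCnt (Suc (reg s' rCnt)) ?s1)"
    show ?thesis
    proof (cases "lit_var l \<in> Z")
      case False
      then have "arr s' aMark (link (lit_var l)) = 0" using m by blast
      moreover have "Post (T' + 15) (set_reg rK (length zs) ?s2)"
        using True False P by (auto simp: Post_def ready_def)
      ultimately show ?thesis
        using z k nz by (simp add: check_lit_def read_lit_def v plus_numeral_Suc)
    next
      case hit: True
      then have "arr s' aMark (link (lit_var l)) \<noteq> 0" using m by blast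
      moreover have "Post (T' + 15) (set_reg rK (length zs) (set_reg rHit 1 ?s2))"
        using True hit P by (auto simp: Post_def ready_def)
      ultimately show ?thesis
        using z k nz by (simp add: check_lit_def read_lit_def v plus_numeral_Suc)
    qed
  qed
  then show "wp check_lit (Suc T') s' (\<lambda>T' s'. (T' \<le> \<tau> + 15 * length (ys @ [l]) \<and> ready inp n N T s' \<and>
    marked s' = marked s \<and> reg s' rPos = reg s rPos + length (ys @ [l]) \<and>
    reg s' rCnt = length (filter both (ys @ [l])) \<and>
    reg s' rHit = (if \<exists>l\<in>set (ys @ [l]). both l \<and> lit_var l \<in> Z then 1 else 0) \<and>
    reg s' rM = reg s rM \<and> reg s' rFail = reg s rFail) \<and> reg s' rZero = 0 \<and> reg s' rK = length zs)"
    unfolding Post_def .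
next
  show "reg s rZero = 0" using r by (simp add: ready_def)
qed (use r k cnt Q in auto)

lemma wp_skip_xor:
  assumes "ready inp n N T s"
    and Q: "\<And>T' s'. T' \<le> Suc \<tau> + 3 * reg s rK \<Longrightarrow> ready inp n N T s' \<Longrightarrow> marked s' = marked s \<Longrightarrow>
      reg s' rPos = reg s rPos + reg s rK \<Longrightarrow> reg s' rM = reg s rM \<Longrightarrow> reg s' rFail = reg s rFail \<Longrightarrow> Q T' s'"
  shows "wp (While (Less rZero rK) (Inc rPos ;; Dec rK)) \<tau> s Q"
  \<comment> \<open>The list of units supplies nothing but its length.\<close>
  by (rule wp_for[where xs = "replicate (reg s rK) ()" and P = "\<lambda>ys T' s'. T' \<le> \<tau> + 3 * length ys \<and>
      ready inp n N T s' \<and> marked s' = marked s \<and> reg s' rPos = reg s rPos + length ys \<and>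
      reg s' rM = reg s rM \<and> reg s' rFail = reg s rFail"])
    (use assms in \<open>auto simp: ready_def[of _ _ _ _ s] intro!: Q\<close>)

lemma wp_check_clause:
  assumes r: "ready inp n N T s" and c: "clause_at inp (reg s rPos) c" "clause_over {..<n} c"
  defines "L \<equiv> lits (marked s \<inter> base n)" and "Z \<equiv> links (marked s \<inter> base n)"
  assumes Q: "\<And>T' s'. T' \<le> \<tau> + 20 * (1 + length (disj_part c) + length (xor_part c)) \<Longrightarrow>
      ready inp n N T s' \<Longrightarrow> marked s' = marked s \<Longrightarrow>
      reg s' rPos = reg s rPos + 2 + length (disj_part c) + length (xor_part c) \<Longrightarrow>
      reg s' rFail = (if clause_ok L Z c then reg s rFail else 1) \<Longrightarrow> reg s' rM = reg s rM - 1 \<Longrightarrow> Q T' s'"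
  shows "wp check_clause \<tau> s Q"
proof -
  let ?ds = "disj_part c" and ?xs = "xor_part c" and ?p = "reg s rPos"
  have ds: "\<forall>l\<in>set ?ds. lit_var l < n"
    using c(2) by (auto simp: clause_over_def clause_vars_def vars_def)
  have at: "inp ?p = length ?ds" "\<forall>i<length ?ds. inp (Suc ?p + i) = encode_lit (?ds ! i)"
      "inp (Suc ?p + length ?ds) = length ?xs"
    using c(1) by (auto simp: clause_at_def)
  let ?s1 = "set_reg rHit 0 (set_reg rCnt 0 (set_reg rPos (Suc ?p) (set_reg rK (length ?ds) s)))"
  let ?check = "If (Equal rK rZero)
       (If (Less rTwo rCnt) (Copy rFail rOne)
         (If (Equal rCnt rTwo) (If (Equal rHit rOne) (Copy rFail rOne) skip) skip))
       (If (Equal rCnt rZero) skip (Copy rFail rOne))"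
  let ?skip = "While (Less rZero rK) (Inc rPos ;; Dec rK)"
  have inp: "arr s aIn = inp" "reg s rZero = 0" using r by (simp_all add: ready_def)
  have "wp (While (Less rZero rK) check_lit) (\<tau> + 4) ?s1
    (\<lambda>T' s'. wp (Read rK aIn rPos ;; Inc rPos ;; ?check ;; ?skip ;; Dec rM) T' s' Q)"
  proof (rule wp_check_lits[where ds = ?ds and inp = inp and n = n and N = N and T = T])
    show "ready inp n N T ?s1" using r by simp
    show "\<forall>i<length ?ds. inp (reg ?s1 rPos + i) = encode_lit (?ds ! i)" using at by simp
    fix T3 s3
    assume T3: "T3 \<le> Suc (\<tau> + 4) + 15 * length ?ds" and r3: "ready inp n N T s3" and m3: "marked s3 = marked ?s1"
      and p3: "reg s3 rPos = reg ?s1 rPos + length ?ds"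
      and cnt3: "reg s3 rCnt = length (filter (\<lambda>l. lit_var l \<in> doubly (lits (marked ?s1 \<inter> base n))) ?ds)"
      and hit3: "reg s3 rHit = (if \<exists>l\<in>set ?ds. lit_var l \<in> doubly (lits (marked ?s1 \<inter> base n)) \<and>
        lit_var l \<in> links (marked ?s1 \<inter> base n) then 1 else 0)"
      and reg3: "reg s3 rM = reg ?s1 rM" "reg s3 rFail = reg ?s1 rFail"
    have in3: "arr s3 aIn = inp" "reg s3 rZero = 0" "reg s3 rOne = 1" "reg s3 rTwo = 2"
      using r3 by (simp_all add: ready_def)
    have cnt: "reg s3 rCnt = length (rest L c)" using cnt3 by (simp add: rest_def L_def)
    have hit: "reg s3 rHit = 1 \<longleftrightarrow> vars (rest L c) \<inter> Z \<noteq> {}"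
      using hit3 by (auto simp: rest_def L_def Z_def vars_def)
    let ?s4 = "set_reg rPos (Suc (reg s3 rPos)) (set_reg rK (length ?xs) s3)"
    have "wp ?check (T3 + 2) ?s4 (\<lambda>T' s'. T' \<le> T3 + 7 \<and> ready inp n N T s' \<and> marked s' = marked s \<and>
        reg s' rPos = Suc (reg s3 rPos) \<and> reg s' rK = length ?xs \<and>
        reg s' rM = reg s rM \<and> reg s' rFail = (if clause_ok L Z c then reg s rFail else 1))"
      using r3 m3 reg3 in3 cnt hit by (auto simp: clause_ok_def)
    moreover have "wp (?skip ;; Dec rM) T5 s5 Q"
      if 5: "T5 \<le> T3 + 7 \<and> ready inp n N T s5 \<and> marked s5 = marked s \<and>
        reg s5 rPos = Suc (reg s3 rPos) \<and> reg s5 rK = length ?xs \<and>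
        reg s5 rM = reg s rM \<and> reg s5 rFail = (if clause_ok L Z c then reg s rFail else 1)" for T5 s5
      unfolding wp_Seq
    proof (rule wp_skip_xor)
      show "ready inp n N T s5" using 5 by blast
      fix T6 s6
      assume 6: "T6 \<le> Suc T5 + 3 * reg s5 rK" "ready inp n N T s6" "marked s6 = marked s5"
        "reg s6 rPos = reg s5 rPos + reg s5 rK" "reg s6 rM = reg s5 rM" "reg s6 rFail = reg s5 rFail"
      have "Q (Suc T6) (set_reg rM (reg s6 rM - 1) s6)"
        by (rule Q) (use 5 6 T3 p3 in auto)
      then show "wp (Dec rM) T6 s6 Q" by simp
    qed
    ultimately have "wp ?check (T3 + 2) ?s4 (\<lambda>T' s'. wp (?skip ;; Dec rM) T' s' Q)"
      by (rule wp_mono)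
    then show "wp (Read rK aIn rPos ;; Inc rPos ;; ?check ;; ?skip ;; Dec rM) T3 s3 Q"
      using in3 at(3) p3 by (simp add: plus_numeral_Suc del: wp_If)
  qed (use ds in auto)
  then show ?thesis using inp at(1) by (simp add: check_clause_def plus_numeral_Suc)
qed

lemma wp_check_all:
  assumes r: "ready inp n N T s" and \<phi>: "formula_over {..<n} \<phi>" "formula_at inp \<phi>"
    and m: "reg s rM = length \<phi>" "reg s rPos = 2" "reg s rFail = 0"
  defines "L \<equiv> lits (marked s \<inter> base n)" and "Z \<equiv> links (marked s \<inter> base n)"
  assumes Q: "\<And>T' s'. T' \<le> Suc \<tau> + 21 * weight \<phi> \<Longrightarrow> ready inp n N T s' \<Longrightarrow> marked s' = marked s \<Longrightarrow>
      reg s' rFail = (if \<forall>c\<in>set \<phi>. clause_ok L Z c then 0 else 1) \<Longrightarrow> Q T' s'"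
  shows "wp (While (Less rZero rM) check_clause) \<tau> s Q"
proof (rule wp_for[where xs = \<phi> and P = "\<lambda>ys T' s'. T' \<le> \<tau> + 21 * weight ys \<and> ready inp n N T s' \<and>
    marked s' = marked s \<and> reg s' rFail = (if \<forall>c\<in>set ys. clause_ok L Z c then 0 else 1) \<and>
    reg s' rPos = 2 + code_length ys"])
  show "reg s rZero = 0" using r by (simp add: ready_def)
next
  fix ys c zs T' s'
  assume eq: "\<phi> = ys @ c # zs" and P: "T' \<le> \<tau> + 21 * weight ys \<and> ready inp n N T s' \<and>
    marked s' = marked s \<and> reg s' rFail = (if \<forall>c\<in>set ys. clause_ok L Z c then 0 else 1) \<and>
    reg s' rPos = 2 + code_length ys" and k: "reg s' rM = Suc (length zs)"
  have c: "clause_at inp (reg s' rPos) c" "clause_over {..<n} c"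
    using \<phi> P unfolding formula_at_def formula_over_def by (auto simp: eq)
  have r': "ready inp n N T s'" using P by blast
  show "wp check_clause (Suc T') s' (\<lambda>T' s'. (T' \<le> \<tau> + 21 * weight (ys @ [c]) \<and> ready inp n N T s' \<and>
    marked s' = marked s \<and> reg s' rFail = (if \<forall>c\<in>set (ys @ [c]). clause_ok L Z c then 0 else 1) \<and>
    reg s' rPos = 2 + code_length (ys @ [c])) \<and> reg s' rZero = 0 \<and> reg s' rM = length zs)"
    by (rule wp_check_clause[OF r' c]) (use P k in \<open>auto simp: L_def Z_def ready_def\<close>)
qed (use r m Q in auto)

text \<open>The output array is initially 0, so the variables of V0 require no write; meeting one of
  them sets \<open>rSome\<close>, which records that V0 is non-empty.\<close>

definition emit :: prog where
  "emit = Copy rK rN ;; Copy rL rOne ;; Copy rI rZero ;;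
     While (Less rZero rK)
       (Read rNl aNeg rL ;; Read rW aLink rL ;; Read rC aMark rL ;; Read rU aMark rNl ;;
        If (Equal rC rZero) (Copy rSome rOne)
          (If (Equal rU rZero) (Copy rSome rOne)
            (Read rV aMark rW ;; If (Equal rV rZero) (Write aOut rI rOne) (Write aOut rI rTwo))) ;;
        Inc rI ;; Inc rL ;; Inc rL ;; Inc rL ;; Dec rK)"

definition class_of :: "lit set \<Rightarrow> nat set \<Rightarrow> nat \<Rightarrow> nat" where
  "class_of L Z x = (if x \<in> doubly L then if x \<in> Z then 2 else 1 else 0)"

lemma wp_emit:
  assumes r: "ready inp n N T s" and n: "reg s rN = n" and some: "reg s rSome = 0"
  defines "L \<equiv> lits (marked s \<inter> base n)" and "Z \<equiv> links (marked s \<inter> base n)"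
  assumes Q: "\<And>T' s'. T' \<le> \<tau> + 4 + 20 * n \<Longrightarrow>
      arr s' aOut = (\<lambda>x. if x < n then class_of L Z x else 0) \<Longrightarrow>
      reg s' rSome = (if {..<n} - doubly L = {} then 0 else 1) \<Longrightarrow> reg s' rFail = reg s rFail \<Longrightarrow>
      reg s' rZero = 0 \<Longrightarrow> reg s' 0 = reg s 0 \<Longrightarrow> Q T' s'"
  shows "wp emit \<tau> s Q"
proof -
  let ?body = "Read rNl aNeg rL ;; Read rW aLink rL ;; Read rC aMark rL ;; Read rU aMark rNl ;;
        If (Equal rC rZero) (Copy rSome rOne)
          (If (Equal rU rZero) (Copy rSome rOne)
            (Read rV aMark rW ;; If (Equal rV rZero) (Write aOut rI rOne) (Write aOut rI rTwo))) ;;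
        Inc rI ;; Inc rL ;; Inc rL ;; Inc rL ;; Dec rK"
  let ?out = "\<lambda>k x. if x < k then class_of L Z x else 0"
  let ?P = "\<lambda>ys T' s'. T' \<le> \<tau> + 3 + 20 * length ys \<and> tables n s' \<and> arr s' aMark = arr s aMark \<and>
     reg s' rZero = 0 \<and> reg s' rOne = 1 \<and> reg s' rTwo = 2 \<and> reg s' rI = length ys \<and> reg s' rL = Suc (3 * length ys) \<and>
     arr s' aOut = ?out (length ys) \<and> reg s' rSome = (if {..<length ys} - doubly L = {} then 0 else 1) \<and>
     reg s' rFail = reg s rFail \<and> reg s' 0 = reg s 0"
  let ?s = "set_reg rI 0 (set_reg rL 1 (set_reg rK n s))"
  have z: "reg s rZero = 0" "reg s rOne = 1" using r by (simp_all add: ready_def)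
  have "wp (While (Less rZero rK) ?body) (\<tau> + 3) ?s Q"
  proof (rule wp_for[where xs = "[0..<n]" and P = ?P])
    show "?P [] (\<tau> + 3) ?s" using r some by (simp add: ready_def tables_def)
  next
    fix ys x zs T' s'
    assume eq: "[0..<n] = ys @ x # zs" and P: "?P ys T' s'" and k: "reg s' rK = Suc (length zs)"
    have len: "length ys + Suc (length zs) = n" using arg_cong[OF eq, of length] by simp
    have x: "x = length ys" using arg_cong[OF eq, of "\<lambda>xs. xs ! length ys"] len by (simp add: nth_append)
    have xn: "x < n" using len x by simp
    define Post where "Post T' s' \<longleftrightarrow> ?P (ys @ [x]) T' s' \<and> reg s' rZero = 0 \<and> reg s' rK = length zs" for T' s'
    have rL: "reg s' rL = node (Pos x)" using P x by simp
    have tab: "arr s' aNeg (node (Pos x)) = node (Neg x)" "arr s' aLink (node (Pos x)) = link x"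
    proof -
      have "tables n s'" using P by blast
      then show "arr s' aNeg (node (Pos x)) = node (Neg x)" "arr s' aLink (node (Pos x)) = link x"
        unfolding tables_def using xn by (metis lit_var.simps(1) negate.simps(1))+
    qed
    have c: "reg s' rZero = 0" "reg s' rOne = 1" "reg s' rTwo = 2" "reg s' rI = x" using P x by simp_all
    have m: "arr s' aMark (node (Pos x)) \<noteq> 0 \<longleftrightarrow> Pos x \<in> L" "arr s' aMark (node (Neg x)) \<noteq> 0 \<longleftrightarrow> Neg x \<in> L"
      "arr s' aMark (link x) \<noteq> 0 \<longleftrightarrow> x \<in> Z"
      using xn P by (auto simp: L_def Z_def lits_def links_def marked_def simp del: node.simps)
    let ?s1 = "set_reg rU (arr s' aMark (node (Neg x))) (set_reg rC (arr s' aMark (node (Pos x)))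
      (set_reg rW (link x) (set_reg rNl (node (Neg x)) s')))"
    let ?end = "\<lambda>s. set_reg rK (length zs) (set_reg rL (Suc (Suc (Suc (node (Pos x))))) (set_reg rI (Suc x) s))"
    have dbl: "{..<Suc x} - doubly L = ({..<x} - doubly L) \<union> (if x \<in> doubly L then {} else {x})"
      by (auto simp: lessThan_Suc)
    have "wp ?body (Suc T') s' Post"
    proof (cases "x \<in> doubly L")
      case False
      have fin: "Post T2 (?end (set_reg rSome 1 ?s1))" if "T2 \<le> T' + 20" for T2
        using P x that False by (auto simp: Post_def dbl class_of_def fun_eq_iff less_Suc_eq)
      have "arr s' aMark (node (Pos x)) = 0 \<or> arr s' aMark (node (Neg x)) = 0"
        using False m by (auto simp: doubly_def)
      then show ?thesis
        using fin[of "T' + 12"] fin[of "T' + 13"] k by (auto simp: rL tab c plus_numeral_Suc simp del: node.simps)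
    next
      case True
      then have nz: "arr s' aMark (node (Pos x)) \<noteq> 0" "arr s' aMark (node (Neg x)) \<noteq> 0"
        using m by (auto simp: doubly_def)
      let ?s2 = "set_arr aOut x (class_of L Z x) (set_reg rV (arr s' aMark (link x)) ?s1)"
      have "Post (T' + 15) (?end ?s2)"
        using P x True by (auto simp: Post_def dbl fun_eq_iff less_Suc_eq)
      then show ?thesis
        using nz k m(3) True by (auto simp: rL tab c plus_numeral_Suc class_of_def simp del: node.simps)
    qed
    then show "wp ?body (Suc T') s' (\<lambda>T' s'. ?P (ys @ [x]) T' s' \<and> reg s' rZero = 0 \<and> reg s' rK = length zs)"
      unfolding Post_def .
  next
    fix T' s' assume P: "?P [0..<n] T' s'"
    show "Q (Suc T') s'" by (rule Q) (use P in auto)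
  qed (use z in auto)
  then show ?thesis using z n by (simp add: emit_def plus_numeral_Suc)
qed

section \<open>The algorithm\<close>

text \<open>\<open>rC\<close>, initially 0, counts through the literal codes and
  \<open>rFresh\<close> through the node numbers, two and three steps per variable. Writing
  \<open>aMark\<close> at index 0 makes the null pointer a marked node.\<close>

definition init_tables :: prog where
  "init_tables =
     Assign rOne 1 ;; Assign rTwo 2 ;; Assign rStamp 1 ;; Assign rFresh 1 ;; Write aMark rZero rOne ;;
     Read rN aIn rZero ;; Read rM aIn rOne ;; Copy rPos rTwo ;; Copy rK rN ;;
     While (Less rZero rK)
       (Copy rL rFresh ;; Inc rFresh ;; Copy rNl rFresh ;; Inc rFresh ;; Copy rW rFresh ;; Inc rFresh ;;
        Write aNode rC rL ;; Inc rC ;; Write aNode rC rNl ;; Inc rC ;;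
        Write aNeg rL rNl ;; Write aNeg rNl rL ;; Write aLink rL rW ;; Write aLink rNl rW ;; Dec rK)"

text \<open>The readings differ only in \<open>answer\<close>, which runs if no clause check has
  failed; otherwise register 0 keeps its initial 0, the negative answer.\<close>

definition program :: "prog \<Rightarrow> prog" where
  "program answer =
     init_tables ;;
     While (Less rZero rM) clause_step ;;
     While (Less rHA rTA) (search_step aSeenA aQueueA rHA rTA) ;;
     commit aQueueA rTA ;;
     rounds ;;
     Copy rPos rTwo ;; Read rM aIn rOne ;;
     While (Less rZero rM) check_clause ;;
     emit ;;
     If (Equal rFail rZero) answer skip"

lemma concat_at:
  assumes "\<phi> = ds @ c # cs" "i < length (encode_clause c)"
  shows "concat (map encode_clause \<phi>) ! (code_length ds + i) = encode_clause c ! i"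
    "code_length ds + i < length (concat (map encode_clause \<phi>))"
  using assms by (simp_all add: code_length_def nth_append)

lemma input_clauses:
  fixes n \<phi> defines "inp \<equiv> arr (input_state n \<phi>) 0"
  shows "formula_at inp \<phi>" "inp 0 = n" "inp 1 = length \<phi>"
proof -
  have at: "inp (2 + code_length ds + i) = encode_clause c ! i"
    if "\<phi> = ds @ c # cs" "i < length (encode_clause c)" for ds c cs i
    using concat_at[OF that] by (simp add: inp_def input_state_def encode_formula_def Let_def)
  show "formula_at inp \<phi>"
    unfolding formula_at_def
  proof (intro allI impI)
    fix ds c cs assume \<phi>: "\<phi> = ds @ c # cs"
    let ?p = "2 + code_length ds" and ?d = "length (disj_part c)" and ?x = "length (xor_part c)"
    note at = at[OF \<phi>]
    have "inp (?p + 0) = ?d" by (subst at) (simp_all add: encode_clause_def)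
    moreover have "inp (?p + Suc i) = encode_lit (disj_part c ! i)" if "i < ?d" for i
      using that by (subst at) (simp_all add: encode_clause_def nth_append)
    moreover have "inp (?p + Suc ?d) = ?x"
      by (subst at) (simp_all add: encode_clause_def nth_append)
    moreover have "inp (?p + (Suc (Suc ?d) + i)) = encode_lit (xor_part c ! i)" if "i < ?x" for i
      using that by (subst at) (simp_all add: encode_clause_def nth_append)
    ultimately show "clause_at inp ?p c" by (simp add: clause_at_def add.assoc)
  qed
  show "inp 0 = n" "inp 1 = length \<phi>"
    by (simp_all add: inp_def input_state_def encode_formula_def Let_def)
qed

lemma building_start:
  assumes "arr s aIn = inp" "tables n s" "arr s aMark = (\<lambda>_. 0)(0 := 1)" "\<forall>a\<in>{1, 5, 6, 8, 9, 10, 11}. arr s a = (\<lambda>_. 0)"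
    "reg s rZero = 0" "reg s rOne = 1" "reg s rTwo = 2" "reg s rStamp = 1" "reg s rHA = 0" "reg s rTA = 0"
    "reg s rFresh = 3 * n + 1"
  shows "building inp n (base n) (\<lambda>_. True) s"
proof -
  have "represents (\<lambda>_. 0) (\<lambda>_. 0) (3 * n + 1) {} (base n) (\<lambda>_. True)"
    unfolding represents_def closed_def base_def by auto
  moreover have "queued (\<lambda>_. 0) 1 (\<lambda>_. 0) 0 {}" by (simp add: queued_def)
  ultimately show ?thesis using assms unfolding building_def by auto
qed

lemma wp_init_tables:
  assumes Q: "\<And>T' s'. T' \<le> 10 + 16 * n \<Longrightarrow> building (arr (input_state n \<phi>) 0) n (base n) (\<lambda>_. True) s' \<Longrightarrow>
      reg s' rFresh \<le> T' \<Longrightarrow> reg s' rN = n \<Longrightarrow> reg s' rM = length \<phi> \<Longrightarrow> reg s' rPos = 2 \<Longrightarrow>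
      reg s' rFail = 0 \<Longrightarrow> reg s' rSome = 0 \<Longrightarrow> reg s' 0 = 0 \<Longrightarrow> Q T' s'"
  shows "wp init_tables 0 (input_state n \<phi>) Q"
proof -
  let ?s = "input_state n \<phi>"
  let ?body = "Copy rL rFresh ;; Inc rFresh ;; Copy rNl rFresh ;; Inc rFresh ;; Copy rW rFresh ;; Inc rFresh ;;
        Write aNode rC rL ;; Inc rC ;; Write aNode rC rNl ;; Inc rC ;;
        Write aNeg rL rNl ;; Write aNeg rNl rL ;; Write aLink rL rW ;; Write aLink rNl rW ;; Dec rK"
  define inp where "inp = arr ?s 0"
  let ?keep = "\<lambda>s. arr s aIn = inp \<and> arr s aMark = (\<lambda>_. 0)(0 := 1) \<and>
    (\<forall>a\<in>{1, 5, 6, 8, 9, 10, 11}. arr s a = (\<lambda>_. 0)) \<and>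
    reg s rZero = 0 \<and> reg s rOne = 1 \<and> reg s rTwo = 2 \<and> reg s rStamp = 1 \<and> reg s rHA = 0 \<and> reg s rTA = 0 \<and>
    reg s rN = n \<and> reg s rM = length \<phi> \<and> reg s rPos = 2 \<and> reg s rFail = 0 \<and> reg s rSome = 0 \<and> reg s 0 = 0"
  let ?P = "\<lambda>ys T' s'. T' \<le> 9 + 16 * length ys \<and> tables (length ys) s' \<and> reg s' rC = 2 * length ys \<and>
     reg s' rFresh = Suc (3 * length ys) \<and> reg s' rFresh \<le> T' \<and> ?keep s'"
  let ?s1 = "set_reg rK n (set_reg rPos 2 (set_reg rM (length \<phi>) (set_reg rN n (set_arr aMark 0 1
    (set_reg rFresh 1 (set_reg rStamp 1 (set_reg rTwo 2 (set_reg rOne 1 ?s))))))))"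
  have reg0: "reg ?s = (\<lambda>_. 0)" by (simp add: input_state_def Let_def)
  have arr0: "arr ?s a = (\<lambda>_. 0)" if "a \<noteq> 0" for a
    using that by (simp add: input_state_def Let_def)
  have "wp (While (Less rZero rK) ?body) 9 ?s1 Q"
  proof (rule wp_for[where xs = "[0..<n]" and P = ?P])
    show "?P [] 9 ?s1" by (auto simp: reg0 arr0 tables_def inp_def)
  next
    fix ys x zs T' s'
    assume eq: "[0..<n] = ys @ x # zs" and P: "?P ys T' s'" and k: "reg s' rK = Suc (length zs)"
    let ?k = "length ys"
    let ?f = "Suc (3 * ?k)"
    let ?s2 = "set_reg rK (length zs)
      (set_arr aLink (Suc ?f) (Suc (Suc ?f)) (set_arr aLink ?f (Suc (Suc ?f)) (set_arr aNeg (Suc ?f) ?f (set_arr aNeg ?f (Suc ?f)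
      (set_reg rC (Suc (Suc (2 * ?k))) (set_arr aNode (Suc (2 * ?k)) (Suc ?f) (set_reg rC (Suc (2 * ?k)) (set_arr aNode (2 * ?k) ?f
      (set_reg rFresh (Suc (Suc (Suc ?f))) (set_reg rW (Suc (Suc ?f)) (set_reg rFresh (Suc (Suc ?f)) (set_reg rNl (Suc ?f)
      (set_reg rFresh (Suc ?f) (set_reg rL ?f s'))))))))))))))"
    have tab: "tables (Suc ?k) ?s2"
    proof -
      have old: "tables ?k s'" using P by blast
      have "arr ?s2 aNode (encode_lit l) = node l \<and> arr ?s2 aNeg (node l) = node (negate l) \<and>
          arr ?s2 aLink (node l) = link (lit_var l)" if l: "lit_var l < Suc ?k" for l
      proof (cases "lit_var l = ?k")
        case True
        then show ?thesis by (cases l) (auto simp: link_def)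
      next
        case False
        then have lk: "lit_var l < ?k" using l by simp
        then have o: "arr s' aNode (encode_lit l) = node l" "arr s' aNeg (node l) = node (negate l)"
          "arr s' aLink (node l) = link (lit_var l)" using old by (simp_all add: tables_def)
        have "node l < ?f" "encode_lit l < 2 * ?k" using lk by (cases l; simp)+
        then show ?thesis using o by simp
      qed
      moreover have "arr ?s2 aNeg v = 0" if v: "\<nexists>l. lit_var l < Suc ?k \<and> v = node l" for v
      proof -
        have "v \<noteq> node (Pos ?k)" "v \<noteq> node (Neg ?k)"
          using v[simplified, rule_format, of "Pos ?k"] v[simplified, rule_format, of "Neg ?k"] by simp_all
        moreover have "\<nexists>l. lit_var l < ?k \<and> v = node l" using v less_SucI by blast
        ultimately show ?thesis using old by (simp add: tables_def)
      qed
      ultimately show ?thesis unfolding tables_def by blast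
    qed
    have "?P (ys @ [x]) (Suc T' + 15) ?s2" using tab P by simp
    moreover have "reg ?s2 rZero = 0" "reg ?s2 rK = length zs" using P by simp_all
    moreover have "wp ?body (Suc T') s' (\<lambda>T1 s1. T1 = Suc T' + 15 \<and> s1 = ?s2)"
      using P k by (simp add: plus_numeral_Suc)
    ultimately show "wp ?body (Suc T') s' (\<lambda>T1 s1. ?P (ys @ [x]) T1 s1 \<and> reg s1 rZero = 0 \<and> reg s1 rK = length zs)"
      by (elim wp_mono) blast
  next
    fix T' s' assume P: "?P [0..<n] T' s'"
    then have "building inp n (base n) (\<lambda>_. True) s'" by (intro building_start) auto
    with P show "Q (Suc T') s'" unfolding inp_def by (intro Q) auto
  qed (use reg0 in auto)
  moreover have "arr ?s 0 0 = n" "arr ?s 0 1 = length \<phi>" using input_clauses(2,3) by blast+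
  ultimately show ?thesis by (simp add: init_tables_def reg0 numeral_eq_Suc)
qed

text \<open>With only the null pointer marked, the exhausted search from D has found the least
  closed node set containing D. \<open>graph_extend\<close> turns this into minimality among forced
  and link-closed sets, as \<open>marking_start\<close> demands.\<close>

lemma start_marking:
  assumes g: "graph n \<phi> N T f D" and r: "ready inp n N T s" and m: "marked s = {0}"
    and s: "search mk q h t D s" and halt: "reg s h = reg s t"
  shows "invar n \<phi> N T f D (marked s \<union> visited q t s)"
proof -
  let ?V = "visited q t s"
  have NT: "arr s aNext = N" "arr s aTarget = T" using r by (simp_all add: ready_def)
  have least: "\<And>Y. closed N T Y \<Longrightarrow> D \<subseteq> Y \<Longrightarrow> ?V \<subseteq> Y" and D: "D \<subseteq> ?V" and z: "0 \<notin> ?V"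
    and all: "\<forall>i<reg s t. N (arr s q i) \<in> ?V \<union> {0} \<and> T (arr s q i) \<in> ?V \<union> {0}"
    using s halt NT m by (auto simp: search_def)
  have cl: "closed N T ?V"
    unfolding closed_def
  proof
    fix u assume "u \<in> ?V"
    then obtain i where "i < reg s t" "u = arr s q i" by (auto simp: visited_def)
    then have "N u \<in> ?V \<union> {0}" "T u \<in> ?V \<union> {0}" using all by simp_all
    then show "(N u = 0 \<or> N u \<in> ?V) \<and> (T u = 0 \<or> T u \<in> ?V)" by auto
  qed
  note b = graph_bounds[OF g]
  have Vf: "?V \<subseteq> {1..<f}" by (rule least[OF b(3,1)])
  have eq: "({0} \<union> ?V) - {0} = ?V" "({0} \<union> ?V) \<inter> base n = ?V \<inter> base n" using z by auto
  have "marking \<phi> (lits (?V \<inter> base n)) (links (?V \<inter> base n))"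
  proof (rule marking_start)
    show "forced \<phi> (lits (?V \<inter> base n))" "link_closed \<phi> (links (?V \<inter> base n))"
      using graph_closed[OF g cl D Vf] by blast+
    fix L' Z' assume "forced \<phi> L'" "link_closed \<phi> Z'"
    from graph_extend[OF g this] obtain Y where Y: "closed N T Y" "D \<subseteq> Y"
      "lits (Y \<inter> base n) = {l\<in>L'. lit_var l < n}" "links (Y \<inter> base n) = {x\<in>Z'. x < n}" by metis
    have "?V \<subseteq> Y" by (rule least[OF Y(1,2)])
    then have "lits (?V \<inter> base n) \<subseteq> lits (Y \<inter> base n)" "links (?V \<inter> base n) \<subseteq> links (Y \<inter> base n)"
      by (auto simp: lits_def links_def)
    then show "lits (?V \<inter> base n) \<subseteq> L' \<and> links (?V \<inter> base n) \<subseteq> Z'" using Y(3,4) by auto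
  qed
  moreover have "0 < f" using g by (auto simp: graph_def represents_def)
  ultimately show ?thesis
    unfolding invar_def m eq using cl D Vf by auto
qed

section \<open>Assembling the program and its running time\<close>

lemma frame_parts:
  "{0, rN, rFail, rSome} \<inter> wregs clause_step = {}"
  "{0, rN, rFail, rSome} \<inter> wregs (search_step aSeenA aQueueA rHA rTA) = {}"
  "{0, rN, rFail, rSome} \<inter> wregs (commit aQueueA rTA) = {}"
  "{0, rN, rFail, rSome} \<inter> wregs rounds = {}"
  "{0, rN, rSome} \<inter> wregs check_clause = {}"
  "{aSeenB} \<inter> warrs (search_step aSeenA aQueueA rHA rTA) = {}"
  "{aSeenA, aSeenB} \<inter> warrs (commit aQueueA rTA) = {}"
  by (simp_all add: rounds_def round_def both_steps_def decide_def search_step_def push_def skip_def check_def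
    commit_def clause_step_def disj_step_def xor_step_def read_lit_def edge_def new_def check_clause_def check_lit_def)

lemma wp_program:
  assumes \<phi>: "formula_over {..<n} \<phi>"
    and Q: "\<And>T' s' L Z. T' \<le> 10000 * (formula_length n \<phi> + 1) \<Longrightarrow> marking \<phi> L Z \<Longrightarrow>
      (\<And>x. x < n \<Longrightarrow> Pos x \<in> L \<or> Neg x \<in> L) \<Longrightarrow>
      arr s' aOut = (\<lambda>x. if x < n then class_of L Z x else 0) \<Longrightarrow>
      reg s' rSome = (if {..<n} - doubly L = {} then 0 else 1) \<Longrightarrow>
      reg s' rFail = (if \<forall>c\<in>set \<phi>. clause_ok L Z c then 0 else 1) \<Longrightarrow> reg s' rZero = 0 \<Longrightarrow>
      reg s' 0 = 0 \<Longrightarrow> wp (If (Equal rFail rZero) answer skip) T' s' Q"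
  shows "wp (program answer) 0 (input_state n \<phi>) Q"
proof -
  define inp where "inp = arr (input_state n \<phi>) 0"
  have at: "formula_at inp \<phi>" "inp 1 = length \<phi>" using input_clauses unfolding inp_def by blast+
  \<comment> \<open>The continuations of the phases, named in order that each phase can be treated
    with the rest of the program as its postcondition.\<close>
  let ?K7 = "\<lambda>T s. wp (If (Equal rFail rZero) answer skip) T s Q"
  let ?K6 = "\<lambda>T s. wp emit T s ?K7"
  let ?K5 = "\<lambda>T s. wp (While (Less rZero rM) check_clause) T s ?K6"
  let ?K4 = "\<lambda>T s. wp (Copy rPos rTwo) T s (\<lambda>T s. wp (Read rM aIn rOne) T s ?K5)"
  let ?K3 = "\<lambda>T s. wp rounds T s ?K4"
  let ?K2 = "\<lambda>T s. wp (commit aQueueA rTA) T s ?K3"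
  let ?K1 = "\<lambda>T s. wp (While (Less rHA rTA) (search_step aSeenA aQueueA rHA rTA)) T s ?K2"
  show ?thesis
    unfolding program_def wp_Seq
  proof (rule wp_init_tables, fold inp_def)
    fix T1 s1
    assume T1: "T1 \<le> 10 + 16 * n" and b1: "building inp n (base n) (\<lambda>_. True) s1" and f1: "reg s1 rFresh \<le> T1"
      and reg1: "reg s1 rN = n" "reg s1 rM = length \<phi>" "reg s1 rPos = 2" "reg s1 rFail = 0" "reg s1 rSome = 0" "reg s1 0 = 0"
    show "wp (While (Less rZero rM) clause_step) T1 s1 ?K1"
    proof (rule wp_frame, rule wp_build[OF b1 \<phi> at(1) reg1(2,3) f1], rule impI)
      fix T2 s2
      assume T2: "T2 \<le> Suc T1 + 43 * weight \<phi>" and b2: "building inp n (base n) (\<lambda>X. \<forall>c\<in>set \<phi>. obeys c X) s2"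
        and f2: "reg s2 rFresh \<le> T2"
        and fr2: "frame (wregs (While (Less rZero rM) clause_step)) (warrs (While (Less rZero rM) clause_step)) s1 s2"
      have reg2: "reg s2 rN = n" "reg s2 rFail = 0" "reg s2 rSome = 0" "reg s2 0 = 0"
        using frame_reg[OF fr2] frame_parts(1) reg1 by auto
      define N where "N = arr s2 aNext"
      define T where "T = arr s2 aTarget"
      define f where "f = reg s2 rFresh"
      obtain D where D: "represents N T f D (base n) (\<lambda>X. \<forall>c\<in>set \<phi>. obeys c X)"
          "queued (arr s2 aSeenA) 1 (arr s2 aQueueA) (reg s2 rTA) D"
        using b2 unfolding building_def N_def T_def f_def by blast
      have g: "graph n \<phi> N T f D" using D(1) \<phi> by (simp add: graph_def)
      note gb = graph_bounds[OF g]
      have r2: "ready inp n N T s2" using b2 by (simp add: building_def ready_def N_def T_def)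
      have m2: "marked s2 = {0}" using b2 by (auto simp: building_def marked_def)
      have st2: "reg s2 rStamp = 1" "reg s2 rHA = 0" "\<forall>v. arr s2 aSeenA v \<le> 1" "arr s2 aSeenB = (\<lambda>_. 0)"
        using b2 by (simp_all add: building_def)
      have v2: "visited aQueueA rTA s2 = D" using D(2) by (simp add: queued_def visited_def)
      have "D \<inter> {0} = {}" using gb(1) by auto
      then have s2: "search aSeenA aQueueA rHA rTA D s2"
        using D(2) st2 m2 by (simp add: search_def v2)
      have z2: "reg s2 rZero = 0" "arr s2 aNext = N" "arr s2 aTarget = T" using r2 by (simp_all add: ready_def)
      show "wp (While (Less rHA rTA) (search_step aSeenA aQueueA rHA rTA)) T2 s2 ?K2"
      proof (rule wp_finish[OF channels(1) s2 z2(1) _ gb(1)])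
        show "0 \<in> marked s2" "closed (arr s2 aNext) (arr s2 aTarget) {1..<f}" using m2 gb(3) z2 by simp_all
        fix T3 s3
        assume T3: "T3 \<le> Suc T2 + 19 * (reg s3 rTA - reg s2 rHA)" and s3: "search aSeenA aQueueA rHA rTA D s3"
          and halt: "reg s3 rHA = reg s3 rTA" and fr3: "frame {rHA, rTA, rU, rV, rTmp} {aSeenA, aQueueA} s2 s3"
        have r3: "ready inp n N T s3" by (rule ready_frame[OF r2 fr3]) auto
        have m3: "marked s3 = {0}" using frame_arr[OF fr3, of aMark] m2 by (simp add: marked_def)
        have reg3: "reg s3 rN = n" "reg s3 rFail = 0" "reg s3 rSome = 0" "reg s3 0 = 0" "reg s3 rStamp = 1"
          using frame_reg[OF fr3] reg2 st2 by simp_all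
        have seen3: "\<forall>v. arr s3 aSeenA v \<le> 1" "arr s3 aSeenB = (\<lambda>_. 0)"
          using s3 reg3 frame_arr[OF fr3, of aSeenB] st2 by (simp_all add: search_def)
        have z3: "reg s3 rOne = 1" "reg s3 rZero = 0" using r3 by (simp_all add: ready_def)
        have tf: "reg s3 rTA \<le> f"
          by (rule search_bound[OF s3 gb(1)]) (use gb(3) r3 in \<open>simp add: ready_def\<close>)
        note i = start_marking[OF g r3 m3 s3 halt]
        show "wp (commit aQueueA rTA) T3 s3 ?K3"
        proof (rule wp_commit[OF channels(1) z3])
          fix T4 s4
          assume T4: "T4 \<le> T3 + 2 + 4 * reg s3 rTA" and m4: "marked s4 = marked s3 \<union> visited aQueueA rTA s3"
            and fr4: "frame {rI, rU} {aMark} s3 s4"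
          have r4: "ready inp n N T s4" by (rule ready_frame[OF r3 fr4]) auto
          have reg4: "reg s4 rN = n" "reg s4 rFail = 0" "reg s4 rSome = 0" "reg s4 0 = 0" "reg s4 rStamp = 1"
            using frame_reg[OF fr4] reg3 by simp_all
          have seen4: "\<forall>v. arr s4 aSeenA v \<le> reg s4 rStamp" "\<forall>v. arr s4 aSeenB v \<le> reg s4 rStamp"
            using frame_arr[OF fr4] seen3 reg4 by simp_all
          have i4: "invar n \<phi> N T f D (marked s4)" using i m4 by simp
          show "wp rounds T4 s4 ?K4"
          proof (rule wp_frame, rule wp_rounds[OF g i4 r4 reg4(1) seen4], rule impI)
            fix T5 s5
            assume T5: "T5 \<le> T4 + 3 + 50 * n + 72 * f" and i5: "invar n \<phi> N T f D (marked s5)"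
              and total5: "\<forall>x<n. node (Pos x) \<in> marked s5 \<or> node (Neg x) \<in> marked s5" and r5: "ready inp n N T s5"
              and fr5: "frame (wregs rounds) (warrs rounds) s4 s5"
            have reg5: "reg s5 rN = n" "reg s5 rFail = 0" "reg s5 rSome = 0" "reg s5 0 = 0"
              using frame_reg[OF fr5] frame_parts(4) reg4 by auto
            have z5: "reg s5 rTwo = 2" "reg s5 rOne = 1" "arr s5 aIn = inp" using r5 by (simp_all add: ready_def)
            let ?s = "set_reg rM (length \<phi>) (set_reg rPos 2 s5)"
            define L where "L = lits (marked s5 \<inter> base n)"
            define Z where "Z = links (marked s5 \<inter> base n)"
            have mk: "marking \<phi> L Z" using i5 by (simp add: L_def Z_def invar_def)
            have total: "Pos x \<in> L \<or> Neg x \<in> L" if "x < n" for x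
              using total5 that by (simp add: L_def lits_def del: node.simps)
            have r5': "ready inp n N T ?s" "reg ?s rM = length \<phi>" "reg ?s rPos = 2" "reg ?s rFail = 0"
              using r5 reg5 by simp_all
            have "wp (While (Less rZero rM) check_clause) (Suc (Suc T5)) ?s ?K6"
            proof (rule wp_frame, rule wp_check_all[OF r5'(1) \<phi> at(1) r5'(2-4)], rule impI)
              fix T6 s6
              assume T6: "T6 \<le> Suc (Suc (Suc T5)) + 21 * weight \<phi>" and r6: "ready inp n N T s6"
                and m6: "marked s6 = marked ?s"
                and fail6: "reg s6 rFail = (if \<forall>c\<in>set \<phi>. clause_ok (lits (marked ?s \<inter> base n)) (links (marked ?s \<inter> base n)) c then 0 else 1)"
                and fr6: "frame (wregs (While (Less rZero rM) check_clause)) (warrs (While (Less rZero rM) check_clause)) ?s s6"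
              have reg6: "reg s6 rN = n" "reg s6 rSome = 0" "reg s6 0 = 0"
                using frame_reg[OF fr6] frame_parts(5) reg5 by auto
              have eq6: "lits (marked s6 \<inter> base n) = L" "links (marked s6 \<inter> base n) = Z"
                using m6 by (simp_all add: L_def Z_def)
              show "wp emit T6 s6 ?K7"
              proof (rule wp_emit[OF r6 reg6(1,2)], unfold eq6)
                fix T7 and s7 :: state
                assume 7: "T7 \<le> T6 + 4 + 20 * n" "arr s7 aOut = (\<lambda>x. if x < n then class_of L Z x else 0)"
                  "reg s7 rSome = (if {..<n} - doubly L = {} then 0 else 1)" "reg s7 rFail = reg s6 rFail"
                  "reg s7 rZero = 0" "reg s7 0 = reg s6 0"
                have len: "formula_length n \<phi> = n + weight \<phi>" by (simp add: formula_length_def weight_def)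
                have T2': "T2 \<le> 11 + 16 * n + 43 * weight \<phi>" using T2 T1 by simp
                \<comment> \<open>The fresh-node counter never exceeds the elapsed time, so the
                  bound for the building phase also bounds the graph. All later phases are linear in
                  \<open>f\<close>, \<open>n\<close> and the weight; 10000 is a generous rounding of
                  the resulting coefficients.\<close>
                have "f \<le> T2" using f2 by (simp add: f_def)
                moreover have "T3 \<le> Suc T2 + 19 * reg s3 rTA" using T3 st2 by simp
                ultimately have "T4 \<le> 24 * T2 + 3" "f \<le> T2" using T4 tf by linarith+
                then have "T7 \<le> 96 * T2 + 13 + 70 * n + 21 * weight \<phi>"
                  using T5 T6 7(1) by linarith
                then have "T7 \<le> 10000 * (formula_length n \<phi> + 1)"
                  using T2' unfolding len by simp
                then show "wp (If (Equal rFail rZero) answer skip) T7 s7 Q"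
                  by (rule Q[OF _ mk total]) (use fail6 7 reg6 in \<open>auto simp: L_def Z_def\<close>)
              qed
            qed
            then show "wp (Copy rPos rTwo) T5 s5 (\<lambda>T s. wp (Read rM aIn rOne) T s ?K5)"
              using z5 at(2) by simp
          qed
        qed
      qed
    qed
  qed
qed

section \<open>Correct answers for both readings\<close>

lemma output_sets:
  assumes "arr s aOut = (\<lambda>x. if x < n then class_of L Z x else 0)"
  shows "output_set n s 0 = {..<n} - doubly L" "output_set n s 1 = {..<n} \<inter> doubly L - Z"
    "output_set n s 2 = {..<n} \<inter> doubly L \<inter> Z"
  using assms by (auto simp: output_set_def class_of_def split: if_splits)

text \<open>A failed check excludes even the weaker reading. If all checks succeed, the weaker
  reading always has a witness, and the strict one has a witness exactly if the greatest V0 is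
  non-empty.\<close>

lemma solves:
  assumes "\<And>T s. reg s 0 = 0 \<Longrightarrow> wp answer T s (\<lambda>T' s'. T' \<le> T + 1 \<and> arr s' aOut = arr s aOut \<and>
      reg s' 0 = (if strict then reg s rSome else 1))"
  shows "finds_witness_in_linear_time (program answer) (if strict then lpic_witness else lpic_witness_empty_ok)"
  unfolding finds_witness_in_linear_time_def
\<comment> \<open>The surplus over the constant of \<open>wp_program\<close> absorbs the final test
  and the answer.\<close>
proof (rule exI[of _ 10003], intro allI impI)
  fix n \<phi> assume \<phi>: "formula_over {..<n} \<phi>"
  let ?w = "if strict then lpic_witness else lpic_witness_empty_ok"
  define ok where "ok s \<longleftrightarrow> (if reg s 0 = 0 then \<not> (\<exists>V0 V1 V2. ?w {..<n} \<phi> V0 V1 V2)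
     else ?w {..<n} \<phi> (output_set n s 0) (output_set n s 1) (output_set n s 2))" for s
  have "wp (program answer) 0 (input_state n \<phi>) (\<lambda>T s. T \<le> 10003 * (formula_length n \<phi> + 1) \<and> ok s)"
  proof (rule wp_program[OF \<phi>])
    fix T and s :: state and L Z
    assume T: "T \<le> 10000 * (formula_length n \<phi> + 1)" and m: "marking \<phi> L Z"
      and total: "\<And>x. x < n \<Longrightarrow> Pos x \<in> L \<or> Neg x \<in> L"
      and out: "arr s aOut = (\<lambda>x. if x < n then class_of L Z x else 0)"
      and some: "reg s rSome = (if {..<n} - doubly L = {} then 0 else 1)"
      and fail: "reg s rFail = (if \<forall>c\<in>set \<phi>. clause_ok L Z c then 0 else 1)"
      and z: "reg s rZero = 0" "reg s 0 = 0"
    show "wp (If (Equal rFail rZero) answer skip) T s (\<lambda>T s. T \<le> 10003 * (formula_length n \<phi> + 1) \<and> ok s)"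
    proof (cases "\<forall>c\<in>set \<phi>. clause_ok L Z c")
      case False
      then have no: "\<not> lpic_witness_empty_ok {..<n} \<phi> V0 V1 V2" for V0 V1 V2
        using checks_complete[OF m \<phi>] by blast
      then have "\<not> ?w {..<n} \<phi> V0 V1 V2" for V0 V1 V2
        using witness_iff by auto
      then have "ok s" using z(2) by (simp add: ok_def)
      moreover have "reg s rFail = 1" using False fail by auto
      ultimately show ?thesis using z T by simp
    next
      case True
      have good: "lpic_witness_empty_ok {..<n} \<phi> ({..<n} - doubly L) ({..<n} \<inter> doubly L - Z) ({..<n} \<inter> doubly L \<inter> Z)"
        using checks_sound[OF m total \<phi> True] by (simp add: sets_ok_def)
      have "wp answer (Suc T) s (\<lambda>T s. T \<le> 10003 * (formula_length n \<phi> + 1) \<and> ok s)"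
      proof (rule wp_mono[OF assms[OF z(2)]])
        fix T' and s' :: state
        assume a: "T' \<le> Suc T + 1 \<and> arr s' aOut = arr s aOut \<and> reg s' 0 = (if strict then reg s rSome else 1)"
        then have out': "arr s' aOut = (\<lambda>x. if x < n then class_of L Z x else 0)" using out by simp
        have "ok s'"
        \<comment> \<open>After successful checks the answer is 0 only in the strict reading with an
          empty greatest V0.\<close>
        proof (cases "reg s' 0 = 0")
          case True
          then have strict: "strict" and empty: "{..<n} - doubly L = {}"
            using a some by (auto split: if_splits)
          have "\<not> lpic_witness {..<n} \<phi> V0 V1 V2" for V0 V1 V2
            using witness_V0_le[OF m \<phi>, of V0 V1 V2] empty by (auto simp: witness_iff)
          then show ?thesis using True strict by (simp add: ok_def)
        next
          case False
          then have "strict \<longrightarrow> {..<n} - doubly L \<noteq> {}" using a some by auto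
          then show ?thesis
            using False good witness_iff unfolding ok_def output_sets[OF out'] by auto
        qed
        then show "T' \<le> 10003 * (formula_length n \<phi> + 1) \<and> ok s'" using a T by simp
      qed
      then show ?thesis using True fail z by simp
    qed
  qed
  then show "\<exists>t s. exec (program answer) (input_state n \<phi>) t s \<and> t \<le> 10003 * (formula_length n \<phi> + 1) \<and>
      (if reg s 0 = 0 then \<not> (\<exists>V0 V1 V2. ?w {..<n} \<phi> V0 V1 V2)
       else ?w {..<n} \<phi> (output_set n s 0) (output_set n s 1) (output_set n s 2))"
    unfolding wp_def ok_def by simp
qed

theorem theorem3p5:
  "(\<exists>p. finds_witness_in_linear_time p lpic_witness) \<and>
   (\<exists>p. finds_witness_in_linear_time p lpic_witness_empty_ok)"
proof
  show "\<exists>p. finds_witness_in_linear_time p lpic_witness"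
    \<comment> \<open>\<open>rSome\<close> is 1 precisely if some variable is left for V0, so
      copying it rejects the case that \<open>partially_horn\<close> excludes.\<close>
    using solves[of "Copy 0 rSome" True] by auto
  show "\<exists>p. finds_witness_in_linear_time p lpic_witness_empty_ok"
    using solves[of "Assign 0 1" False] by auto
qed

end
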